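(* Let $q\in(-1,1)$ and $n\ge1$. For any $x_1,\dots,x_n\in H$ and any $\epsilon=(\epsilon(1),\dots,\epsilon(n))\in\{1,\ast\}^n$, writing $d_q^{1}(x):=d_q(x)$ and $d_q^{\ast}(x)$ for the creation operator, $$d_q^{\epsilon(1)}(x_1)\cdots d_q^{\epsilon(n)}(x_n)\Omega=\sum_{(\pi,f)\in\mathcal{P}^D_{1,2;\epsilon}(n)}q^{\mathrm{cr}(\pi)+\mathrm{cs}(\pi)+2\,\mathrm{cnp}(\pi,f)+2\,\mathrm{npssr}(\pi,f)}\prod_{\substack{\{i<j\}\in\mathrm{Pair}(\pi)\\ f(\{i<j\})=1}}\langle x_i,x_j\rangle\prod_{\substack{\{i<j\}\in\mathrm{Pair}(\pi)\\ f(\{i<j\})=-1}}\langle x_i,\overline{x}_j\rangle\bigotimes_{i\in\mathrm{Sing}(\pi,f)}x_i ,$$ where, if the singletons of $\pi$ are $v_1<\cdots<v_m$, $\bigotimes_{i\in\mathrm{Sing}(\pi,f)}x_i$ denotes $x_{v_1}\otimes\cdots\otimes x_{v_m}$ if $(\pi,f)$ has no negative singleton and $x_{v_1}\otimes\cdots\otimes x_{v_{m-1}}\otimes\overline{x}_{v_m}$ if the rightmost singleton $\{v_m\}$ is negative (colored $-1$), with the convention that it equals $\Omega$ if $\pi$ has no singletons.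
   Context: Fock space. $H$ is a complex Hilbert space with inner product $\langle\cdot,\cdot\rangle$ linear in the right argument and antilinear in the left one; $x\mapsto\overline{x}$ is a fixed selfadjoint involution on $H$, i.e. a bounded selfadjoint linear operator whose square is the identity. Let $B(n)$ be the group of permutations $\sigma$ of $\{\pm1,\dots,\pm n\}$ with $\sigma(-k)=-\sigma(k)$; put $\pi_i=(i,i+1)(-i,-i-1)$ for $1\le i\le n-1$, $\overline{\pi}_n=(n,-n)$ and $\widehat{\pi}_{n-1}=\overline{\pi}_n\pi_{n-1}\overline{\pi}_n$. The Coxeter group $D(n)$ of type D is $D(1)=\{e\}$ and, for $n\ge2$, the subgroup of $B(n)$ generated by $\pi_1,\dots,\pi_{n-1},\widehat{\pi}_{n-1}$; $\ell(\sigma)$ is the minimal number of these generators in a product expression of $\sigma\in D(n)$. For $n\ge 2$, $D(n)$ acts on $H^{\otimes n}$ by $\pi_i(x_1\otimes\cdots\otimes x_n)=x_1\otimes\cdots\otimes x_{i-1}\otimes x_{i+1}\otimes x_i\otimes x_{i+2}\otimes\cdots\otimes x_n$ and $\widehat{\pi}_{n-1}(x_1\otimes\cdots\otimes x_n)=x_1\otimes\cdots\otimes x_{n-2}\otimes\overline{x}_n\otimes\overline{x}_{n-1}$; $D(1)$ acts trivially on $H$. Put $\widehat{P}_q^{(n)}=\sum_{\sigma\in D(n)}q^{\ell(\sigma)}\sigma$ for $n\ge1$ and $\widehat P_q^{(0)}=I$ (convention $0^0=1$). Let $\mathcal{F}_{\rm fin}(H)=\bigoplus_{n\ge0}H^{\otimes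 n}$ be the algebraic direct sum, $H^{\otimes0}=\mathbb{C}\Omega$ with $\Omega$ a unit vector, with the usual inner product $\langle x_1\otimes\cdots\otimes x_m,y_1\otimes\cdots\otimes y_n\rangle_0=\delta_{m,n}\prod_i\langle x_i,y_i\rangle$, and $\widehat P_q=\bigoplus_n\widehat P_q^{(n)}$. For $q\in(-1,1)$, $\widehat P_q$ is known to be strictly positive, so $\langle f,g\rangle_q:=\langle f,\widehat P_q g\rangle_0$ is an inner product. The creation operator is $d_q^\ast(x)(x_1\otimes\cdots\otimes x_n)=x\otimes x_1\otimes\cdots\otimes x_n$, $d_q^\ast(x)\Omega=x$, and $d_q(x)$ is its adjoint with respect to $\langle\cdot,\cdot\rangle_q$. Combinatorics. $[n]=\{1,\dots,n\}$. $\mathcal{P}_{1,2}(n)$ is the set of partitions of $[n]$ with blocks of size 1 (singletons) or 2 (pairs); $\mathrm{Pair}(\pi)$, $\mathrm{Sing}(\pi)$ are the sets of pairs and singletons of $\pi$. A set $A$ covers a set $B$ if there are $i,j\in A$ with $i<k<j$ for all $k\in B$. $W$ is on the right of $V$ if $\min V<\min W$, and on the strict right of $V$ if $\max V<\min W$. For $V\in\pi$: $\mathrm{cover}(V)=\#\{W\in\pi:W\text{ covers }V\}$; $\mathrm{sr}(V)$ is the number of singletons of $\pi$ on the right of $V$; $\mathrm{lcr}(V)=\#\{W\in\pi:\exists i,j\in V,\ k,l\in W,\ k<i<l<j\}$; $\mathrm{cr}(\pi)=\sum_{V\in\pi}\mathrm{lcr}(V)$; $\mathrm{cs}(\pi)=\#\{(S,W)\in\mathrm{Sing}(\pi)\times\pi: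 W\text{ covers }S\}$. For a coloring $f:\pi\to\{\pm1\}$, a block of color $-1$ is called negative; $\mathrm{np}(\pi,f)$ is the number of negative pairs; $\mathrm{npr}(V)$ is the number of negative pairs on the right of $V$; $\mathrm{cnp}(\pi,f)=\#\{(V,W): V\text{ a negative pair},\ W\in\mathrm{Pair}(\pi),\ W\text{ covers }V\}$; $\mathrm{npssr}(\pi,f)=\#\{(V,S):V\text{ a negative pair},\ S\in\mathrm{Sing}(\pi),\ S\text{ on the strict right of }V\}$. $\mathcal{P}^D_{1,2}(n)$ (partitions of type D) is the set of $(\pi,f)$ with $\pi\in\mathcal{P}_{1,2}(n)$, $f:\pi\to\{\pm1\}$, such that: (A) every pair $V$ with $\mathrm{sr}(V)=\mathrm{lcr}(V)=\mathrm{cover}(V)=0$ has color $f(V)=(-1)^{\mathrm{npr}(V)}$ (all other pairs may have any color); (B) the rightmost singleton (if there is one) has color $(-1)^{\mathrm{np}(\pi,f)}$, and every other singleton has color $1$. $\mathcal{P}^D_{1,2;\epsilon}(n)$ is the set of $(\pi,f)\in\mathcal{P}^D_{1,2}(n)$ such that $\pi$ is $\epsilon$-compatible: $\epsilon(i)=1$ and $\epsilon(j)=\ast$ for every pair $\{i<j\}\in\pi$, and $\epsilon(s)=\ast$ for every singleton $\{s\}\in\pi$. A sum over the empty set is $0$. *)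

theory Defs
  imports
    Complex_Main
    "HOL-Library.Poly_Mapping"
    "HOL-Library.Disjoint_Sets"
    "HOL-Library.FuncSet"
    "HOL-Combinatorics.Transposition"
begin

section \<open>Complex vector spaces and complex Hilbert spaces\<close>

class complex_vector = ab_group_add +
  fixes scaleC :: "complex \<Rightarrow> 'a \<Rightarrow> 'a"  (infixr "*\<^sub>C" 75)
  assumes scaleC_add_right: "a *\<^sub>C (x + y) = a *\<^sub>C x + a *\<^sub>C y"
    and scaleC_add_left: "(a + b) *\<^sub>C x = a *\<^sub>C x + b *\<^sub>C x"
    and scaleC_scaleC: "a *\<^sub>C b *\<^sub>C x = (a * b) *\<^sub>C x"
    and scaleC_one: "1 *\<^sub>C x = x"

global_interpretation complex_vector: vector_space "scaleC :: complex \<Rightarrow> 'a \<Rightarrow> 'a::complex_vector"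
  by unfold_locales (simp_all add: scaleC_add_right scaleC_add_left scaleC_scaleC scaleC_one)

text \<open>The inner product is antilinear in the left argument; linearity in the right one follows
  from \<open>cinner_commute\<close>.  Completeness comes from class \<^class>\<open>banach\<close>.\<close>

class chilbert_space = complex_vector + banach +
  fixes cinner :: "'a \<Rightarrow> 'a \<Rightarrow> complex"
  assumes scaleR_scaleC: "r *\<^sub>R x = complex_of_real r *\<^sub>C x"
    and cinner_commute: "cinner x y = cnj (cinner y x)"
    and cinner_add_left: "cinner (x + y) z = cinner x z + cinner y z"
    and cinner_scaleC_left: "cinner (c *\<^sub>C x) y = cnj c * cinner x y"
    and cinner_ge_zero: "0 \<le> Re (cinner x x)"
    and cinner_eq_zero_iff: "cinner x x = 0 \<longleftrightarrow> x = 0"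
    and norm_eq_sqrt_cinner: "norm x = sqrt (Re (cinner x x))"

lemma cinner_add_right:
  fixes x y z :: "'h::chilbert_space"
  shows "cinner x (y + z) = cinner x y + cinner x z"
  by (metis cinner_commute cinner_add_left complex_cnj_add)

lemma cinner_scaleC_right:
  fixes x y :: "'h::chilbert_space"
  shows "cinner x (c *\<^sub>C y) = c * cinner x y"
  by (metis cinner_commute cinner_scaleC_left complex_cnj_cnj complex_cnj_mult)

instantiation complex :: chilbert_space
begin
definition scaleC_complex :: "complex \<Rightarrow> complex \<Rightarrow> complex" where "scaleC_complex c x = c * x"
definition cinner_complex :: "complex \<Rightarrow> complex \<Rightarrow> complex" where "cinner_complex x y = cnj x * y"
instance
  by standard
    (auto simp: scaleC_complex_def cinner_complex_def algebra_simps scaleR_conv_of_real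
        cmod_def power2_eq_square)
end

definition selfadjoint_involution :: "('h::chilbert_space \<Rightarrow> 'h) \<Rightarrow> bool" where
  "selfadjoint_involution J \<longleftrightarrow>
     bounded_linear J \<and> (\<forall>c x. J (c *\<^sub>C x) = c *\<^sub>C J x) \<and>
     (\<forall>x y. cinner (J x) y = cinner x (J y)) \<and> (\<forall>x. J (J x) = x)"


section \<open>The algebraic full Fock space\<close>

instantiation poly_mapping :: (type, complex_vector) complex_vector
begin
definition scaleC_poly_mapping :: "complex \<Rightarrow> ('a \<Rightarrow>\<^sub>0 'b) \<Rightarrow> ('a \<Rightarrow>\<^sub>0 'b)"
  where "scaleC_poly_mapping c p = Poly_Mapping.map (scaleC c) p"

lemma lookup_scaleC [simp]: "Poly_Mapping.lookup (c *\<^sub>C p) k = c *\<^sub>C Poly_Mapping.lookup p k"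
  by (simp add: scaleC_poly_mapping_def Poly_Mapping.map.rep_eq when_def)

instance
  by standard
    (auto intro!: poly_mapping_eqI simp: lookup_add scaleC_add_right scaleC_add_left
      scaleC_scaleC scaleC_one)
end

text \<open>The direct sum of all \<open>H\<^sup>\<otimes>\<^sup>n\<close> is the quotient of the free complex vector space on
  finite lists over \<open>H\<close> (the list \<open>[x\<^sub>1, \<dots>, x\<^sub>n]\<close> standing for the elementary tensor
  \<open>x\<^sub>1 \<otimes> \<dots> \<otimes> x\<^sub>n\<close>) by the relations of multilinearity.\<close>

definition tensor_relations :: "('h::complex_vector list \<Rightarrow>\<^sub>0 complex) set" where
  "tensor_relations =
     {Poly_Mapping.single (xs @ (x + y) # ys) 1
        - Poly_Mapping.single (xs @ x # ys) 1 - Poly_Mapping.single (xs @ y # ys) 1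
      | xs x y ys. True}
     \<union> {Poly_Mapping.single (xs @ (c *\<^sub>C x) # ys) 1
        - c *\<^sub>C Poly_Mapping.single (xs @ x # ys) 1
      | xs c x ys. True}"

definition tensor_eq :: "('h::complex_vector list \<Rightarrow>\<^sub>0 complex) \<Rightarrow> ('h list \<Rightarrow>\<^sub>0 complex) \<Rightarrow> bool" where
  "tensor_eq p r \<longleftrightarrow> p - r \<in> complex_vector.span tensor_relations"

lemma tensor_eq_refl: "tensor_eq p p"
  by (simp add: tensor_eq_def complex_vector.span_zero)

lemma tensor_eq_minus:
  assumes "tensor_eq p r" shows "tensor_eq (- p) (- r)"
  using complex_vector.span_neg[OF assms[unfolded tensor_eq_def]] by (simp add: tensor_eq_def)

lemma tensor_eq_add:
  assumes "tensor_eq p r" "tensor_eq p' r'" shows "tensor_eq (p + p') (r + r')"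
proof -
  have "(p + p') - (r + r') = (p - r) + (p' - r')" by (rule add_diff_add)
  then show ?thesis
    using complex_vector.span_add[OF assms[unfolded tensor_eq_def]] by (simp only: tensor_eq_def)
qed

lemma tensor_eq_scaleC:
  assumes "tensor_eq p r" shows "tensor_eq (c *\<^sub>C p) (c *\<^sub>C r)"
  unfolding tensor_eq_def complex_vector.scale_right_diff_distrib[symmetric]
  by (rule complex_vector.span_scale) (use assms in \<open>simp only: tensor_eq_def\<close>)

quotient_type (overloaded) 'h fock = "'h::complex_vector list \<Rightarrow>\<^sub>0 complex" / tensor_eq
proof (rule equivpI)
  show "reflp (tensor_eq :: ('h list \<Rightarrow>\<^sub>0 complex) \<Rightarrow> _)"
    by (rule reflpI) (rule tensor_eq_refl)
  show "symp (tensor_eq :: ('h list \<Rightarrow>\<^sub>0 complex) \<Rightarrow> _)"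
  proof (rule sympI)
    fix p r :: "'h list \<Rightarrow>\<^sub>0 complex"
    assume "tensor_eq p r"
    then have "- (p - r) \<in> complex_vector.span tensor_relations"
      unfolding tensor_eq_def by (rule complex_vector.span_neg)
    then show "tensor_eq r p" by (simp add: tensor_eq_def)
  qed
  show "transp (tensor_eq :: ('h list \<Rightarrow>\<^sub>0 complex) \<Rightarrow> _)"
  proof (rule transpI)
    fix p r s :: "'h list \<Rightarrow>\<^sub>0 complex"
    assume "tensor_eq p r" "tensor_eq r s"
    then have "(p - r) + (r - s) \<in> complex_vector.span tensor_relations"
      unfolding tensor_eq_def by (rule complex_vector.span_add)
    then show "tensor_eq p s" by (simp add: tensor_eq_def)
  qed
qed

instantiation fock :: (complex_vector) complex_vector
begin

lift_definition zero_fock :: "'a fock" is 0 .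

lift_definition plus_fock :: "'a fock \<Rightarrow> 'a fock \<Rightarrow> 'a fock" is "(+)"
  by (rule tensor_eq_add)

lift_definition uminus_fock :: "'a fock \<Rightarrow> 'a fock" is uminus
  by (rule tensor_eq_minus)

lift_definition minus_fock :: "'a fock \<Rightarrow> 'a fock \<Rightarrow> 'a fock" is "(-)"
  unfolding diff_conv_add_uminus by (intro tensor_eq_add tensor_eq_minus)

lift_definition scaleC_fock :: "complex \<Rightarrow> 'a fock \<Rightarrow> 'a fock" is scaleC
  by (rule tensor_eq_scaleC)

instance
proof
  fix a b c :: "'a fock" and r s :: complex
  show "a + b + c = a + (b + c)" by transfer (simp add: tensor_eq_refl add.assoc)
  show "a + b = b + a" by transfer (simp add: tensor_eq_refl add.commute)
  show "0 + a = a" by transfer (simp add: tensor_eq_refl)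
  show "- a + a = 0" by transfer (simp add: tensor_eq_refl)
  show "a - b = a + - b" by transfer (simp add: tensor_eq_refl)
  show "r *\<^sub>C (a + b) = r *\<^sub>C a + r *\<^sub>C b"
    by transfer (simp add: tensor_eq_refl scaleC_add_right)
  show "(r + s) *\<^sub>C a = r *\<^sub>C a + s *\<^sub>C a"
    by transfer (simp add: tensor_eq_refl scaleC_add_left)
  show "r *\<^sub>C s *\<^sub>C a = (r * s) *\<^sub>C a"
    by transfer (simp add: tensor_eq_refl scaleC_scaleC)
  show "1 *\<^sub>C a = a" by transfer (simp add: tensor_eq_refl scaleC_one)
qed

end

lift_definition tens :: "'h::complex_vector list \<Rightarrow> 'h fock" is "\<lambda>xs. Poly_Mapping.single xs 1" .

definition vacuum :: "'h::complex_vector fock"  ("\<Omega>") where "\<Omega> = tens []"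

definition multilinear :: "('h::complex_vector list \<Rightarrow> 'v::complex_vector) \<Rightarrow> bool" where
  "multilinear \<phi> \<longleftrightarrow>
     (\<forall>xs x y ys. \<phi> (xs @ (x + y) # ys) = \<phi> (xs @ x # ys) + \<phi> (xs @ y # ys)) \<and>
     (\<forall>xs c x ys. \<phi> (xs @ (c *\<^sub>C x) # ys) = c *\<^sub>C \<phi> (xs @ x # ys))"

definition free_ext :: "('a \<Rightarrow> 'v::complex_vector) \<Rightarrow> ('a \<Rightarrow>\<^sub>0 complex) \<Rightarrow> 'v" where
  "free_ext \<phi> p = (\<Sum>k\<in>Poly_Mapping.keys p. Poly_Mapping.lookup p k *\<^sub>C \<phi> k)"

text \<open>For multilinear \<open>\<phi>\<close> this is the linear map with value \<open>\<phi> [x\<^sub>1, \<dots>, x\<^sub>n]\<close> at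
  \<open>x\<^sub>1 \<otimes> \<dots> \<otimes> x\<^sub>n\<close>, see \<open>fock_lift_tens\<close>, \<open>fock_lift_add\<close> and \<open>fock_lift_scaleC\<close> below; the
  chosen representative then does not matter.\<close>

definition fock_lift :: "('h::complex_vector list \<Rightarrow> 'v::complex_vector) \<Rightarrow> 'h fock \<Rightarrow> 'v" where
  "fock_lift \<phi> F = free_ext \<phi> (rep_fock F)"

lemma free_ext_superset:
  assumes "finite A" "Poly_Mapping.keys p \<subseteq> A"
  shows "free_ext \<phi> p = (\<Sum>k\<in>A. Poly_Mapping.lookup p k *\<^sub>C \<phi> k)"
  unfolding free_ext_def
  by (rule sum.mono_neutral_left) (use assms in \<open>auto simp: in_keys_iff\<close>)

lemma free_ext_add: "free_ext \<phi> (p + r) = free_ext \<phi> p + free_ext \<phi> r"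
proof -
  let ?A = "Poly_Mapping.keys p \<union> Poly_Mapping.keys r"
  have "free_ext \<phi> (p + r) = (\<Sum>k\<in>?A. Poly_Mapping.lookup (p + r) k *\<^sub>C \<phi> k)"
    using Poly_Mapping.keys_add[of p r] by (intro free_ext_superset) auto
  moreover have "free_ext \<phi> p = (\<Sum>k\<in>?A. Poly_Mapping.lookup p k *\<^sub>C \<phi> k)"
    by (intro free_ext_superset) auto
  moreover have "free_ext \<phi> r = (\<Sum>k\<in>?A. Poly_Mapping.lookup r k *\<^sub>C \<phi> k)"
    by (intro free_ext_superset) auto
  ultimately show ?thesis
    by (simp add: lookup_add scaleC_add_left sum.distrib)
qed

lemma free_ext_scaleC: "free_ext \<phi> (c *\<^sub>C p) = c *\<^sub>C free_ext \<phi> p"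
proof -
  have "free_ext \<phi> (c *\<^sub>C p) = (\<Sum>k\<in>Poly_Mapping.keys p. Poly_Mapping.lookup (c *\<^sub>C p) k *\<^sub>C \<phi> k)"
    by (intro free_ext_superset) (auto simp: in_keys_iff)
  then show ?thesis
    by (simp add: free_ext_def complex_vector.scale_sum_right scaleC_complex_def scaleC_scaleC)
qed

lemma free_ext_diff: "free_ext \<phi> (p - r) = free_ext \<phi> p - free_ext \<phi> r"
  by (metis add_diff_cancel_right' diff_add_cancel free_ext_add)

lemma free_ext_single: "free_ext \<phi> (Poly_Mapping.single k 1) = \<phi> k"
  by (simp add: free_ext_def scaleC_one)

lemma free_ext_span:
  assumes "multilinear \<phi>" "p \<in> complex_vector.span tensor_relations"
  shows "free_ext \<phi> p = 0"
  using assms(2)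
proof (induction rule: complex_vector.span_induct_alt)
  case base
  then show ?case by (simp add: free_ext_def)
next
  case (step c x y)
  have "free_ext \<phi> x = 0"
    using step(1) assms(1) unfolding tensor_relations_def multilinear_def
    by (auto simp: free_ext_diff free_ext_single free_ext_scaleC)
  then show ?case using step by (simp add: free_ext_add free_ext_scaleC)
qed

lemma fock_lift_abs:
  assumes "multilinear \<phi>"
  shows "fock_lift \<phi> (abs_fock p) = free_ext \<phi> p"
proof -
  have "tensor_eq (rep_fock (abs_fock p)) p"
    by (meson Quotient3_fock fock.abs_eq_iff Quotient3_abs_rep)
  then show ?thesis
    using free_ext_span[OF assms] unfolding tensor_eq_def fock_lift_def
    by (metis free_ext_diff eq_iff_diff_eq_0)
qed

lemma fock_lift_tens:
  assumes "multilinear \<phi>"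
  shows "fock_lift \<phi> (tens xs) = \<phi> xs"
  by (simp add: tens.abs_eq fock_lift_abs[OF assms] free_ext_single)

lemma fock_lift_add:
  assumes "multilinear \<phi>"
  shows "fock_lift \<phi> (F + G) = fock_lift \<phi> F + fock_lift \<phi> G"
  by (induct F rule: fock.abs_induct, induct G rule: fock.abs_induct)
     (simp add: plus_fock.abs_eq fock_lift_abs[OF assms] free_ext_add)

lemma fock_lift_scaleC:
  assumes "multilinear \<phi>"
  shows "fock_lift \<phi> (c *\<^sub>C F) = c *\<^sub>C fock_lift \<phi> F"
  by (induct F rule: fock.abs_induct)
     (simp add: scaleC_fock.abs_eq fock_lift_abs[OF assms] free_ext_scaleC)

lemma multilinear_tens: "multilinear (tens :: 'h::complex_vector list \<Rightarrow> 'h fock)"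
proof -
  have "tens (xs @ (x + y) # ys) = tens (xs @ x # ys) + (tens (xs @ y # ys) :: 'h fock)"
    for xs x y ys
  proof transfer
    fix xs ys :: "'h list" and x y :: 'h
    show "tensor_eq (Poly_Mapping.single (xs @ (x + y) # ys) 1)
      (Poly_Mapping.single (xs @ x # ys) 1 + Poly_Mapping.single (xs @ y # ys) 1)"
      unfolding tensor_eq_def diff_diff_eq[symmetric]
      by (rule complex_vector.span_base) (unfold tensor_relations_def, blast)
  qed
  moreover have "tens (xs @ (c *\<^sub>C x) # ys) = c *\<^sub>C (tens (xs @ x # ys) :: 'h fock)" for xs c x ys
  proof transfer
    fix xs ys :: "'h list" and x :: 'h and c
    show "tensor_eq (Poly_Mapping.single (xs @ (c *\<^sub>C x) # ys) 1)
      (c *\<^sub>C Poly_Mapping.single (xs @ x # ys) 1)"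
      unfolding tensor_eq_def
      by (rule complex_vector.span_base) (unfold tensor_relations_def, blast)
  qed
  ultimately show ?thesis by (auto simp: multilinear_def)
qed

lemma fock_induct [case_names tens add scaleC]:
  fixes F :: "'h::complex_vector fock"
  assumes tens: "\<And>xs. P (tens xs)"
    and add: "\<And>F G. P F \<Longrightarrow> P G \<Longrightarrow> P (F + G)"
    and scaleC: "\<And>c F. P F \<Longrightarrow> P (c *\<^sub>C F)"
  shows "P F"
proof -
  have zero: "P 0" using scaleC[OF tens, of 0 "[]"] by simp
  have single_P: "P (abs_fock (Poly_Mapping.single xs c))" for xs c
  proof -
    have "Poly_Mapping.single xs c = c *\<^sub>C Poly_Mapping.single xs 1"
      by (rule poly_mapping_eqI) (simp add: lookup_single scaleC_complex_def when_def)
    then show ?thesis using scaleC[OF tens, of c xs] by (simp add: tens.abs_eq scaleC_fock.abs_eq)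
  qed
  have sum_P: "P (abs_fock (\<Sum>k\<in>A. Poly_Mapping.single k (c k)))" if "finite A" for A c
    using that
  proof induction
    case empty
    then show ?case using zero by (simp add: zero_fock.abs_eq)
  next
    case (insert k A)
    then show ?case using add[OF single_P] by (simp add: plus_fock.abs_eq[symmetric])
  qed
  have "p = (\<Sum>k\<in>Poly_Mapping.keys p. Poly_Mapping.single k (Poly_Mapping.lookup p k))"
    for p :: "'h list \<Rightarrow>\<^sub>0 complex"
    by (rule poly_mapping_eqI) (simp add: lookup_sum lookup_single when_def in_keys_iff)
  then have "P (abs_fock p)" for p
    using sum_P[OF finite_keys, of "Poly_Mapping.lookup p" p] by simp
  then show ?thesis by (induct F rule: fock.abs_induct)
qed

fun tensor_inner :: "'h::chilbert_space list \<Rightarrow> 'h list \<Rightarrow> complex" where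
  "tensor_inner [] [] = 1"
| "tensor_inner (x # xs) (y # ys) = cinner x y * tensor_inner xs ys"
| "tensor_inner _ _ = 0"

text \<open>The sesquilinear extension of \<^const>\<open>tensor_inner\<close>: the inner lift is
  \<open>\<langle>y\<^sub>1 \<otimes> \<dots> \<otimes> y\<^sub>n, F\<rangle>\<^sub>0\<close>, linear in \<open>F\<close>.\<close>

definition inner0 :: "'h::chilbert_space fock \<Rightarrow> 'h fock \<Rightarrow> complex" where
  "inner0 F G = fock_lift (\<lambda>ys. cnj (fock_lift (tensor_inner ys) F)) G"

lemma tensor_inner_commute: "tensor_inner xs ys = cnj (tensor_inner ys xs)"
  by (induction xs ys rule: tensor_inner.induct) (simp_all, metis cinner_commute)

lemma multilinear_tensor_inner: "multilinear (tensor_inner ws)"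
proof -
  have "tensor_inner ws (xs @ (x + y) # ys) = tensor_inner ws (xs @ x # ys) + tensor_inner ws (xs @ y # ys)"
    for xs x y ys
    by (induction xs arbitrary: ws; case_tac ws) (auto simp: cinner_add_right algebra_simps)
  moreover have "tensor_inner ws (xs @ (c *\<^sub>C x) # ys) = c *\<^sub>C tensor_inner ws (xs @ x # ys)" for xs c x ys
    by (induction xs arbitrary: ws; case_tac ws) (auto simp: cinner_scaleC_right scaleC_complex_def)
  ultimately show ?thesis by (auto simp: multilinear_def)
qed

lemma tensor_inner_lift_left:
  "multilinear (\<lambda>ys. cnj (fock_lift (tensor_inner ys) (F :: 'h::chilbert_space fock)))"
proof (induction F rule: fock_induct)
  case (tens xs)
  then show ?case
    using multilinear_tensor_inner[of xs]
    by (simp add: fock_lift_tens multilinear_tensor_inner tensor_inner_commute[symmetric])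
next
  case (add F G)
  then show ?case
    by (simp add: multilinear_def fock_lift_add[OF multilinear_tensor_inner] scaleC_add_right algebra_simps)
next
  case (scaleC c F)
  then show ?case
    by (simp add: multilinear_def fock_lift_scaleC[OF multilinear_tensor_inner] scaleC_complex_def algebra_simps)
qed

lemma inner0_tens: "inner0 (tens xs) (tens ys) = tensor_inner xs ys"
  by (simp add: inner0_def fock_lift_tens tensor_inner_lift_left multilinear_tensor_inner
      tensor_inner_commute[symmetric])

lemma inner0_add_right: "inner0 F (G + G') = inner0 F G + inner0 F G'"
  by (simp add: inner0_def fock_lift_add tensor_inner_lift_left)

lemma inner0_scaleC_right: "inner0 F (c *\<^sub>C G) = c * inner0 F G"
  by (simp add: inner0_def fock_lift_scaleC tensor_inner_lift_left scaleC_complex_def)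

lemma inner0_tens_right: "inner0 F (tens ys) = cnj (fock_lift (tensor_inner ys) F)"
  unfolding inner0_def by (rule fock_lift_tens[OF tensor_inner_lift_left])

lemma inner0_add_left: "inner0 (F + F') G = inner0 F G + inner0 F' G"
proof (induction G rule: fock_induct)
  case (tens xs)
  show ?case by (simp add: inner0_tens_right fock_lift_add[OF multilinear_tensor_inner])
qed (simp_all add: inner0_add_right inner0_scaleC_right algebra_simps)

lemma inner0_scaleC_left: "inner0 (c *\<^sub>C F) G = cnj c * inner0 F G"
proof (induction G rule: fock_induct)
  case (tens xs)
  show ?case
    by (simp add: inner0_tens_right fock_lift_scaleC[OF multilinear_tensor_inner] scaleC_complex_def)
qed (simp_all add: inner0_add_right inner0_scaleC_right algebra_simps)

lemma inner0_commute: "inner0 F G = cnj (inner0 G F)"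
proof (induction F rule: fock_induct)
  case (tens xs)
  show ?case
  proof (induction G rule: fock_induct)
    case (tens ys)
    show ?case unfolding inner0_tens by (rule tensor_inner_commute)
  next
    case (add G G')
    then show ?case by (simp add: inner0_add_right inner0_add_left)
  next
    case (scaleC c G)
    then show ?case by (simp add: inner0_scaleC_right inner0_scaleC_left)
  qed
next
  case (add F F')
  have "inner0 (F + F') G = cnj (inner0 G F) + cnj (inner0 G F')"
    by (simp only: inner0_add_left add)
  then show ?case by (simp add: inner0_add_right)
next
  case (scaleC c F)
  have "inner0 (c *\<^sub>C F) G = cnj c * cnj (inner0 G F)"
    by (simp only: inner0_scaleC_left scaleC)
  then show ?case by (simp add: inner0_scaleC_right)
qed


section \<open>The Coxeter group of type D and its action\<close>

text \<open>Permutations of \<open>{\<plusminus>1, \<dots>, \<plusminus>n}\<close> are functions on \<open>int\<close> fixing everything else.\<close>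

definition signed_perms :: "nat \<Rightarrow> (int \<Rightarrow> int) set" where
  "signed_perms n = {\<sigma>. bij \<sigma> \<and> (\<forall>k. \<sigma> (- k) = - \<sigma> k) \<and> (\<forall>k. \<bar>k\<bar> > int n \<longrightarrow> \<sigma> k = k)}"

definition pi_gen :: "nat \<Rightarrow> int \<Rightarrow> int" where
  "pi_gen i = transpose (int i) (int i + 1) \<circ> transpose (- int i) (- int i - 1)"

definition bar_pi :: "nat \<Rightarrow> int \<Rightarrow> int" where
  "bar_pi n = transpose (int n) (- int n)"

text \<open>\<open>hat_pi_gen i\<close> is the generator \<open>\<pi>\<^sub>i\<close> with a hat, to be used with \<open>i = n - 1\<close>.\<close>

definition hat_pi_gen :: "nat \<Rightarrow> int \<Rightarrow> int" where
  "hat_pi_gen i = bar_pi (Suc i) \<circ> pi_gen i \<circ> bar_pi (Suc i)"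

definition D_gens :: "nat \<Rightarrow> (int \<Rightarrow> int) set" where
  "D_gens n = (if n \<ge> 2 then pi_gen ` {1..n - 1} \<union> {hat_pi_gen (n - 1)} else {})"

definition word_prod :: "(int \<Rightarrow> int) list \<Rightarrow> int \<Rightarrow> int" where
  "word_prod w = foldr (\<circ>) w id"

text \<open>The generators are involutions, so the generated subgroup consists of the products of
  generators.\<close>

definition D_group :: "nat \<Rightarrow> (int \<Rightarrow> int) set" where
  "D_group n = {word_prod w | w. set w \<subseteq> D_gens n}"

definition D_length :: "nat \<Rightarrow> (int \<Rightarrow> int) \<Rightarrow> nat" where
  "D_length n \<sigma> = (LEAST k. \<exists>w. set w \<subseteq> D_gens n \<and> word_prod w = \<sigma> \<and> length w = k)"

definition signed_nth :: "('h \<Rightarrow> 'h) \<Rightarrow> 'h list \<Rightarrow> int \<Rightarrow> 'h" where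
  "signed_nth J xs k = (if k < 0 then J (xs ! (nat (- k) - 1)) else xs ! (nat k - 1))"

text \<open>The action on \<open>x\<^sub>1 \<otimes> \<dots> \<otimes> x\<^sub>n\<close>: the \<open>i\<close>-th factor of the image under \<open>\<sigma>\<close> is
  the one with signed index \<open>\<sigma>\<^sup>-\<^sup>1(i)\<close>, where index \<open>-k\<close> means \<open>J x\<^sub>k\<close>.  By \<open>signed_act_comp\<close>,
  \<open>signed_act_pi_gen\<close> and \<open>signed_act_hat_pi_gen\<close> below this is the group action with the prescribed
  values on generators.\<close>

definition signed_act :: "('h \<Rightarrow> 'h) \<Rightarrow> (int \<Rightarrow> int) \<Rightarrow> 'h list \<Rightarrow> 'h list" where
  "signed_act J \<sigma> xs = map (\<lambda>i. signed_nth J xs (inv \<sigma> (int i))) [1..<Suc (length xs)]"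

lemma length_signed_act [simp]: "length (signed_act J \<sigma> xs) = length xs"
  by (simp add: signed_act_def del: upt_Suc)

lemma pi_gen_apply:
  assumes "1 \<le> i"
  shows "pi_gen i k = (if k = int i then int i + 1 else if k = int i + 1 then int i
    else if k = - int i then - int i - 1 else if k = - int i - 1 then - int i else k)"
proof -
  consider "k = int i" | "k = int i + 1" | "k = - int i" | "k = - int i - 1"
    | "k \<noteq> int i" "k \<noteq> int i + 1" "k \<noteq> - int i" "k \<noteq> - int i - 1" by blast
  then show ?thesis
    by cases (use assms in \<open>simp_all add: pi_gen_def transpose_def\<close>)
qed

lemma hat_pi_gen_apply:
  assumes "1 \<le> i"
  shows "hat_pi_gen i k = (if k = int i then - int i - 1 else if k = int i + 1 then - int i
    else if k = - int i then int i + 1 else if k = - int i - 1 then int i else k)"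
proof -
  consider "k = int i" | "k = int i + 1" | "k = - int i" | "k = - int i - 1"
    | "k \<noteq> int i" "k \<noteq> int i + 1" "k \<noteq> - int i" "k \<noteq> - int i - 1" by blast
  then show ?thesis
    by cases (use assms in \<open>simp_all add: hat_pi_gen_def bar_pi_def pi_gen_apply transpose_def\<close>)
qed

lemma pi_gen_invol: "1 \<le> i \<Longrightarrow> pi_gen i (pi_gen i k) = k"
  by (simp add: pi_gen_apply)

lemma hat_pi_gen_invol: "1 \<le> i \<Longrightarrow> hat_pi_gen i (hat_pi_gen i k) = k"
  by (simp add: hat_pi_gen_apply)

lemma inv_pi_gen: "1 \<le> i \<Longrightarrow> inv (pi_gen i) = pi_gen i"
  by (rule inv_unique_comp) (simp_all add: fun_eq_iff pi_gen_invol)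

lemma inv_hat_pi_gen: "1 \<le> i \<Longrightarrow> inv (hat_pi_gen i) = hat_pi_gen i"
  by (rule inv_unique_comp) (simp_all add: fun_eq_iff hat_pi_gen_invol)

lemma pi_gen_in_signed_perms: "1 \<le> i \<Longrightarrow> i < n \<Longrightarrow> pi_gen i \<in> signed_perms n"
  using involuntory_imp_bij[of "pi_gen i"]
  by (simp add: signed_perms_def pi_gen_invol) (simp add: pi_gen_apply)

lemma hat_pi_gen_in_signed_perms: "1 \<le> i \<Longrightarrow> i < n \<Longrightarrow> hat_pi_gen i \<in> signed_perms n"
  using involuntory_imp_bij[of "hat_pi_gen i"]
  by (simp add: signed_perms_def hat_pi_gen_invol) (simp add: hat_pi_gen_apply)

lemma signed_perms_comp: "\<sigma> \<in> signed_perms n \<Longrightarrow> \<tau> \<in> signed_perms n \<Longrightarrow> \<sigma> \<circ> \<tau> \<in> signed_perms n"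
  by (auto simp: signed_perms_def bij_comp)

lemma D_group_subset: "D_group n \<subseteq> signed_perms n"
proof -
  have "set w \<subseteq> D_gens n \<Longrightarrow> word_prod w \<in> signed_perms n" for w
  proof (induction w)
    case Nil
    have "bij (\<lambda>k :: int. k)" by (simp add: bij_def)
    then show ?case by (simp add: word_prod_def signed_perms_def id_def)
  next
    case (Cons g w)
    then have "g \<in> signed_perms n"
      using pi_gen_in_signed_perms[of _ n] hat_pi_gen_in_signed_perms[of "n - 1" n]
      by (auto simp: D_gens_def split: if_splits)
    have "word_prod (g # w) = g \<circ> word_prod w" by (simp add: word_prod_def)
    moreover have "word_prod w \<in> signed_perms n" using Cons by simp
    ultimately show ?case using \<open>g \<in> signed_perms n\<close> by (simp only: signed_perms_comp)
  qed
  then show ?thesis by (auto simp: D_group_def)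
qed

lemma inv_signed_perm:
  assumes "\<sigma> \<in> signed_perms n"
  shows "inv \<sigma> (- k) = - inv \<sigma> k" "k \<noteq> 0 \<Longrightarrow> inv \<sigma> k \<noteq> 0" "\<bar>k\<bar> \<le> int n \<Longrightarrow> \<bar>inv \<sigma> k\<bar> \<le> int n"
proof -
  have b: "bij \<sigma>" and o: "\<And>k. \<sigma> (- k) = - \<sigma> k" and f: "\<And>k. \<bar>k\<bar> > int n \<Longrightarrow> \<sigma> k = k"
    using assms by (auto simp: signed_perms_def)
  show "inv \<sigma> (- k) = - inv \<sigma> k"
    by (metis b o bij_inv_eq_iff)
  have "\<sigma> 0 = 0" using o[of 0] by simp
  then show "k \<noteq> 0 \<Longrightarrow> inv \<sigma> k \<noteq> 0" by (metis b bij_inv_eq_iff)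
  show "\<bar>k\<bar> \<le> int n \<Longrightarrow> \<bar>inv \<sigma> k\<bar> \<le> int n" by (metis b bij_inv_eq_iff f linorder_not_less)
qed

lemma nth_signed_act:
  "i < length xs \<Longrightarrow> signed_act J \<sigma> xs ! i = signed_nth J xs (inv \<sigma> (int (Suc i)))"
  unfolding signed_act_def by (subst nth_map) (simp_all del: upt_Suc)

lemma signed_act_comp:
  assumes "\<And>x. J (J x) = x" "\<sigma> \<in> signed_perms (length xs)" "\<tau> \<in> signed_perms (length xs)"
  shows "signed_act J (\<sigma> \<circ> \<tau>) xs = signed_act J \<sigma> (signed_act J \<tau> xs)"
proof (rule nth_equalityI)
  fix i assume "i < length (signed_act J (\<sigma> \<circ> \<tau>) xs)"
  then have i: "i < length xs" by simp
  have inv: "inv (\<sigma> \<circ> \<tau>) = inv \<tau> \<circ> inv \<sigma>"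
    using assms by (simp add: o_inv_distrib signed_perms_def)
  have key: "signed_nth J (signed_act J \<tau> xs) k = signed_nth J xs (inv \<tau> k)"
    if k: "k \<noteq> 0" "\<bar>k\<bar> \<le> int (length xs)" for k
  proof (cases "k < 0")
    case False
    then have "nat k - 1 < length xs" "int (Suc (nat k - 1)) = k" using k by auto
    then show ?thesis using False by (simp add: signed_nth_def[of J "signed_act J \<tau> xs"] nth_signed_act)
  next
    case True
    then have "nat (- k) - 1 < length xs" "int (Suc (nat (- k) - 1)) = - k" using k by auto
    then have "signed_nth J (signed_act J \<tau> xs) k = J (signed_nth J xs (- inv \<tau> k))"
      using True inv_signed_perm(1)[OF assms(3)]
      by (simp add: signed_nth_def[of J "signed_act J \<tau> xs"] nth_signed_act)
    also have "\<dots> = signed_nth J xs (inv \<tau> k)"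
      using inv_signed_perm(2)[OF assms(3) k(1)] assms(1) by (auto simp: signed_nth_def)
    finally show ?thesis .
  qed
  have "inv \<sigma> (int (Suc i)) \<noteq> 0" "\<bar>inv \<sigma> (int (Suc i))\<bar> \<le> int (length xs)"
    using inv_signed_perm(2,3)[OF assms(2), of "int (Suc i)"] i by auto
  then show "signed_act J (\<sigma> \<circ> \<tau>) xs ! i = signed_act J \<sigma> (signed_act J \<tau> xs) ! i"
    using i by (simp add: nth_signed_act inv key del: of_nat_Suc)
qed simp

lemma signed_act_pi_gen:
  assumes "1 \<le> i" "i < length xs"
  shows "signed_act J (pi_gen i) xs = xs[i - 1 := xs ! i, i := xs ! (i - 1)]"
proof (rule nth_equalityI)
  fix j assume "j < length (signed_act J (pi_gen i) xs)"
  then have j: "j < length xs" by simp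
  have "pi_gen i (int (Suc j)) = int (if j = i - 1 then Suc i else if j = i then i else Suc j)"
    using assms by (auto simp: pi_gen_apply)
  then show "signed_act J (pi_gen i) xs ! j = xs[i - 1 := xs ! i, i := xs ! (i - 1)] ! j"
    using assms j by (auto simp: nth_signed_act inv_pi_gen signed_nth_def nth_list_update nat_add_distrib)
qed simp

lemma signed_act_hat_pi_gen:
  assumes "2 \<le> length xs" "n = length xs"
  shows "signed_act J (hat_pi_gen (n - 1)) xs = xs[n - 2 := J (xs ! (n - 1)), n - 1 := J (xs ! (n - 2))]"
proof (rule nth_equalityI)
  fix j assume "j < length (signed_act J (hat_pi_gen (n - 1)) xs)"
  then have j: "j < length xs" by simp
  obtain m where m: "n = Suc (Suc m)" using assms by (metis add_2_eq_Suc le_Suc_ex)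
  have act: "signed_act J (hat_pi_gen (n - 1)) xs ! j = signed_nth J xs (hat_pi_gen (Suc m) (int (Suc j)))"
    using j m by (simp add: nth_signed_act inv_hat_pi_gen del: of_nat_Suc)
  consider "j = m" | "j = Suc m" | "j < m" using j assms(2) m by linarith
  then show "signed_act J (hat_pi_gen (n - 1)) xs ! j =
      xs[n - 2 := J (xs ! (n - 1)), n - 1 := J (xs ! (n - 2))] ! j"
  proof cases
    case 1
    then have "hat_pi_gen (Suc m) (int (Suc j)) = - int (Suc (Suc m))"
      by (simp add: hat_pi_gen_apply)
    then show ?thesis unfolding act using 1 j m by (simp add: signed_nth_def nat_add_distrib)
  next
    case 2
    then have "hat_pi_gen (Suc m) (int (Suc j)) = - int (Suc m)"
      by (simp add: hat_pi_gen_apply)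
    then show ?thesis unfolding act using 2 j m by (simp add: signed_nth_def nat_add_distrib)
  next
    case 3
    then have "hat_pi_gen (Suc m) (int (Suc j)) = int (Suc j)"
      by (simp add: hat_pi_gen_apply)
    then show ?thesis unfolding act using 3 j m by (simp add: signed_nth_def nat_add_distrib)
  qed
qed simp


section \<open>The deformed inner product, creation and annihilation\<close>

definition Pq :: "real \<Rightarrow> ('h::complex_vector \<Rightarrow> 'h) \<Rightarrow> 'h fock \<Rightarrow> 'h fock" where
  "Pq q J = fock_lift (\<lambda>xs. \<Sum>\<sigma>\<in>D_group (length xs).
     complex_of_real (q ^ D_length (length xs) \<sigma>) *\<^sub>C tens (signed_act J \<sigma> xs))"

definition inner_q :: "real \<Rightarrow> ('h::chilbert_space \<Rightarrow> 'h) \<Rightarrow> 'h fock \<Rightarrow> 'h fock \<Rightarrow> complex" where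
  "inner_q q J f g = inner0 f (Pq q J g)"

definition creation :: "'h::complex_vector \<Rightarrow> 'h fock \<Rightarrow> 'h fock" where
  "creation x = fock_lift (\<lambda>xs. tens (x # xs))"

text \<open>The adjoint is unique because \<^const>\<open>inner_q\<close> is definite for \<open>-1 < q < 1\<close>.\<close>

definition annihilation :: "real \<Rightarrow> ('h::chilbert_space \<Rightarrow> 'h) \<Rightarrow> 'h \<Rightarrow> 'h fock \<Rightarrow> 'h fock" where
  "annihilation q J x =
     (THE T. \<forall>f g. inner_q q J (creation x f) g = inner_q q J f (T g))"

datatype exponent = One | Star

fun d_op :: "real \<Rightarrow> ('h::chilbert_space \<Rightarrow> 'h) \<Rightarrow> exponent \<Rightarrow> 'h \<Rightarrow> 'h fock \<Rightarrow> 'h fock" where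
  "d_op q J One x = annihilation q J x"
| "d_op q J Star x = creation x"

lemma multilinear_tens_Cons: "multilinear (\<lambda>xs. tens (x # xs))"
  using multilinear_tens unfolding multilinear_def by (metis append_Cons)

lemma creation_tens: "creation x (tens xs) = tens (x # xs)"
  by (simp add: creation_def fock_lift_tens multilinear_tens_Cons)

lemma signed_act_slot:
  assumes s: "s \<in> signed_perms (Suc (length as + length bs))"
  obtains us vs g where "g = id \<or> g = J"
    "\<And>x. signed_act J s (as @ x # bs) = us @ g x # vs"
proof -
  let ?n = "Suc (length as + length bs)"
  let ?k = "int (Suc (length as))"
  let ?act = "\<lambda>x. signed_act J s (as @ x # bs)"
  have b: "bij s" and odd: "\<And>k. s (- k) = - s k" and f: "\<And>k. \<bar>k\<bar> > int ?n \<Longrightarrow> s k = k"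
    using s unfolding signed_perms_def by blast+
  have inj: "s k = s l \<Longrightarrow> k = l" for k l using b by (meson bij_def injD)
  have inv_iff: "inv s k = l \<longleftrightarrow> k = s l" for k l using bij_inv_eq_iff[OF b, of l k] by metis
  have "\<bar>s ?k\<bar> \<le> int ?n"
  proof (rule ccontr)
    assume a: "\<not> \<bar>s ?k\<bar> \<le> int ?n"
    then have "s (s ?k) = s ?k" using f by simp
    then have "s ?k = ?k" by (rule inj)
    then show False using a by simp
  qed
  moreover have "s ?k \<noteq> 0"
  proof
    assume "s ?k = 0"
    moreover have "s 0 = 0" using odd[of 0] by simp
    ultimately have "s ?k = s 0" by (simp only:)
    then have "?k = 0" by (rule inj)
    then show False by simp
  qed
  ultimately obtain p where p: "p < ?n" "\<bar>s ?k\<bar> = int (Suc p)"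
    by (intro that[of "nat \<bar>s ?k\<bar> - 1"]) linarith+
  define g where "g = (if s ?k > 0 then id else J)"
  have inv_pos: "inv s (int (Suc i)) = ?k \<longleftrightarrow> i = p \<and> s ?k > 0" for i
    unfolding inv_iff using p(2) by linarith
  have inv_neg: "inv s (int (Suc i)) = - ?k \<longleftrightarrow> i = p \<and> s ?k < 0" for i
    unfolding inv_iff odd using p(2) by linarith
  have nth_p: "?act x ! p = g x" for x
  proof -
    have act: "?act x ! p = signed_nth J (as @ x # bs) (inv s (int (Suc p)))"
      using p(1) by (intro nth_signed_act) simp
    show ?thesis
    proof (cases "s ?k > 0")
      case True
      then have "inv s (int (Suc p)) = ?k" by (simp only: inv_pos)
      then show ?thesis unfolding act using True by (simp add: signed_nth_def g_def nat_add_distrib)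
    next
      case False
      then have "s ?k < 0" using \<open>s ?k \<noteq> 0\<close> by linarith
      then have "inv s (int (Suc p)) = - ?k" by (simp only: inv_neg)
      then show ?thesis unfolding act using False by (simp add: signed_nth_def g_def nat_add_distrib)
    qed
  qed
  have nth_i: "?act x ! i = ?act y ! i" if i: "i < ?n" "i \<noteq> p" for i x y
  proof -
    let ?m = "inv s (int (Suc i))"
    have m: "?m \<noteq> ?k" "?m \<noteq> - ?k" using inv_pos[of i] inv_neg[of i] i(2) by blast+
    have m0: "?m \<noteq> 0" using inv_signed_perm(2)[OF s] by simp
    have ne: "(as @ x # bs) ! j = (as @ y # bs) ! j" if "j \<noteq> length as" for j
      using that by (simp add: nth_append nth_Cons split: nat.split)
    have "nat ?m - 1 \<noteq> length as" if "\<not> ?m < 0" using that m(1) m0 by linarith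
    moreover have "nat (- ?m) - 1 \<noteq> length as" if "?m < 0" using that m(2) m0 by linarith
    ultimately have "signed_nth J (as @ x # bs) ?m = signed_nth J (as @ y # bs) ?m"
      by (cases "?m < 0") (simp_all only: signed_nth_def if_True if_False ne not_False_eq_True)
    then show ?thesis using i(1) by (simp add: nth_signed_act del: of_nat_Suc)
  qed
  have "?act x = take p (?act undefined) @ g x # drop (Suc p) (?act undefined)" for x
  proof -
    have "?act x = take p (?act x) @ ?act x ! p # drop (Suc p) (?act x)"
      using p(1) by (intro id_take_nth_drop) simp
    moreover have "take p (?act x) = take p (?act undefined)"
      using p(1) by (intro nth_equalityI) (simp_all add: nth_i)
    moreover have "drop (Suc p) (?act x) = drop (Suc p) (?act undefined)"
      using p(1) by (intro nth_equalityI) (simp_all add: nth_i)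
    ultimately show ?thesis by (simp only: nth_p)
  qed
  moreover have "g = id \<or> g = J" by (simp add: g_def)
  ultimately show thesis by (rule that[rotated])
qed

lemma tens_signed_act:
  fixes J :: "'h::chilbert_space \<Rightarrow> 'h"
  assumes J: "selfadjoint_involution J" and s: "s \<in> D_group (Suc (length as + length bs))"
  shows "tens (signed_act J s (as @ (x + y) # bs)) =
      tens (signed_act J s (as @ x # bs)) + tens (signed_act J s (as @ y # bs))"
    and "tens (signed_act J s (as @ (c *\<^sub>C x) # bs)) = c *\<^sub>C tens (signed_act J s (as @ x # bs))"
proof -
  have "s \<in> signed_perms (Suc (length as + length bs))" using s D_group_subset by blast
  then obtain us vs g where g: "g = id \<or> g = J"
    and act: "\<And>x. signed_act J s (as @ x # bs) = us @ g x # vs"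
    using signed_act_slot[where J = J] by metis
  have "g (x + y) = g x + g y" "g (c *\<^sub>C x) = c *\<^sub>C g x"
    using g J by (auto simp: selfadjoint_involution_def linear_add bounded_linear.linear)
  then show "tens (signed_act J s (as @ (x + y) # bs)) =
      tens (signed_act J s (as @ x # bs)) + tens (signed_act J s (as @ y # bs))"
    and "tens (signed_act J s (as @ (c *\<^sub>C x) # bs)) = c *\<^sub>C tens (signed_act J s (as @ x # bs))"
    using multilinear_tens[where 'h = 'h] unfolding multilinear_def by (simp_all add: act)
qed

lemma Pq_tens:
  assumes J: "selfadjoint_involution J"
  shows "Pq q J (tens xs) = (\<Sum>\<sigma>\<in>D_group (length xs).
     complex_of_real (q ^ D_length (length xs) \<sigma>) *\<^sub>C tens (signed_act J \<sigma> xs))"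
proof -
  have "multilinear (\<lambda>xs. \<Sum>\<sigma>\<in>D_group (length xs).
     complex_of_real (q ^ D_length (length xs) \<sigma>) *\<^sub>C tens (signed_act J \<sigma> xs))"
    unfolding multilinear_def
    by (auto simp: tens_signed_act[OF J] scaleC_add_right sum.distrib[symmetric]
        complex_vector.scale_sum_right scaleC_scaleC mult.commute
        simp del: of_real_power intro!: sum.cong)
  then show ?thesis by (simp add: Pq_def fock_lift_tens del: of_real_power)
qed


section \<open>Partitions of type D\<close>

definition P12 :: "nat \<Rightarrow> nat set set set" where
  "P12 n = {\<pi>. partition_on {1..n} \<pi> \<and> (\<forall>V\<in>\<pi>. card V \<in> {1, 2})}"

definition Pair_blocks :: "nat set set \<Rightarrow> nat set set" where
  "Pair_blocks \<pi> = {V \<in> \<pi>. card V = 2}"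

definition Sing_blocks :: "nat set set \<Rightarrow> nat set set" where
  "Sing_blocks \<pi> = {V \<in> \<pi>. card V = 1}"

definition covers :: "nat set \<Rightarrow> nat set \<Rightarrow> bool" where
  "covers A B \<longleftrightarrow> (\<exists>i\<in>A. \<exists>j\<in>A. \<forall>k\<in>B. i < k \<and> k < j)"

definition right_of :: "nat set \<Rightarrow> nat set \<Rightarrow> bool" where
  "right_of W V \<longleftrightarrow> Min V < Min W"

definition strict_right_of :: "nat set \<Rightarrow> nat set \<Rightarrow> bool" where
  "strict_right_of W V \<longleftrightarrow> Max V < Min W"

definition cover_num :: "nat set set \<Rightarrow> nat set \<Rightarrow> nat" where
  "cover_num \<pi> V = card {W \<in> \<pi>. covers W V}"

definition sr :: "nat set set \<Rightarrow> nat set \<Rightarrow> nat" where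
  "sr \<pi> V = card {S \<in> Sing_blocks \<pi>. right_of S V}"

definition lcr :: "nat set set \<Rightarrow> nat set \<Rightarrow> nat" where
  "lcr \<pi> V = card {W \<in> \<pi>. \<exists>i\<in>V. \<exists>j\<in>V. \<exists>k\<in>W. \<exists>l\<in>W. k < i \<and> i < l \<and> l < j}"

definition cr :: "nat set set \<Rightarrow> nat" where
  "cr \<pi> = (\<Sum>V\<in>\<pi>. lcr \<pi> V)"

definition cs :: "nat set set \<Rightarrow> nat" where
  "cs \<pi> = card {(S, W). S \<in> Sing_blocks \<pi> \<and> W \<in> \<pi> \<and> covers W S}"

definition neg_pairs :: "nat set set \<Rightarrow> (nat set \<Rightarrow> int) \<Rightarrow> nat set set" where
  "neg_pairs \<pi> f = {V \<in> Pair_blocks \<pi>. f V = - 1}"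

definition np :: "nat set set \<Rightarrow> (nat set \<Rightarrow> int) \<Rightarrow> nat" where
  "np \<pi> f = card (neg_pairs \<pi> f)"

definition npr :: "nat set set \<Rightarrow> (nat set \<Rightarrow> int) \<Rightarrow> nat set \<Rightarrow> nat" where
  "npr \<pi> f V = card {W \<in> neg_pairs \<pi> f. right_of W V}"

definition cnp :: "nat set set \<Rightarrow> (nat set \<Rightarrow> int) \<Rightarrow> nat" where
  "cnp \<pi> f = card {(V, W). V \<in> neg_pairs \<pi> f \<and> W \<in> Pair_blocks \<pi> \<and> covers W V}"

definition npssr :: "nat set set \<Rightarrow> (nat set \<Rightarrow> int) \<Rightarrow> nat" where
  "npssr \<pi> f = card {(V, S). V \<in> neg_pairs \<pi> f \<and> S \<in> Sing_blocks \<pi> \<and> strict_right_of S V}"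

text \<open>Colorings are extensional functions (\<^const>\<open>undefined\<close> off \<open>\<pi>\<close>), so that each coloring of
  \<open>\<pi>\<close> occurs exactly once.  A singleton is the rightmost one iff no singleton is on the right
  of it.\<close>

definition PD12 :: "nat \<Rightarrow> (nat set set \<times> (nat set \<Rightarrow> int)) set" where
  "PD12 n = {(\<pi>, f). \<pi> \<in> P12 n \<and> f \<in> \<pi> \<rightarrow>\<^sub>E {1, - 1} \<and>
     (\<forall>V\<in>Pair_blocks \<pi>. sr \<pi> V = 0 \<and> lcr \<pi> V = 0 \<and> cover_num \<pi> V = 0 \<longrightarrow>
        f V = (- 1) ^ npr \<pi> f V) \<and>
     (\<forall>S\<in>Sing_blocks \<pi>.
        f S = (if \<exists>T\<in>Sing_blocks \<pi>. right_of T S then 1 else (- 1) ^ np \<pi> f))}"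

definition compatible :: "(nat \<Rightarrow> exponent) \<Rightarrow> nat set set \<Rightarrow> bool" where
  "compatible \<epsilon> \<pi> \<longleftrightarrow>
     (\<forall>V\<in>Pair_blocks \<pi>. \<epsilon> (Min V) = One \<and> \<epsilon> (Max V) = Star) \<and>
     (\<forall>S\<in>Sing_blocks \<pi>. \<forall>s\<in>S. \<epsilon> s = Star)"

definition PD12_eps :: "nat \<Rightarrow> (nat \<Rightarrow> exponent) \<Rightarrow> (nat set set \<times> (nat set \<Rightarrow> int)) set" where
  "PD12_eps n \<epsilon> = {(\<pi>, f) \<in> PD12 n. compatible \<epsilon> \<pi>}"

definition sing_tensor ::
  "('h::complex_vector \<Rightarrow> 'h) \<Rightarrow> (nat \<Rightarrow> 'h) \<Rightarrow> nat set set \<Rightarrow> (nat set \<Rightarrow> int) \<Rightarrow> 'h fock" where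
  "sing_tensor J x \<pi> f =
     (let vs = sorted_list_of_set (\<Union>(Sing_blocks \<pi>)) in
      if \<exists>S\<in>Sing_blocks \<pi>. f S = - 1
      then tens (map x (butlast vs) @ [J (x (last vs))])
      else tens (map x vs))"

end

theory Submission
  imports Defs
begin

text \<open>The proof follows the recursive structure of both sides.  Applying the operators from right to left,
  each step either creates a new first tensor factor or contracts the vector against one of its factors;
  on partitions of type D, each step adds a new leftmost point, which is either a singleton or the left
  end of a pair whose right end was a singleton before.

  \<^bold>\<open>The annihilation operator.\<close>  The group \<open>D(n + 1)\<close> decomposes into cosets of \<open>D(n)\<close>, the stabilizer
  of the index \<open>1\<close>, and each coset has a representative of minimal length with which lengths add up
  (\<open>D_group_coset_bij\<close>, \<open>inv_num_embed_front\<close>).  A representative moves one factor, possibly with an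
  application of the involution \<open>J\<close>, to the front; if it applies \<open>J\<close> there, it also applies \<open>J\<close> to the last
  remaining factor.  Hence \<open>P\<^sub>q\<close> in degree \<open>n + 1\<close> is \<open>P\<^sub>q\<close> in degree \<open>n\<close> after a weighted sum of such
  moves, and the adjoint of the creation operator is an explicit weighted contraction
  (\<open>contraction_adjoint\<close>).  Lengths are computed as numbers of inverted positive roots
  (\<open>D_length_eq_inv_num\<close>).

  \<^bold>\<open>Uniqueness of the adjoint.\<close>  The annihilation operator is defined by a description, so the deformed
  inner product must be nondegenerate.  The matrix \<open>q ^ \<ell>(s\<^sup>-\<^sup>1 t)\<close> over the group is \<open>q\<close> to the power of
  the Hamming distance of the inversion sets of \<open>s\<^sup>-\<^sup>1\<close> and \<open>t\<^sup>-\<^sup>1\<close> (\<open>inv_num_cocycle\<close>), and the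
  kernel \<open>q ^ d(A, B)\<close> on all subsets of a finite set is a tensor power of a strictly positive
  \<open>2 \<times> 2\<close> matrix for \<open>\<bar>q\<bar> < 1\<close> (\<open>hamming_form_definite\<close>).  Together with the nondegeneracy of the
  undeformed inner product this gives \<open>inner_q_nondegenerate\<close>.

  \<^bold>\<open>The combinatorial recursion.\<close>  A coloring is determined by the set \<open>N\<close> of its negative pairs, and the
  last factor carries a \<open>J\<close> iff \<open>N\<close> has odd size.  Pairing the new point \<open>k\<close> with a singleton \<open>v\<close> turns
  covers of \<open>v\<close> into crossings with \<open>{k, v}\<close>, and negative pairs to the left of \<open>v\<close> into negative pairs
  covered by \<open>{k, v}\<close>.  The exponent therefore grows by the number of singletons to the left of \<open>v\<close>, plus
  twice the number of singletons to the right of \<open>v\<close> if the new pair is negative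
  (\<open>weight_exponent_pairing\<close>).  These are exactly the lengths of the coset representatives.  Condition (A)
  reflects that \<open>D(1)\<close> is trivial: the color of the new pair is free unless \<open>v\<close> was the only singleton, and
  then it is forced by the \<open>J\<close> on this factor (\<open>admissible_pairing\<close>, \<open>contraction_flip_if\<close>).\<close>


section \<open>Positive definiteness of the Hamming kernel\<close>

text \<open>The quadratic form of the kernel \<open>q ^ d(A, B)\<close>, where \<open>d\<close> is the Hamming distance of subsets
  of \<open>F\<close>.  Its matrix is the tensor power, over the points of \<open>F\<close>, of the matrix with rows
  \<open>(1, q)\<close> and \<open>(q, 1)\<close>.\<close>

definition hamming_form :: "real \<Rightarrow> 'a set \<Rightarrow> ('a set \<Rightarrow> real) \<Rightarrow> real" where
  "hamming_form q F c = (\<Sum>A\<in>Pow F. \<Sum>B\<in>Pow F. q ^ card (sym_diff A B) * (c A * c B))"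

lemma sum_Pow_insert:
  assumes "finite F" "x \<notin> F"
  shows "(\<Sum>A\<in>Pow (insert x F). h A) = (\<Sum>A\<in>Pow F. h A + h (insert x A))"
proof -
  have "inj_on (insert x) (Pow F)" using assms(2) by (auto simp: inj_on_def)
  moreover have "Pow F \<inter> insert x ` Pow F = {}" using assms(2) by auto
  ultimately show ?thesis
    using assms(1) by (simp add: Pow_insert sum.union_disjoint sum.reindex sum.distrib)
qed

text \<open>The \<open>2 \<times> 2\<close> matrix with rows \<open>(1, q)\<close>, \<open>(q, 1)\<close> is \<open>1 - \<bar>q\<bar>\<close> times the identity plus \<open>\<bar>q\<bar>\<close>
  times the rank one matrix of the vector \<open>(1, s)\<close>, where \<open>s\<close> is the sign of \<open>q\<close>.  Splitting the
  argument of \<open>c\<close> by membership of \<open>x\<close> turns this into a decomposition of the form into forms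
  over \<open>F\<close> with nonnegative coefficients, which makes an induction over \<open>F\<close> possible.\<close>

lemma hamming_form_insert:
  fixes q :: real
  assumes "finite F" "x \<notin> F"
  defines "s \<equiv> if q \<ge> 0 then 1 else - 1"
  shows "hamming_form q (insert x F) c =
    (1 - \<bar>q\<bar>) * (hamming_form q F c + hamming_form q F (\<lambda>A. c (insert x A)))
      + \<bar>q\<bar> * hamming_form q F (\<lambda>A. c A + s * c (insert x A))"
proof -
  have card_ins: "card (insert x (sym_diff A B)) = Suc (card (sym_diff A B))"
    if "A \<in> Pow F" "B \<in> Pow F" for A B
    using that assms(1,2) by (subst card_insert_disjoint) (auto intro: finite_subset)
  have diff: "sym_diff (insert x A) (insert x B) = sym_diff A B"
      "sym_diff (insert x A) B = insert x (sym_diff A B)"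
      "sym_diff A (insert x B) = insert x (sym_diff A B)" if "A \<in> Pow F" "B \<in> Pow F" for A B
    using that assms(2) by blast+
  have sq: "\<bar>q\<bar> * s = q" "s * s = 1" by (auto simp: s_def)
  have "hamming_form q (insert x F) c = (\<Sum>A\<in>Pow F. \<Sum>B\<in>Pow F. q ^ card (sym_diff A B) *
      (c A * c B + c (insert x A) * c (insert x B) + q * (c A * c (insert x B) + c (insert x A) * c B)))"
    unfolding hamming_form_def sum_Pow_insert[OF assms(1,2)] sum.distrib[symmetric]
    by (intro sum.cong refl) (simp only: diff card_ins power_Suc, simp only: algebra_simps)
  also have "\<dots> = (\<Sum>A\<in>Pow F. \<Sum>B\<in>Pow F. q ^ card (sym_diff A B) *
      ((1 - \<bar>q\<bar>) * (c A * c B + c (insert x A) * c (insert x B))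
        + \<bar>q\<bar> * ((c A + s * c (insert x A)) * (c B + s * c (insert x B)))))"
  proof (intro sum.cong refl arg_cong2[where f = "(*)"])
    fix A B
    have "\<bar>q\<bar> * ((c A + s * c (insert x A)) * (c B + s * c (insert x B))) =
       \<bar>q\<bar> * (c A * c B) + (\<bar>q\<bar> * s) * (c A * c (insert x B) + c (insert x A) * c B)
        + \<bar>q\<bar> * (s * s) * (c (insert x A) * c (insert x B))"
      by (simp add: algebra_simps)
    then show "c A * c B + c (insert x A) * c (insert x B) + q * (c A * c (insert x B) + c (insert x A) * c B)
       = (1 - \<bar>q\<bar>) * (c A * c B + c (insert x A) * c (insert x B))
        + \<bar>q\<bar> * ((c A + s * c (insert x A)) * (c B + s * c (insert x B)))"
      unfolding sq by (simp add: algebra_simps)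
  qed
  also have "\<dots> = (1 - \<bar>q\<bar>) * (hamming_form q F c + hamming_form q F (\<lambda>A. c (insert x A)))
      + \<bar>q\<bar> * hamming_form q F (\<lambda>A. c A + s * c (insert x A))"
    unfolding hamming_form_def sum_distrib_left sum.distrib[symmetric]
    by (intro sum.cong refl) (simp add: algebra_simps)
  finally show ?thesis .
qed

lemma hamming_form_definite:
  fixes q :: real
  assumes "finite F" "\<bar>q\<bar> < 1"
  shows "0 \<le> hamming_form q F c \<and> (hamming_form q F c = 0 \<longrightarrow> (\<forall>A\<subseteq>F. c A = 0))"
  using assms(1)
proof (induction F arbitrary: c)
  case empty
  then show ?case by (simp add: hamming_form_def)
next
  case (insert x F)
  let ?c1 = "\<lambda>A. c (insert x A)"
  let ?s = "if q \<ge> 0 then 1 else - 1 :: real"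
  let ?a = "hamming_form q F c" and ?b = "hamming_form q F ?c1"
    and ?d = "hamming_form q F (\<lambda>A. c A + ?s * ?c1 A)"
  have eq: "hamming_form q (insert x F) c = (1 - \<bar>q\<bar>) * (?a + ?b) + \<bar>q\<bar> * ?d"
    by (rule hamming_form_insert) (use insert in auto)
  have nn: "0 \<le> ?a" "0 \<le> ?b" "0 \<le> ?d" using insert.IH by blast+
  have nn2: "0 \<le> (1 - \<bar>q\<bar>) * (?a + ?b)" "0 \<le> \<bar>q\<bar> * ?d"
    using nn assms(2) by auto
  have "c A = 0" if z: "hamming_form q (insert x F) c = 0" and A: "A \<subseteq> insert x F" for A
  proof -
    have "(1 - \<bar>q\<bar>) * (?a + ?b) = 0" using z eq nn2 by linarith
    then have "?a = 0" "?b = 0" using nn assms(2) by auto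
    then have F: "\<And>B. B \<subseteq> F \<Longrightarrow> c B = 0" "\<And>B. B \<subseteq> F \<Longrightarrow> ?c1 B = 0"
      using insert.IH by blast+
    show ?thesis
    proof (cases "x \<in> A")
      case True
      have "c (insert x (A - {x})) = 0" by (rule F(2)) (use A in blast)
      then show ?thesis using True by (simp only: insert_Diff)
    next
      case False
      then show ?thesis using F(1) A by (simp add: subset_insert)
    qed
  qed
  moreover have "0 \<le> hamming_form q (insert x F) c" unfolding eq using nn2 by (rule add_nonneg_nonneg)
  ultimately show ?case by blast
qed

text \<open>Points with pairwise different labels \<open>A s\<close> give a principal submatrix of the Hamming kernel,
  and a principal submatrix of a strictly positive matrix is strictly positive.\<close>

lemma hamming_kernel_regular_real:
  fixes q :: real and d :: "'g \<Rightarrow> real"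
  assumes "finite F" "\<bar>q\<bar> < 1" "finite G" "inj_on A G" "\<And>s. s \<in> G \<Longrightarrow> A s \<subseteq> F"
    and zero: "\<And>s. s \<in> G \<Longrightarrow> (\<Sum>t\<in>G. q ^ card (sym_diff (A s) (A t)) * d t) = 0"
    and t: "t \<in> G"
  shows "d t = 0"
proof -
  define c where "c X = (if X \<in> A ` G then d (the_inv_into G A X) else 0)" for X
  have c: "c (A s) = d s" if "s \<in> G" for s
    using that assms(4) by (simp add: c_def the_inv_into_f_f)
  have red: "(\<Sum>X\<in>Pow F. h X) = (\<Sum>s\<in>G. h (A s))" if "\<And>X. X \<notin> A ` G \<Longrightarrow> h X = 0" for h :: "'a set \<Rightarrow> real"
  proof -
    have "(\<Sum>X\<in>Pow F. h X) = (\<Sum>X\<in>A ` G. h X)"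
      by (rule sum.mono_neutral_right) (use assms that in auto)
    then show ?thesis using assms(4) by (simp add: sum.reindex)
  qed
  have "hamming_form q F c = (\<Sum>X\<in>Pow F. \<Sum>t\<in>G. q ^ card (sym_diff X (A t)) * (c X * c (A t)))"
    unfolding hamming_form_def by (intro sum.cong refl red) (simp add: c_def)
  also have "\<dots> = (\<Sum>s\<in>G. \<Sum>t\<in>G. q ^ card (sym_diff (A s) (A t)) * (c (A s) * c (A t)))"
    by (rule red) (simp add: c_def)
  also have "\<dots> = (\<Sum>s\<in>G. d s * (\<Sum>t\<in>G. q ^ card (sym_diff (A s) (A t)) * d t))"
    unfolding sum_distrib_left by (intro sum.cong refl) (simp add: c algebra_simps)
  also have "\<dots> = 0" using zero by simp
  finally have "\<forall>X\<subseteq>F. c X = 0" using hamming_form_definite[OF assms(1,2)] by blast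
  then show ?thesis using c[OF t] assms(5)[OF t] by auto
qed

text \<open>The kernel is real, so a complex solution of the homogeneous system splits into two real
  ones.\<close>

lemma hamming_kernel_regular:
  fixes q :: real and d :: "'g \<Rightarrow> complex"
  assumes "finite F" "\<bar>q\<bar> < 1" "finite G" "inj_on A G" "\<And>s. s \<in> G \<Longrightarrow> A s \<subseteq> F"
    and zero: "\<And>s. s \<in> G \<Longrightarrow> (\<Sum>t\<in>G. complex_of_real (q ^ card (sym_diff (A s) (A t))) * d t) = 0"
    and t: "t \<in> G"
  shows "d t = 0"
proof (rule complex_eqI)
  have re: "(\<Sum>t\<in>G. q ^ card (sym_diff (A s) (A t)) * Re (d t)) = 0" if "s \<in> G" for s
    using arg_cong[OF zero[OF that], of Re] by (simp del: of_real_power)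
  have im: "(\<Sum>t\<in>G. q ^ card (sym_diff (A s) (A t)) * Im (d t)) = 0" if "s \<in> G" for s
    using arg_cong[OF zero[OF that], of Im] by (simp del: of_real_power)
  show "Re (d t) = Re 0" "Im (d t) = Im 0"
    using hamming_kernel_regular_real[OF assms(1-5) re t]
      hamming_kernel_regular_real[OF assms(1-5) im t] by (simp_all only: zero_complex.sel)
qed


section \<open>Roots, inversions and length in type D\<close>

lemma signed_permsD:
  assumes "s \<in> signed_perms n"
  shows "bij s" "s (- k) = - s k" "int n < \<bar>k\<bar> \<Longrightarrow> s k = k" "s 0 = 0"
    "\<bar>s k\<bar> = \<bar>s l\<bar> \<longleftrightarrow> \<bar>k\<bar> = \<bar>l\<bar>" "s k = 0 \<longleftrightarrow> k = 0" "\<bar>s k\<bar> \<le> int n \<longleftrightarrow> \<bar>k\<bar> \<le> int n"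
proof -
  have o: "\<And>k. s (- k) = - s k" and f: "\<And>k. int n < \<bar>k\<bar> \<Longrightarrow> s k = k"
    using assms by (auto simp: signed_perms_def)
  show b: "bij s" using assms by (simp add: signed_perms_def)
  show "s (- k) = - s k" by (rule o)
  show "int n < \<bar>k\<bar> \<Longrightarrow> s k = k" by (rule f)
  show z: "s 0 = 0" using o[of 0] by simp
  have i: "s k = s l \<longleftrightarrow> k = l" for k l using b by (metis bij_pointE)
  show "\<bar>s k\<bar> = \<bar>s l\<bar> \<longleftrightarrow> \<bar>k\<bar> = \<bar>l\<bar>"
    by (metis abs_eq_iff i o)
  show "s k = 0 \<longleftrightarrow> k = 0" using i z by metis
  show "\<bar>s k\<bar> \<le> int n \<longleftrightarrow> \<bar>k\<bar> \<le> int n"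
    by (metis f i linorder_not_less)
qed

lemma inv_signed_perms:
  assumes "s \<in> signed_perms n" shows "inv s \<in> signed_perms n"
proof -
  have "inv s k = k" if "int n < \<bar>k\<bar>" for k
    using bij_inv_eq_iff[OF signed_permsD(1)[OF assms]] signed_permsD(3)[OF assms that] by metis
  then show ?thesis
    using inv_signed_perm(1)[OF assms] bij_imp_bij_inv[OF signed_permsD(1)[OF assms]]
    by (simp add: signed_perms_def)
qed

lemma inv_signed_perm_comp: "s \<in> signed_perms n \<Longrightarrow> inv s \<circ> s = id" "s \<in> signed_perms n \<Longrightarrow> s \<circ> inv s = id"
  using signed_permsD(1)[of s n] by (simp_all add: bij_is_inj bij_is_surj surj_iff[symmetric])

text \<open>A root \<open>e\<^sub>a + e\<^sub>b\<close>, with the convention \<open>e\<^sub>-\<^sub>a = - e\<^sub>a\<close>, is represented by the two-element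
  set \<open>{a, b}\<close>.  Signed permutations then act on roots by taking images, and negation of roots is
  the image under negation of integers.\<close>

definition D_roots :: "nat \<Rightarrow> int set set" where
  "D_roots n = {{a, b} | a b. \<bar>a\<bar> \<noteq> \<bar>b\<bar> \<and> a \<noteq> 0 \<and> b \<noteq> 0 \<and> \<bar>a\<bar> \<le> int n \<and> \<bar>b\<bar> \<le> int n}"

text \<open>The sign of a root is the sign of its entry of smaller absolute value.  The simple roots of this
  choice are \<open>e\<^sub>i - e\<^sub>i\<^sub>+\<^sub>1\<close> and \<open>e\<^sub>n\<^sub>-\<^sub>1 + e\<^sub>n\<close>, in accordance with the generators \<open>\<pi>\<^sub>i\<close> and
  \<open>\<pi>\<^sub>n\<^sub>-\<^sub>1\<close> with a hat; changing the sign of the entry \<open>n\<close> never changes the sign of a root.\<close>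

definition pos_root :: "int set \<Rightarrow> bool" where
  "pos_root R \<longleftrightarrow> (\<exists>a\<in>R. 0 < a \<and> (\<forall>b\<in>R. a \<le> \<bar>b\<bar>))"

definition D_pos :: "nat \<Rightarrow> int set set" where
  "D_pos n = {R \<in> D_roots n. pos_root R}"

definition inversions :: "nat \<Rightarrow> (int \<Rightarrow> int) \<Rightarrow> int set set" where
  "inversions n s = {R \<in> D_pos n. \<not> pos_root (s ` R)}"

definition inv_num :: "nat \<Rightarrow> (int \<Rightarrow> int) \<Rightarrow> nat" where
  "inv_num n s = card (inversions n s)"

lemma pos_root_pair: "\<bar>a\<bar> < \<bar>b\<bar> \<Longrightarrow> pos_root {a, b} \<longleftrightarrow> 0 < a"
  by (auto simp: pos_root_def)

lemma pos_root_pair': "\<bar>b\<bar> < \<bar>a\<bar> \<Longrightarrow> pos_root {a, b} \<longleftrightarrow> 0 < b"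
  by (auto simp: pos_root_def)

lemma D_pos_iff: "R \<in> D_pos n \<longleftrightarrow> (\<exists>a b. R = {a, b} \<and> 0 < a \<and> a < \<bar>b\<bar> \<and> \<bar>b\<bar> \<le> int n)"
proof
  assume "R \<in> D_pos n"
  then obtain a b where ab: "R = {a, b}" "\<bar>a\<bar> \<noteq> \<bar>b\<bar>" "a \<noteq> 0" "b \<noteq> 0" "\<bar>a\<bar> \<le> int n" "\<bar>b\<bar> \<le> int n" "pos_root {a, b}"
    unfolding D_pos_def D_roots_def mem_Collect_eq by blast
  show "\<exists>a b. R = {a, b} \<and> 0 < a \<and> a < \<bar>b\<bar> \<and> \<bar>b\<bar> \<le> int n"
  proof (cases "\<bar>a\<bar> < \<bar>b\<bar>")
    case True
    then have "0 < a" using ab pos_root_pair by blast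
    show ?thesis by (rule exI[of _ a], rule exI[of _ b]) (use ab True \<open>0 < a\<close> in simp)
  next
    case False
    then have "\<bar>b\<bar> < \<bar>a\<bar>" using ab by simp
    moreover from this have "0 < b" using ab pos_root_pair' by blast
    moreover have "R = {b, a}" unfolding ab(1) by blast
    ultimately have "R = {b, a} \<and> 0 < b \<and> b < \<bar>a\<bar> \<and> \<bar>a\<bar> \<le> int n" using ab(5) by simp
    then show ?thesis by blast
  qed
next
  assume "\<exists>a b. R = {a, b} \<and> 0 < a \<and> a < \<bar>b\<bar> \<and> \<bar>b\<bar> \<le> int n"
  then obtain a b where R: "R = {a, b}" "0 < a" "a < \<bar>b\<bar>" "\<bar>b\<bar> \<le> int n" by blast
  have "R \<in> D_roots n"
    unfolding D_roots_def mem_Collect_eq by (rule exI[of _ a], rule exI[of _ b]) (use R in auto)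
  moreover have "pos_root R" using R by (simp add: pos_root_pair)
  ultimately show "R \<in> D_pos n" by (simp add: D_pos_def)
qed

lemma finite_D_roots: "finite (D_roots n)"
  by (rule finite_subset[of _ "Pow {- int n..int n}"]) (auto simp: D_roots_def)

lemma finite_D_pos: "finite (D_pos n)"
  using finite_D_roots by (simp add: D_pos_def)

lemma finite_inversions: "finite (inversions n s)"
  using finite_D_pos by (simp add: inversions_def)

lemma D_roots_image:
  assumes "s \<in> signed_perms n" "R \<in> D_roots n"
  shows "s ` R \<in> D_roots n"
proof -
  obtain a b where R: "R = {a, b}" "\<bar>a\<bar> \<noteq> \<bar>b\<bar>" "a \<noteq> 0" "b \<noteq> 0" "\<bar>a\<bar> \<le> int n" "\<bar>b\<bar> \<le> int n"
    using assms(2) unfolding D_roots_def by blast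
  show ?thesis
    unfolding D_roots_def mem_Collect_eq
    by (rule exI[of _ "s a"], rule exI[of _ "s b"]) (use R signed_permsD(5-7)[OF assms(1)] in auto)
qed

lemma D_roots_uminus:
  assumes "R \<in> D_roots n" shows "uminus ` R \<in> D_roots n"
proof -
  obtain a b where R: "R = {a, b}" "\<bar>a\<bar> \<noteq> \<bar>b\<bar>" "a \<noteq> 0" "b \<noteq> 0" "\<bar>a\<bar> \<le> int n" "\<bar>b\<bar> \<le> int n"
    using assms unfolding D_roots_def by blast
  show ?thesis
    unfolding D_roots_def mem_Collect_eq by (rule exI[of _ "- a"], rule exI[of _ "- b"]) (use R in auto)
qed

lemma pos_root_uminus:
  assumes "R \<in> D_roots n" shows "pos_root (uminus ` R) \<longleftrightarrow> \<not> pos_root R"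
proof -
  obtain a b where R: "R = {a, b}" "\<bar>a\<bar> \<noteq> \<bar>b\<bar>" "a \<noteq> 0" "b \<noteq> 0" using assms unfolding D_roots_def by auto
  then show ?thesis
    by (cases "\<bar>a\<bar> < \<bar>b\<bar>") (auto simp: pos_root_pair pos_root_pair')
qed

lemma image_uminus_signed_perm: "s \<in> signed_perms n \<Longrightarrow> s ` uminus ` R = uminus ` s ` R"
  using signed_permsD(2)[of s n] by (auto simp: image_image)

lemma D_pos_subset: "D_pos n \<subseteq> D_roots n" by (auto simp: D_pos_def)

text \<open>As a reflection in a simple root, the generator negates that root and permutes all other positive
  roots.  The same holds for the remaining generator, by the next lemma.\<close>

lemma pi_gen_root:
  assumes "1 \<le> i" "i < n"
  defines "\<alpha> \<equiv> {int i, - int i - 1}"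
  shows "\<alpha> \<in> D_pos n" "pi_gen i ` \<alpha> = uminus ` \<alpha>"
    "R \<in> D_pos n \<Longrightarrow> R \<noteq> \<alpha> \<Longrightarrow> pi_gen i ` R \<in> D_pos n"
proof -
  show "\<alpha> \<in> D_pos n" unfolding D_pos_iff \<alpha>_def
    by (rule exI[of _ "int i"], rule exI[of _ "- int i - 1"]) (use assms in auto)
  show "pi_gen i ` \<alpha> = uminus ` \<alpha>" using assms by (auto simp: pi_gen_apply)
  assume "R \<in> D_pos n" "R \<noteq> \<alpha>"
  then obtain a b where R: "R = {a, b}" "0 < a" "a < \<bar>b\<bar>" "\<bar>b\<bar> \<le> int n"
    and ne: "\<not> (a = int i \<and> b = - int i - 1)" unfolding D_pos_iff \<alpha>_def by blast
  let ?a = "pi_gen i a" and ?b = "pi_gen i b"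
  have "(0 < ?a \<and> ?a < \<bar>?b\<bar> \<and> \<bar>?b\<bar> \<le> int n) \<or> (0 < ?b \<and> ?b < \<bar>?a\<bar> \<and> \<bar>?a\<bar> \<le> int n)"
    using assms(1,2) R(2-) ne by (auto simp: pi_gen_apply)
  moreover have "pi_gen i ` R = {?a, ?b}" "pi_gen i ` R = {?b, ?a}" by (auto simp: R(1))
  ultimately show "pi_gen i ` R \<in> D_pos n" unfolding D_pos_iff by metis
qed

lemma hat_pi_gen_root:
  assumes "2 \<le> n"
  defines "\<alpha> \<equiv> {int n - 1, int n}"
  shows "\<alpha> \<in> D_pos n" "hat_pi_gen (n - 1) ` \<alpha> = uminus ` \<alpha>"
    "R \<in> D_pos n \<Longrightarrow> R \<noteq> \<alpha> \<Longrightarrow> hat_pi_gen (n - 1) ` R \<in> D_pos n"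
proof -
  have n: "int (n - 1) = int n - 1" "1 \<le> n - 1" using assms(1) by auto
  show "\<alpha> \<in> D_pos n" unfolding D_pos_iff \<alpha>_def
    by (rule exI[of _ "int n - 1"], rule exI[of _ "int n"]) (use assms in auto)
  show "hat_pi_gen (n - 1) ` \<alpha> = uminus ` \<alpha>" using assms by (auto simp: hat_pi_gen_apply n)
  assume "R \<in> D_pos n" "R \<noteq> \<alpha>"
  then obtain a b where R: "R = {a, b}" "0 < a" "a < \<bar>b\<bar>" "\<bar>b\<bar> \<le> int n"
    and ne: "\<not> (a = int n - 1 \<and> b = int n)" unfolding D_pos_iff \<alpha>_def by blast
  let ?a = "hat_pi_gen (n - 1) a" and ?b = "hat_pi_gen (n - 1) b"
  have "(0 < ?a \<and> ?a < \<bar>?b\<bar> \<and> \<bar>?b\<bar> \<le> int n) \<or> (0 < ?b \<and> ?b < \<bar>?a\<bar> \<and> \<bar>?a\<bar> \<le> int n)"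
    using assms(1) R(2-) ne by (auto simp: hat_pi_gen_apply n)
  moreover have "hat_pi_gen (n - 1) ` R = {?a, ?b}" "hat_pi_gen (n - 1) ` R = {?b, ?a}" by (auto simp: R(1))
  ultimately show "hat_pi_gen (n - 1) ` R \<in> D_pos n" unfolding D_pos_iff by metis
qed

text \<open>A simple reflection \<open>g\<close> maps inversions of \<open>s \<circ> g\<close> other than \<open>\<alpha>\<close> to inversions of \<open>s\<close> other than
  \<open>\<alpha>\<close>, so the number of inversions can change only by what happens to \<open>\<alpha>\<close> itself.\<close>

lemma inv_num_comp_reflection:
  assumes s: "s \<in> signed_perms n" and g: "\<And>k. g (g k) = k"
    and root: "\<alpha> \<in> D_pos n" "g ` \<alpha> = uminus ` \<alpha>" "\<And>R. R \<in> D_pos n \<Longrightarrow> R \<noteq> \<alpha> \<Longrightarrow> g ` R \<in> D_pos n"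
  shows "inv_num n (s \<circ> g) \<le> Suc (inv_num n s)"
    and "\<not> pos_root (s ` \<alpha>) \<Longrightarrow> inv_num n (s \<circ> g) < inv_num n s"
proof -
  have "inj g" using g by (metis injI)
  have neg: "\<not> pos_root (uminus ` \<alpha>)"
    using root(1) pos_root_uminus[of \<alpha> n] by (auto simp: D_pos_def)
  \<comment> \<open>The reflection is an involution, so only \<open>- \<alpha>\<close>, which is not positive, is mapped to \<open>\<alpha>\<close>.\<close>
  have "(`) g ` (inversions n (s \<circ> g) - {\<alpha>}) \<subseteq> inversions n s - {\<alpha>}"
  proof (rule image_subsetI)
    fix R assume "R \<in> inversions n (s \<circ> g) - {\<alpha>}"
    then have R: "R \<in> D_pos n" "R \<noteq> \<alpha>" "\<not> pos_root (s ` g ` R)" by (auto simp: inversions_def image_comp)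
    have "g ` R \<noteq> \<alpha>"
    proof
      assume "g ` R = \<alpha>"
      then have "R = g ` \<alpha>" using g by (force simp: image_image)
      then show False using R(1) root(2) neg by (simp add: D_pos_def)
    qed
    then show "g ` R \<in> inversions n s - {\<alpha>}" using R root(3) by (auto simp: inversions_def)
  qed
  moreover have "inj_on ((`) g) (inversions n (s \<circ> g) - {\<alpha>})"
    using \<open>inj g\<close> by (meson inj_on_subset inj_image_eq_iff inj_onI)
  ultimately have le: "card (inversions n (s \<circ> g) - {\<alpha>}) \<le> card (inversions n s - {\<alpha>})"
    by (meson card_inj_on_le finite_inversions finite_Diff)
  have "card (inversions n (s \<circ> g)) \<le> Suc (card (inversions n (s \<circ> g) - {\<alpha>}))"
    using finite_inversions by (metis card_Diff1_le card_Suc_Diff1 Diff_empty Diff_insert0 le_SucI order_refl)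
  also have "\<dots> \<le> Suc (card (inversions n s))"
    using le card_mono[OF finite_inversions, of "inversions n s - {\<alpha>}" n s] by auto
  finally show "inv_num n (s \<circ> g) \<le> Suc (inv_num n s)" by (simp add: inv_num_def)
  assume na: "\<not> pos_root (s ` \<alpha>)"
  then have "\<alpha> \<in> inversions n s" using root(1) by (simp add: inversions_def)
  then have "card (inversions n s - {\<alpha>}) < card (inversions n s)"
    by (meson card_Diff1_less finite_inversions)
  moreover have "s ` \<alpha> \<in> D_roots n" using root(1) D_pos_subset D_roots_image[OF s] by blast
  then have "pos_root ((s \<circ> g) ` \<alpha>)"
    using na by (simp only: image_comp[symmetric] root(2) image_uminus_signed_perm[OF s] pos_root_uminus not_not simp_thms)
  then have "\<alpha> \<notin> inversions n (s \<circ> g)" by (simp add: inversions_def)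
  ultimately show "inv_num n (s \<circ> g) < inv_num n s" using le by (simp add: inv_num_def)
qed

text \<open>A character of the group of signed permutations; its kernel is the group of type D.\<close>

definition D_sign :: "nat \<Rightarrow> (int \<Rightarrow> int) \<Rightarrow> int" where
  "D_sign n s = (\<Prod>i=1..n. sgn (s (int i)))"

lemma D_sign_comp:
  assumes s: "s \<in> signed_perms n" and t: "t \<in> signed_perms n"
  shows "D_sign n (s \<circ> t) = D_sign n s * D_sign n t"
proof -
  have sgn: "sgn (s k) = sgn (s \<bar>k\<bar>) * sgn k" for k
    using signed_permsD(2,4)[OF s] by (cases "k < 0"; cases "k = 0") auto
  have "D_sign n (s \<circ> t) = (\<Prod>i=1..n. sgn (s (int (nat \<bar>t (int i)\<bar>)))) * D_sign n t"
    unfolding D_sign_def prod.distrib[symmetric]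
    by (rule prod.cong[OF refl]) (subst o_apply, subst sgn, simp)
  also have "(\<Prod>i=1..n. sgn (s (int (nat \<bar>t (int i)\<bar>)))) = D_sign n s"
    unfolding D_sign_def
  proof (rule prod.reindex_bij_betw)
    have "inj_on (\<lambda>i. nat \<bar>t (int i)\<bar>) {1..n}"
      using signed_permsD(5)[OF t] by (intro inj_onI) (metis abs_ge_zero abs_of_nat nat_eq_iff2 of_nat_eq_iff)
    moreover have "(\<lambda>i. nat \<bar>t (int i)\<bar>) ` {1..n} \<subseteq> {1..n}"
    proof (rule image_subsetI)
      fix i assume "i \<in> {1..n}"
      then show "nat \<bar>t (int i)\<bar> \<in> {1..n}"
        using signed_permsD(6,7)[OF t, of "int i"] by auto
    qed
    ultimately show "bij_betw (\<lambda>i. nat \<bar>t (int i)\<bar>) {1..n} {1..n}"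
      by (simp add: bij_betw_def endo_inj_surj)
  qed
  finally show ?thesis .
qed

lemma D_sign_pi_gen: "1 \<le> i \<Longrightarrow> D_sign n (pi_gen i) = 1"
  by (auto simp: D_sign_def pi_gen_apply intro!: prod.neutral)

lemma D_sign_hat_pi_gen:
  assumes "2 \<le> n" shows "D_sign n (hat_pi_gen (n - 1)) = 1"
proof -
  obtain m where m: "n = Suc (Suc m)" using assms by (metis add_2_eq_Suc le_Suc_ex)
  have "(\<Prod>i=1..m. sgn (hat_pi_gen (Suc m) (int i))) = 1"
    by (rule prod.neutral) (auto simp: hat_pi_gen_apply)
  then show ?thesis by (simp add: D_sign_def m hat_pi_gen_apply)
qed

lemma signed_perm_eq_id:
  assumes s: "s \<in> signed_perms n" and fixed: "\<And>i. 1 \<le> i \<Longrightarrow> i \<le> n \<Longrightarrow> s (int i) = int i"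
  shows "s = id"
proof
  fix k
  show "s k = id k"
  proof (cases "k = 0 \<or> \<bar>k\<bar> > int n")
    case True then show ?thesis using signed_permsD(3,4)[OF s] by auto
  next
    case False
    then have "s (int (nat \<bar>k\<bar>)) = int (nat \<bar>k\<bar>)" by (intro fixed) auto
    then show ?thesis using signed_permsD(2)[OF s, of k] by (cases "k < 0") auto
  qed
qed

text \<open>If all simple roots stay positive, then comparing neighbours from the right end shows that
  \<open>s 1, \<dots>, s (n - 1)\<close> are positive and that the absolute values increase strictly.  This leaves the
  identity and the sign change of \<open>n\<close>, and the sign product excludes the latter.\<close>

lemma simple_positive_imp_id:
  assumes s: "s \<in> signed_perms n" and sg: "D_sign n s = 1"
    and pi: "\<And>i. 1 \<le> i \<Longrightarrow> i < n \<Longrightarrow> pos_root (s ` {int i, - int i - 1})"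
    and hat: "2 \<le> n \<Longrightarrow> pos_root (s ` {int n - 1, int n})"
  shows "s = id"
proof (cases "n \<ge> 2")
  case False
  then consider "n = 0" | "n = 1" by linarith
  then show ?thesis
  proof cases
    case 1
    then show ?thesis using s by (intro signed_perm_eq_id[OF s]) auto
  next
    case 2
    have "\<bar>s 1\<bar> \<le> 1" "s 1 \<noteq> 0" using 2 signed_permsD(6,7)[OF s, of 1] by auto
    moreover have "sgn (s 1) = 1" using sg 2 by (simp add: D_sign_def)
    ultimately show ?thesis using 2 by (intro signed_perm_eq_id[OF s]) (auto simp: sgn_if split: if_splits)
  qed
next
  case n: True
  have neq: "\<bar>s a\<bar> \<noteq> \<bar>s b\<bar>" if "\<bar>a\<bar> \<noteq> \<bar>b\<bar>" for a b using that signed_permsD(5)[OF s] by simp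
  have pi': "if \<bar>s (int i)\<bar> < \<bar>s (int i + 1)\<bar> then s (int i) > 0 else s (int i + 1) < 0"
    if "1 \<le> i" "i < n" for i
  proof -
    have "s (- int i - 1) = - s (int i + 1)" using signed_permsD(2)[OF s, of "int i + 1"] by simp
    moreover have "\<bar>s (int i)\<bar> \<noteq> \<bar>s (int i + 1)\<bar>" using that by (intro neq) auto
    ultimately show ?thesis using pi[OF that] by (auto simp: pos_root_pair pos_root_pair')
  qed
  have hat': "if \<bar>s (int n - 1)\<bar> < \<bar>s (int n)\<bar> then s (int n - 1) > 0 else s (int n) > 0"
  proof -
    have "\<bar>s (int n - 1)\<bar> \<noteq> \<bar>s (int n)\<bar>" using n by (intro neq) auto
    then show ?thesis using hat[OF n] by (auto simp: pos_root_pair pos_root_pair')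
  qed
  have chain: "s (int i) > 0 \<and> \<bar>s (int i)\<bar> < \<bar>s (int i + 1)\<bar>" if "1 \<le> i" "i \<le> n - 1" for i
    using that(2)
  proof (induction i rule: inc_induct)
    case base
    have "int (n - 1) = int n - 1" "1 \<le> n - 1" "n - 1 < n" using n by auto
    then show ?case using pi'[of "n - 1"] hat' n by (auto split: if_splits)
  next
    case (step j)
    have "int (Suc j) = int j + 1" "1 \<le> j" "j < n" using step that by auto
    then show ?case using pi'[of j] step.IH by (simp only: split: if_splits) (metis less_irrefl less_trans)
  qed
  have up: "1 \<le> i \<longrightarrow> i \<le> n \<longrightarrow> int i \<le> \<bar>s (int i)\<bar>" for i
  proof (induction i)
    case (Suc j)
    have "s 1 \<noteq> 0" using signed_permsD(6)[OF s, of 1] by simp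
    moreover have "j \<le> n - 1" if "Suc j \<le> n" using that by simp
    ultimately show ?case using Suc chain[of j] by (cases "j = 0") (auto simp: add.commute)
  qed simp
  have down: "\<bar>s (int i)\<bar> \<le> int i" if "1 \<le> i" "i \<le> n" for i
    using that(2)
  proof (induction i rule: inc_induct)
    case base
    show ?case by (simp add: signed_permsD(7)[OF s])
  next
    case (step j)
    then have "\<bar>s (int j)\<bar> < \<bar>s (int j + 1)\<bar>" "int (Suc j) = int j + 1" using chain[of j] that(1) by auto
    then show ?case using step.IH by (simp add: add.commute)
  qed
  have small: "s (int i) = int i" if "1 \<le> i" "i \<le> n - 1" for i
  proof -
    have "i \<le> n" using that by simp
    then show ?thesis using up[of i] down[of i] chain[OF that] that by simp
  qed
  obtain m where m: "n = Suc m" using n by (cases n) auto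
  \<comment> \<open>All other signs are positive, so the sign product equals the sign of the last entry.\<close>
  have "(\<Prod>i=1..m. sgn (s (int i))) = 1" using small m by (intro prod.neutral) auto
  then have "sgn (s (int n)) = 1" using sg by (simp add: D_sign_def m)
  moreover have "\<bar>s (int n)\<bar> = int n" using up[of n] down[of n] n by simp
  ultimately have "s (int n) = int n" using n by (auto simp: sgn_if split: if_splits)
  then show ?thesis using small by (intro signed_perm_eq_id[OF s]) (metis le_neq_implies_less less_Suc_eq_le m diff_Suc_1)
qed

lemma word_prod_snoc: "word_prod (w @ [g]) = word_prod w \<circ> g"
  by (induction w) (simp_all add: word_prod_def comp_assoc)

lemma D_gensE:
  assumes "g \<in> D_gens n"
  obtains \<alpha> where "g \<in> signed_perms n" "\<And>k. g (g k) = k" "D_sign n g = 1" "\<alpha> \<in> D_pos n" "g ` \<alpha> = uminus ` \<alpha>"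
    "\<And>R. R \<in> D_pos n \<Longrightarrow> R \<noteq> \<alpha> \<Longrightarrow> g ` R \<in> D_pos n"
proof -
  have n: "2 \<le> n" using assms by (simp add: D_gens_def split: if_splits)
  then consider i where "1 \<le> i" "i < n" "g = pi_gen i" | "g = hat_pi_gen (n - 1)"
    using assms by (fastforce simp: D_gens_def)
  then show thesis
  proof cases
    case 1
    show ?thesis
      by (rule that) (use 1 pi_gen_in_signed_perms pi_gen_invol D_sign_pi_gen pi_gen_root in blast)+
  next
    case 2
    have "1 \<le> n - 1" "n - 1 < n" using n by auto
    then show ?thesis
      using hat_pi_gen_in_signed_perms[of "n - 1" n] hat_pi_gen_invol[of "n - 1"] D_sign_hat_pi_gen[OF n] hat_pi_gen_root[OF n]
      by (intro that) (unfold 2, blast+)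
  qed
qed

lemma inv_num_id: "inv_num n id = 0"
  by (simp add: inv_num_def inversions_def D_pos_def)

lemma word_prod_signed:
  assumes "set w \<subseteq> D_gens n"
  shows "word_prod w \<in> signed_perms n \<and> D_sign n (word_prod w) = 1 \<and> inv_num n (word_prod w) \<le> length w"
  using assms
proof (induction w rule: rev_induct)
  case Nil
  have "id \<in> signed_perms n" by (simp add: signed_perms_def)
  moreover have "D_sign n id = 1" by (simp add: D_sign_def)
  moreover have "word_prod [] = id" by (simp add: word_prod_def)
  ultimately show ?case using inv_num_id by (simp only: list.size order_refl simp_thms)
next
  case (snoc g w)
  then have IH: "word_prod w \<in> signed_perms n" "D_sign n (word_prod w) = 1" "inv_num n (word_prod w) \<le> length w"
    and "g \<in> D_gens n" by auto
  from \<open>g \<in> D_gens n\<close> obtain \<alpha> where g: "g \<in> signed_perms n" "\<And>k. g (g k) = k" "D_sign n g = 1"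
    "\<alpha> \<in> D_pos n" "g ` \<alpha> = uminus ` \<alpha>" "\<And>R. R \<in> D_pos n \<Longrightarrow> R \<noteq> \<alpha> \<Longrightarrow> g ` R \<in> D_pos n"
    by (rule D_gensE) blast
  have "D_sign n (word_prod w \<circ> g) = 1" using D_sign_comp[OF IH(1) g(1)] IH(2) g(3) by simp
  moreover have "inv_num n (word_prod w \<circ> g) \<le> length (w @ [g])"
    using inv_num_comp_reflection(1)[OF IH(1) g(2) g(4-6)] IH(3) by simp
  ultimately show ?case
    unfolding word_prod_snoc using signed_perms_comp[OF IH(1) g(1)] by blast
qed

text \<open>Sorting: as long as \<open>s\<close> is not the identity, some simple root becomes negative, and multiplying by
  the corresponding generator removes at least one inversion.\<close>

lemma reduced_word_exists:
  assumes "s \<in> signed_perms n" "D_sign n s = 1"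
  shows "\<exists>w. set w \<subseteq> D_gens n \<and> word_prod w = s \<and> length w \<le> inv_num n s"
  using assms
proof (induction "inv_num n s" arbitrary: s rule: less_induct)
  case less
  show ?case
  proof (cases "s = id")
    case True
    then show ?thesis by (intro exI[of _ "[]"]) (simp add: word_prod_def)
  next
    case False
    have "\<exists>g \<alpha>. g \<in> D_gens n \<and> \<alpha> \<in> D_pos n \<and> g ` \<alpha> = uminus ` \<alpha> \<and> \<not> pos_root (s ` \<alpha>)
       \<and> (\<forall>R. R \<in> D_pos n \<longrightarrow> R \<noteq> \<alpha> \<longrightarrow> g ` R \<in> D_pos n)"
    proof (rule ccontr)
      assume no: "\<not> ?thesis"
      have "pos_root (s ` {int i, - int i - 1})" if "1 \<le> i" "i < n" for i
      proof -
        have "pi_gen i \<in> D_gens n" using that by (auto simp: D_gens_def)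
        then show ?thesis using no pi_gen_root[OF that] by blast
      qed
      moreover have "pos_root (s ` {int n - 1, int n})" if "2 \<le> n"
      proof -
        have "hat_pi_gen (n - 1) \<in> D_gens n" using that by (auto simp: D_gens_def)
        then show ?thesis using no hat_pi_gen_root[OF that] by blast
      qed
      ultimately show False using simple_positive_imp_id[OF less.prems] False by blast
    qed
    then obtain g \<alpha> where *: "g \<in> D_gens n \<and> \<alpha> \<in> D_pos n \<and> g ` \<alpha> = uminus ` \<alpha> \<and> \<not> pos_root (s ` \<alpha>)
       \<and> (\<forall>R. R \<in> D_pos n \<longrightarrow> R \<noteq> \<alpha> \<longrightarrow> g ` R \<in> D_pos n)"
      by (elim exE) (rule that)
    then have g: "g \<in> D_gens n" and \<alpha>: "\<alpha> \<in> D_pos n" "g ` \<alpha> = uminus ` \<alpha>"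
      "\<And>R. R \<in> D_pos n \<Longrightarrow> R \<noteq> \<alpha> \<Longrightarrow> g ` R \<in> D_pos n" and neg: "\<not> pos_root (s ` \<alpha>)"
      by simp_all
    obtain g': "g \<in> signed_perms n" "\<And>k. g (g k) = k" "D_sign n g = 1" using g by (rule D_gensE) blast
    have lt: "inv_num n (s \<circ> g) < inv_num n s"
      by (rule inv_num_comp_reflection(2)[OF less.prems(1) g'(2) \<alpha> neg])
    obtain w where w: "set w \<subseteq> D_gens n" "word_prod w = s \<circ> g" "length w \<le> inv_num n (s \<circ> g)"
      using less.hyps[OF lt] signed_perms_comp[OF less.prems(1) g'(1)] D_sign_comp[OF less.prems(1) g'(1)] less.prems(2) g'(3) by auto
    have "word_prod (w @ [g]) = s" unfolding word_prod_snoc w(2) using g'(2) by (simp add: fun_eq_iff)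
    then show ?thesis using w lt g by (intro exI[of _ "w @ [g]"]) auto
  qed
qed

lemma D_group_eq: "D_group n = {s \<in> signed_perms n. D_sign n s = 1}"
  using word_prod_signed reduced_word_exists unfolding D_group_def by fastforce

text \<open>A generator adds at most one inversion, which bounds the length from below; the word produced
  by sorting attains the bound.\<close>

lemma D_length_eq_inv_num:
  assumes "s \<in> D_group n" shows "D_length n s = inv_num n s"
proof -
  have s: "s \<in> signed_perms n" "D_sign n s = 1" using assms by (auto simp: D_group_eq)
  obtain w where w: "set w \<subseteq> D_gens n" "word_prod w = s" "length w \<le> inv_num n s"
    using reduced_word_exists[OF s] by blast
  then have "length w = inv_num n s" using word_prod_signed[OF w(1)] by simp
  moreover have "inv_num n s \<le> k" if "\<exists>w. set w \<subseteq> D_gens n \<and> word_prod w = s \<and> length w = k" for k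
    using that word_prod_signed by blast
  ultimately show ?thesis unfolding D_length_def
    using w by (intro Least_equality) blast+
qed

lemma finite_signed_perms: "finite (signed_perms n)"
proof -
  let ?I = "{- int n..int n}"
  have "inj_on (\<lambda>s. restrict s ?I) (signed_perms n)"
  proof (rule inj_onI, rule ext)
    fix s t k assume st: "s \<in> signed_perms n" "t \<in> signed_perms n" "restrict s ?I = restrict t ?I"
    show "s k = t k"
    proof (cases "k \<in> ?I")
      case True then show ?thesis using st(3) by (metis restrict_apply')
    next
      case False
      then have "int n < \<bar>k\<bar>" by auto
      then show ?thesis using signed_permsD(3)[OF st(1)] signed_permsD(3)[OF st(2)] by simp
    qed
  qed
  moreover have "(\<lambda>s. restrict s ?I) ` signed_perms n \<subseteq> ?I \<rightarrow>\<^sub>E ?I"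
  proof (rule image_subsetI, rule PiE_I)
    fix s k assume "s \<in> signed_perms n" "k \<in> ?I"
    then show "restrict s ?I k \<in> ?I" using signed_permsD(7)[of s n k] by auto
  qed auto
  ultimately show ?thesis by (meson finite_PiE finite_atLeastAtMost_int finite_subset inj_on_finite)
qed

lemma finite_D_group: "finite (D_group n)"
  using finite_signed_perms by (simp add: D_group_eq)

lemma D_group_comp: "s \<in> D_group n \<Longrightarrow> t \<in> D_group n \<Longrightarrow> s \<circ> t \<in> D_group n"
  by (simp add: D_group_eq signed_perms_comp D_sign_comp)

lemma D_group_id: "id \<in> D_group n"
  by (simp add: D_group_eq signed_perms_def D_sign_def)

lemma D_group_inv:
  assumes "s \<in> D_group n" shows "inv s \<in> D_group n"
proof -
  have s: "s \<in> signed_perms n" "D_sign n s = 1" using assms by (auto simp: D_group_eq)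
  have "D_sign n (s \<circ> inv s) = 1" unfolding inv_signed_perm_comp(2)[OF s(1)] using D_group_id[of n] by (simp add: D_group_eq)
  then show ?thesis using s D_sign_comp[OF s(1) inv_signed_perms[OF s(1)]] inv_signed_perms[OF s(1)]
    by (simp add: D_group_eq)
qed

text \<open>Both sides count the roots, up to sign, whose hyperplane separates the chambers of \<open>s\<close> and \<open>t\<close>:
  a root that is positive for \<open>t\<close> and negative for \<open>s\<close> is either itself positive, or its negative
  is, and this gives the two halves of the symmetric difference.\<close>

lemma inv_num_cocycle:
  assumes s: "s \<in> signed_perms n" and t: "t \<in> signed_perms n"
  shows "inv_num n (inv s \<circ> t) = card (sym_diff (inversions n (inv s)) (inversions n (inv t)))"
proof -
  let ?u = "inv s" and ?v = "inv t"
  have u: "?u \<in> signed_perms n" and v: "?v \<in> signed_perms n" using s t inv_signed_perms by auto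
  have tv: "t ` ?v ` R = R" "?v ` t ` R = R" for R
    using inv_signed_perm_comp[OF t] by (simp_all add: image_comp)
  have mm: "uminus ` uminus ` R = R" for R :: "int set" by (simp add: image_image)
  have posneg: "R \<in> D_pos n \<longleftrightarrow> R \<in> D_roots n \<and> pos_root R" for R by (simp add: D_pos_def)
  define I where "I = inversions n (?u \<circ> t)"
  have I: "R \<in> I \<longleftrightarrow> R \<in> D_roots n \<and> pos_root R \<and> \<not> pos_root (?u ` t ` R)" for R
    by (simp only: I_def inversions_def D_pos_def image_comp mem_Collect_eq conj_assoc)
  note rts = D_roots_image[OF t] D_roots_image[OF u] D_roots_image[OF v] D_roots_uminus
  note ums = image_uminus_signed_perm[OF t] image_uminus_signed_perm[OF u] image_uminus_signed_perm[OF v]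
  have "bij_betw ((`) t) {R \<in> I. pos_root (t ` R)} (inversions n ?u - inversions n ?v)"
    by (rule bij_betw_byWitness[where f' = "(`) ?v"])
       (auto simp: tv I inversions_def posneg rts)
  moreover have "bij_betw (\<lambda>R. uminus ` t ` R) {R \<in> I. \<not> pos_root (t ` R)} (inversions n ?v - inversions n ?u)"
    by (rule bij_betw_byWitness[where f' = "\<lambda>R. uminus ` ?v ` R"])
       (auto simp: tv mm ums I inversions_def posneg rts pos_root_uminus[of _ n])
  moreover have "finite I" by (simp add: I_def finite_inversions)
  moreover have "I = {R \<in> I. pos_root (t ` R)} \<union> {R \<in> I. \<not> pos_root (t ` R)}" by blast
  moreover from calculation have "card I = card {R \<in> I. pos_root (t ` R)} + card {R \<in> I. \<not> pos_root (t ` R)}"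
    by (intro arg_cong[where f = card, THEN trans, OF _ card_Un_disjoint]) auto
  moreover have "card (sym_diff (inversions n ?u) (inversions n ?v))
     = card (inversions n ?u - inversions n ?v) + card (inversions n ?v - inversions n ?u)"
    by (rule card_Un_disjoint) (auto simp: finite_inversions)
  ultimately show ?thesis by (simp only: inv_num_def I_def[symmetric] bij_betw_same_card)
qed


section \<open>Coset representatives of minimal length\<close>

lemma signed_permsI:
  assumes odd: "\<And>k. s (- k) = - s k" and fx: "\<And>k. int n < \<bar>k\<bar> \<Longrightarrow> s k = k"
    and rng: "\<And>k. 1 \<le> k \<Longrightarrow> k \<le> int n \<Longrightarrow> s k \<noteq> 0 \<and> \<bar>s k\<bar> \<le> int n"
    and inj: "\<And>k l. 1 \<le> k \<Longrightarrow> k < l \<Longrightarrow> l \<le> int n \<Longrightarrow> \<bar>s k\<bar> \<noteq> \<bar>s l\<bar>"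
  shows "s \<in> signed_perms n"
proof -
  have z: "s 0 = 0" using odd[of 0] by simp
  have abs: "\<bar>s \<bar>k\<bar>\<bar> = \<bar>s k\<bar>" for k using odd[of k] by (cases "k < 0") auto
  have ne: "s k \<noteq> 0" and bd: "\<bar>s k\<bar> \<le> int n" if "k \<noteq> 0" "\<bar>k\<bar> \<le> int n" for k
    using rng[of "\<bar>k\<bar>"] abs[of k] that by auto
  have bd': "\<bar>s k\<bar> \<le> int n" if "\<bar>k\<bar> \<le> int n" for k using bd[of k] that z by (cases "k = 0") auto
  have "inj s"
  proof (rule injI)
    fix a b assume eq: "s a = s b"
    have *: "int n < \<bar>a\<bar> \<longleftrightarrow> int n < \<bar>b\<bar>" using bd'[of a] bd'[of b] fx[of a] fx[of b] eq by force
    show "a = b"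
    proof (cases "int n < \<bar>a\<bar>")
      case True
      then show ?thesis using eq * fx by simp
    next
      case False
      have ze: "a = 0 \<longleftrightarrow> b = 0" using ne[of a] ne[of b] z eq False * by (metis linorder_not_less)
      have "\<bar>s \<bar>a\<bar>\<bar> = \<bar>s \<bar>b\<bar>\<bar>" using abs eq by simp
      then have "\<not> \<bar>a\<bar> < \<bar>b\<bar>" "\<not> \<bar>b\<bar> < \<bar>a\<bar>"
        using inj[of "\<bar>a\<bar>" "\<bar>b\<bar>"] inj[of "\<bar>b\<bar>" "\<bar>a\<bar>"] False * ze
        by (metis abs_not_less_zero int_one_le_iff_zero_less linorder_not_less zero_less_abs_iff abs_zero)+
      then have "\<bar>a\<bar> = \<bar>b\<bar>" by simp
      moreover have "a = b" if "a = - b"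
      proof (rule ccontr)
        assume "a \<noteq> b"
        then have "s b \<noteq> 0" using that ne[of b] False * by auto
        then show False using odd[of b] eq that by simp
      qed
      ultimately show ?thesis by (metis abs_eq_iff)
    qed
  qed
  moreover have "surj s"
  proof -
    have "s ` {- int n..int n} \<subseteq> {- int n..int n}"
    proof (rule image_subsetI)
      fix k assume "k \<in> {- int n..int n}"
      then have "\<bar>s k\<bar> \<le> int n" by (intro bd') auto
      then show "s k \<in> {- int n..int n}" by auto
    qed
    then have *: "s ` {- int n..int n} = {- int n..int n}"
      using \<open>inj s\<close> by (intro endo_inj_surj) (auto intro: inj_on_subset)
    show ?thesis
      unfolding surj_def
    proof (rule allI)
      fix y
      show "\<exists>x. y = s x"
      proof (cases "int n < \<bar>y\<bar>")
        case True then show ?thesis using fx[of y] by metis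
      next
        case False
        then have "y \<in> s ` {- int n..int n}" unfolding * by auto
        then show ?thesis by blast
      qed
    qed
  qed
  ultimately show ?thesis using odd fx by (simp add: signed_perms_def bij_def)
qed

text \<open>Moving signed indices away from \<open>0\<close> by one, and back.  Conjugation with these maps embeds the
  group of rank \<open>n\<close> into that of rank \<open>n + 1\<close> as the stabilizer of the index \<open>1\<close>.\<close>

definition shift_up :: "int \<Rightarrow> int" where "shift_up k = k + sgn k"

definition shift_down :: "int \<Rightarrow> int" where "shift_down k = k - sgn k"

definition embed_perm :: "(int \<Rightarrow> int) \<Rightarrow> int \<Rightarrow> int" where
  "embed_perm s k = (if \<bar>k\<bar> \<le> 1 then k else shift_up (s (shift_down k)))"

lemma shift_down_up [simp]: "shift_down (shift_up k) = k"
  by (simp add: shift_down_def shift_up_def sgn_if)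

lemma shift_up_down: "1 < \<bar>k\<bar> \<Longrightarrow> shift_up (shift_down k) = k"
  by (auto simp: shift_down_def shift_up_def sgn_if)

lemma shift_down_nonzero: "1 < \<bar>k\<bar> \<Longrightarrow> shift_down k \<noteq> 0"
  by (auto simp: shift_down_def sgn_if)

lemma shift_minus: "shift_up (- k) = - shift_up k" "shift_down (- k) = - shift_down k"
  by (simp_all add: shift_down_def shift_up_def)

lemma abs_shift_up: "k \<noteq> 0 \<Longrightarrow> \<bar>shift_up k\<bar> = \<bar>k\<bar> + 1"
  by (simp add: shift_up_def sgn_if)

lemma abs_shift_down: "k \<noteq> 0 \<Longrightarrow> \<bar>shift_down k\<bar> = \<bar>k\<bar> - 1"
  by (simp add: shift_down_def sgn_if)

lemma embed_shift_up: "k \<noteq> 0 \<Longrightarrow> embed_perm s (shift_up k) = shift_up (s k)"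
  using abs_shift_up[of k] by (simp add: embed_perm_def)

lemma embed_fix: "\<bar>k\<bar> \<le> 1 \<Longrightarrow> embed_perm s k = k"
  by (simp add: embed_perm_def)

lemma embed_comp:
  assumes "t \<in> signed_perms n"
  shows "embed_perm s \<circ> embed_perm t = embed_perm (s \<circ> t)"
proof
  fix k
  show "(embed_perm s \<circ> embed_perm t) k = embed_perm (s \<circ> t) k"
  proof (cases "\<bar>k\<bar> \<le> 1")
    case False
    then have "shift_down k \<noteq> 0" by (intro shift_down_nonzero) simp
    then have "t (shift_down k) \<noteq> 0" using signed_permsD(6)[OF assms] by simp
    then show ?thesis using False by (simp add: embed_perm_def[of t] embed_perm_def[of "s \<circ> t"] embed_shift_up)
  qed (simp add: embed_fix)
qed

lemma embed_id: "embed_perm id = id"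
  by (rule ext) (simp add: embed_perm_def shift_up_down)

lemma embed_signed_perms:
  assumes s: "s \<in> signed_perms n"
  shows "embed_perm s \<in> signed_perms (Suc n)" "inv (embed_perm s) = embed_perm (inv s)"
proof -
  have 1: "embed_perm s \<circ> embed_perm (inv s) = id" "embed_perm (inv s) \<circ> embed_perm s = id"
    using embed_comp[OF s, of "inv s"] embed_comp[OF inv_signed_perms[OF s], of s]
      inv_signed_perm_comp[OF s] embed_id by simp_all
  then have "bij (embed_perm s)" using o_bij by blast
  moreover have "embed_perm s (- k) = - embed_perm s k" for k
    by (simp add: embed_perm_def shift_minus signed_permsD(2)[OF s])
  moreover have "embed_perm s k = k" if "int (Suc n) < \<bar>k\<bar>" for k
  proof -
    have "int n < \<bar>shift_down k\<bar>" using that abs_shift_down[of k] by auto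
    then have "s (shift_down k) = shift_down k" using signed_permsD(3)[OF s] by blast
    then show ?thesis by (simp add: embed_perm_def shift_up_down)
  qed
  ultimately show "embed_perm s \<in> signed_perms (Suc n)" by (simp add: signed_perms_def)
  show "inv (embed_perm s) = embed_perm (inv s)" using 1 by (intro inv_unique_comp)
qed

lemma sgn_shift_up: "sgn (shift_up k) = sgn k"
  by (simp add: shift_up_def sgn_if)

lemma D_sign_embed: "D_sign (Suc n) (embed_perm s) = D_sign n s"
proof -
  have "D_sign (Suc n) (embed_perm s) = sgn (embed_perm s 1) * (\<Prod>i=Suc 1..Suc n. sgn (embed_perm s (int i)))"
    unfolding D_sign_def by (subst prod.atLeast_Suc_atMost) simp_all
  also have "(\<Prod>i=Suc 1..Suc n. sgn (embed_perm s (int i))) = (\<Prod>i=1..n. sgn (embed_perm s (int (Suc i))))"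
    by (rule prod.shift_bounds_cl_Suc_ivl)
  also have "\<dots> = D_sign n s"
    unfolding D_sign_def
  proof (rule prod.cong[OF refl])
    fix i assume "i \<in> {1..n}"
    then have "int (Suc i) = shift_up (int i)" "int i \<noteq> 0" by (simp_all add: shift_up_def)
    then show "sgn (embed_perm s (int (Suc i))) = sgn (s (int i))" by (simp add: embed_shift_up sgn_shift_up)
  qed
  finally show ?thesis by (simp add: embed_fix)
qed

lemma embed_D_group: "s \<in> D_group n \<Longrightarrow> embed_perm s \<in> D_group (Suc n)"
  by (simp add: D_group_eq D_sign_embed embed_signed_perms)

lemma embed_inject:
  assumes "s \<in> signed_perms n" "t \<in> signed_perms n" "embed_perm s = embed_perm t" shows "s = t"
proof
  fix k
  show "s k = t k"
  proof (cases "k = 0")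
    case True then show ?thesis using signed_permsD(4)[OF assms(1)] signed_permsD(4)[OF assms(2)] by simp
  next
    case False
    then have "shift_up (s k) = shift_up (t k)" using assms(3) embed_shift_up by metis
    then show ?thesis using shift_down_up by metis
  qed
qed

text \<open>A signed permutation that fixes \<open>1\<close> also fixes \<open>-1\<close> and hence preserves the other
  indices.\<close>

lemma embed_surj:
  assumes t: "t \<in> signed_perms (Suc n)" and 1: "t 1 = 1"
  obtains s where "s \<in> signed_perms n" "t = embed_perm s"
proof -
  define s where "s k = (if k = 0 then 0 else shift_down (t (shift_up k)))" for k
  have big: "1 < \<bar>t k\<bar>" if "1 < \<bar>k\<bar>" for k
    using signed_permsD(5)[OF t, of k 1] signed_permsD(6)[OF t, of k] that 1 by auto
  have emb: "t = embed_perm s"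
  proof
    fix k
    show "t k = embed_perm s k"
    proof (cases "1 < \<bar>k\<bar>")
      case True
      then have "shift_down k \<noteq> 0" by (intro shift_down_nonzero) simp
      then show ?thesis using True big[OF True] by (simp add: embed_perm_def s_def shift_up_down)
    next
      case False
      then consider "k = 0" | "k = 1" | "k = - 1" by linarith
      then show ?thesis using 1 signed_permsD(2)[OF t, of 1] signed_permsD(4)[OF t] False
        by cases (simp_all add: embed_fix)
    qed
  qed
  have big2: "1 < \<bar>t (shift_up k)\<bar>" if "k \<noteq> 0" for k
    using big[of "shift_up k"] abs_shift_up[OF that] that by linarith
  have abs_s: "\<bar>s k\<bar> = \<bar>t (shift_up k)\<bar> - 1" if "k \<noteq> 0" for k
    using that big2[OF that] abs_shift_down[of "t (shift_up k)"] by (auto simp: s_def)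
  have "s \<in> signed_perms n"
  proof (rule signed_permsI)
    show "s (- k) = - s k" for k by (simp add: s_def shift_minus signed_permsD(2)[OF t])
    show "s k = k" if "int n < \<bar>k\<bar>" for k
    proof -
      have "k \<noteq> 0" using that by auto
      then have "t (shift_up k) = shift_up k" using that abs_shift_up[of k] by (intro signed_permsD(3)[OF t]) simp
      then show ?thesis using \<open>k \<noteq> 0\<close> by (simp add: s_def)
    qed
    show "s k \<noteq> 0 \<and> \<bar>s k\<bar> \<le> int n" if "1 \<le> k" "k \<le> int n" for k
    proof -
      have "\<bar>t (shift_up k)\<bar> \<le> int (Suc n)"
        using that abs_shift_up[of k] signed_permsD(7)[OF t, of "shift_up k"] by auto
      then show ?thesis using abs_s[of k] big2[of k] that by auto
    qed
    show "\<bar>s k\<bar> \<noteq> \<bar>s l\<bar>" if "1 \<le> k" "k < l" "l \<le> int n" for k l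
    proof -
      have "\<bar>shift_up k\<bar> \<noteq> \<bar>shift_up l\<bar>" using that abs_shift_up[of k] abs_shift_up[of l] by auto
      then have "\<bar>t (shift_up k)\<bar> \<noteq> \<bar>t (shift_up l)\<bar>" using signed_permsD(5)[OF t] by blast
      then show ?thesis using abs_s[of k] abs_s[of l] that by auto
    qed
  qed
  then show thesis using emb that by blast
qed

lemma pos_root_shift_up:
  assumes "R \<in> D_roots n" shows "pos_root (shift_up ` R) \<longleftrightarrow> pos_root R"
proof -
  obtain a b where R: "R = {a, b}" "\<bar>a\<bar> \<noteq> \<bar>b\<bar>" "a \<noteq> 0" "b \<noteq> 0"
    using assms unfolding D_roots_def by blast
  have "0 < shift_up a \<longleftrightarrow> 0 < a" "0 < shift_up b \<longleftrightarrow> 0 < b" by (auto simp: shift_up_def sgn_if)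
  then show ?thesis using R abs_shift_up[of a] abs_shift_up[of b]
    by (cases "\<bar>a\<bar> < \<bar>b\<bar>") (simp_all add: pos_root_pair pos_root_pair')
qed

lemma embed_image_shift_up:
  assumes "R \<in> D_roots n" shows "embed_perm s ` shift_up ` R = shift_up ` s ` R"
proof -
  obtain a b where "R = {a, b}" "a \<noteq> 0" "b \<noteq> 0" using assms unfolding D_roots_def by blast
  then show ?thesis by (simp add: embed_shift_up)
qed

text \<open>Roots with the entry \<open>1\<close> are never inverted by an element that fixes \<open>1\<close>, since this entry decides
  their sign; the other roots are the shifted roots of the smaller system.\<close>

lemma inversions_embed:
  assumes s: "s \<in> signed_perms n"
  shows "inversions (Suc n) (embed_perm s) = (`) shift_up ` inversions n s"
proof (intro set_eqI iffI)
  fix R assume "R \<in> inversions (Suc n) (embed_perm s)"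
  then have "R \<in> D_pos (Suc n)" and neg: "\<not> pos_root (embed_perm s ` R)" by (auto simp: inversions_def)
  then obtain a b where R: "R = {a, b}" "0 < a" "a < \<bar>b\<bar>" "\<bar>b\<bar> \<le> int (Suc n)" unfolding D_pos_iff by blast
  have "a \<noteq> 1"
  proof
    assume a: "a = 1"
    have "1 < \<bar>embed_perm s b\<bar>"
      using signed_permsD(5,6)[OF embed_signed_perms(1)[OF s]] R a embed_fix[of 1 s] by (smt (verit))
    then have "pos_root {1, embed_perm s b}" by (simp add: pos_root_pair)
    then show False using neg R(1) a by (simp add: embed_fix)
  qed
  define R' where "R' = {shift_down a, shift_down b}"
  have sh: "R = shift_up ` R'" using R \<open>a \<noteq> 1\<close> by (simp add: R'_def shift_up_down)
  have "0 < shift_down a \<and> shift_down a < \<bar>shift_down b\<bar> \<and> \<bar>shift_down b\<bar> \<le> int n"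
    using R \<open>a \<noteq> 1\<close> abs_shift_down[of b] by (simp add: shift_down_def)
  then have R': "R' \<in> D_pos n" unfolding D_pos_iff R'_def by blast
  then have "R' \<in> D_roots n" using D_pos_subset by blast
  then have "\<not> pos_root (s ` R')"
    using neg unfolding sh embed_image_shift_up[OF \<open>R' \<in> D_roots n\<close>]
    by (simp only: pos_root_shift_up[OF D_roots_image[OF s]] not_False_eq_True)
  then show "R \<in> (`) shift_up ` inversions n s" using R' sh by (auto simp: inversions_def)
next
  fix R assume "R \<in> (`) shift_up ` inversions n s"
  then obtain R' where R': "R' \<in> D_pos n" "\<not> pos_root (s ` R')" and sh: "R = shift_up ` R'"
    by (auto simp: inversions_def)
  then have rt: "R' \<in> D_roots n" using D_pos_subset by blast
  obtain a b where R: "R' = {a, b}" "0 < a" "a < \<bar>b\<bar>" "\<bar>b\<bar> \<le> int n" using R'(1) unfolding D_pos_iff by blast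
  have "R = {shift_up a, shift_up b}" using sh R(1) by simp
  moreover have "0 < shift_up a \<and> shift_up a < \<bar>shift_up b\<bar> \<and> \<bar>shift_up b\<bar> \<le> int (Suc n)"
    using R abs_shift_up[of b] by (simp add: shift_up_def)
  ultimately have "R \<in> D_pos (Suc n)" unfolding D_pos_iff by blast
  moreover have "\<not> pos_root (embed_perm s ` R)"
    using R'(2) unfolding sh embed_image_shift_up[OF rt] pos_root_shift_up[OF D_roots_image[OF s rt]] .
  ultimately show "R \<in> inversions (Suc n) (embed_perm s)" by (simp add: inversions_def)
qed

lemma inv_num_embed: "s \<in> signed_perms n \<Longrightarrow> inv_num (Suc n) (embed_perm s) = inv_num n s"
proof -
  have "inj shift_up" by (rule inj_on_inverseI[where g = shift_down]) simp
  then have "inj_on ((`) shift_up) A" for A by (meson inj_image_eq_iff inj_onI)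
  moreover assume "s \<in> signed_perms n"
  ultimately show ?thesis by (simp add: inv_num_def inversions_embed card_image)
qed

text \<open>The inverse of the minimal representative of a coset of the stabilizer of \<open>1\<close>.  It sends \<open>1\<close> to
  \<open>k\<close> and the remaining indices in increasing order to the remaining absolute values.  If \<open>k\<close> is
  negative, a second sign change is necessary to stay in the group; placing it at \<open>n\<close>, the entry of
  largest absolute value, creates no further inversions.\<close>

definition front :: "nat \<Rightarrow> int \<Rightarrow> int \<Rightarrow> int" where
  "front n k j = (if j = 0 \<or> int n < \<bar>j\<bar> then j
     else if \<bar>j\<bar> = 1 then sgn j * k
     else sgn j * (if k < 0 \<and> \<bar>j\<bar> = int n then - 1 else 1) * (if \<bar>j\<bar> \<le> \<bar>k\<bar> then \<bar>j\<bar> - 1 else \<bar>j\<bar>))"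

text \<open>For \<open>n = 1\<close> the group is trivial, so \<open>k = -1\<close> does not occur.\<close>

definition front_indices :: "nat \<Rightarrow> int set" where
  "front_indices n = {k. k \<noteq> 0 \<and> \<bar>k\<bar> \<le> int n \<and> (n = 1 \<longrightarrow> 0 < k)}"

lemma front_one: "k \<in> front_indices n \<Longrightarrow> front n k 1 = k"
  by (auto simp: front_def front_indices_def)

lemma front_signed_perms:
  assumes k: "k \<in> front_indices n" shows "front n k \<in> signed_perms n"
proof (rule signed_permsI)
  show "front n k (- j) = - front n k j" for j by (auto simp: front_def sgn_minus)
  show "front n k j = j" if "int n < \<bar>j\<bar>" for j using that by (simp add: front_def)
  show "front n k j \<noteq> 0 \<and> \<bar>front n k j\<bar> \<le> int n" if "1 \<le> j" "j \<le> int n" for j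
    using that k by (auto simp: front_def front_indices_def)
  show "\<bar>front n k i\<bar> \<noteq> \<bar>front n k j\<bar>" if "1 \<le> i" "i < j" "j \<le> int n" for i j
    using that k by (auto simp: front_def front_indices_def split: if_splits)
qed

lemma D_sign_front:
  assumes k: "k \<in> front_indices n" shows "D_sign n (front n k) = 1"
proof (cases "0 < k")
  case True
  then show ?thesis using k unfolding D_sign_def
    by (intro prod.neutral) (auto simp: front_def front_indices_def)
next
  case False
  then have "k < 0" "2 \<le> n" using k by (auto simp: front_indices_def intro: Suc_leI)
  then have n: "{1..n} = insert 1 (insert n {2..<n})" by auto
  have "(\<Prod>i\<in>{2..<n}. sgn (front n k (int i))) = 1" using \<open>k < 0\<close>
    by (intro prod.neutral) (auto simp: front_def)
  moreover have "sgn (front n k (int 1)) = - 1" using \<open>k < 0\<close> \<open>2 \<le> n\<close> by (simp add: front_def)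
  moreover have "sgn (front n k (int n)) = - 1" using \<open>k < 0\<close> \<open>2 \<le> n\<close> by (simp add: front_def)
  ultimately show ?thesis using \<open>2 \<le> n\<close> unfolding D_sign_def n by simp
qed

lemma front_D_group: "k \<in> front_indices n \<Longrightarrow> front n k \<in> D_group n"
  by (simp add: D_group_eq front_signed_perms D_sign_front)

text \<open>Away from the index \<open>1\<close> the map is increasing in absolute value and only the last sign can be
  negative; therefore an inverted root has the entry \<open>1\<close>.\<close>

lemma inversions_front:
  assumes k: "k \<in> front_indices n"
  shows "inversions n (front n k) =
    (\<lambda>b. {1, b}) ` {b. 1 < \<bar>b\<bar> \<and> \<bar>b\<bar> \<le> int n \<and> \<not> pos_root {k, front n k b}}"
proof (intro set_eqI iffI)
  fix R assume "R \<in> inversions n (front n k)"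
  then have "R \<in> D_pos n" and neg: "\<not> pos_root (front n k ` R)" by (auto simp: inversions_def)
  then obtain a b where R: "R = {a, b}" "0 < a" "a < \<bar>b\<bar>" "\<bar>b\<bar> \<le> int n" unfolding D_pos_iff by blast
  have "a = 1"
  proof (rule ccontr)
    assume "a \<noteq> 1"
    then have a: "2 \<le> a" using R(2) by simp
    let ?a = "front n k a" and ?b = "front n k b"
    have "0 < ?a" "\<bar>?a\<bar> < \<bar>?b\<bar>" using a R(2-) by (auto simp: front_def abs_mult)
    then have "pos_root {?a, ?b}" by (simp add: pos_root_pair)
    then show False using neg R(1) by simp
  qed
  then show "R \<in> (\<lambda>b. {1, b}) ` {b. 1 < \<bar>b\<bar> \<and> \<bar>b\<bar> \<le> int n \<and> \<not> pos_root {k, front n k b}}"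
    using R neg front_one[OF k] by auto
next
  fix R assume "R \<in> (\<lambda>b. {1, b}) ` {b. 1 < \<bar>b\<bar> \<and> \<bar>b\<bar> \<le> int n \<and> \<not> pos_root {k, front n k b}}"
  then obtain b where R: "R = {1, b}" "1 < \<bar>b\<bar>" "\<bar>b\<bar> \<le> int n" "\<not> pos_root {k, front n k b}" by blast
  then have "R \<in> D_pos n" unfolding D_pos_iff by (intro exI[of _ 1] exI[of _ b]) simp
  then show "R \<in> inversions n (front n k)" using R front_one[OF k] by (simp add: inversions_def)
qed

text \<open>By the previous lemma one has to count the indices \<open>c\<close> with \<open>\<bar>c\<bar> \<noteq> \<bar>k\<bar>\<close> for which the root
  \<open>{k, c}\<close> is negative.  For \<open>k > 0\<close> these are \<open>-1, \<dots>, -(k - 1)\<close>; for \<open>k < 0\<close> they are all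
  negative \<open>c\<close> and, in addition, the positive \<open>c\<close> beyond \<open>\<bar>k\<bar>\<close>.\<close>

lemma inv_num_front:
  assumes k: "k \<in> front_indices n"
  shows "inv_num n (front n k) = (if 0 < k then nat k - 1 else 2 * n - 1 - nat (- k))"
proof -
  let ?r = "front n k"
  note r = front_signed_perms[OF k]
  let ?B = "{b. 1 < \<bar>b\<bar> \<and> \<bar>b\<bar> \<le> int n \<and> \<not> pos_root {k, ?r b}}"
  let ?C = "{c. c \<noteq> 0 \<and> \<bar>c\<bar> \<le> int n \<and> \<bar>c\<bar> \<noteq> \<bar>k\<bar> \<and> \<not> pos_root {k, c}}"
  have "inj_on (\<lambda>b. {1, b}) ?B" by (rule inj_onI) (auto simp: doubleton_eq_iff)
  then have "inv_num n ?r = card ?B" by (simp add: inv_num_def inversions_front[OF k] card_image)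
  also have "\<dots> = card ?C"
  proof (rule bij_betw_same_card)
    have mem: "b \<in> ?B \<longleftrightarrow> ?r b \<in> ?C" for b
    proof -
      have "\<bar>?r b\<bar> = \<bar>k\<bar> \<longleftrightarrow> \<bar>b\<bar> = 1" using signed_permsD(5)[OF r, of b 1] front_one[OF k] by simp
      then show ?thesis using signed_permsD(6,7)[OF r, of b] by auto
    qed
    have "inj ?r" "surj ?r" using signed_permsD(1)[OF r] by (auto simp: bij_def)
    then show "bij_betw ?r ?B ?C"
      unfolding bij_betw_def using mem by (auto intro: inj_on_subset simp: image_iff)
  qed
  also have "card ?C = (if 0 < k then nat k - 1 else 2 * n - 1 - nat (- k))"
  proof (cases "0 < k")
    case True
    have pos: "pos_root {k, c} \<longleftrightarrow> \<bar>c\<bar> < k \<longrightarrow> 0 < c" if "\<bar>c\<bar> \<noteq> \<bar>k\<bar>" for c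
      using that True by (cases "\<bar>c\<bar> < \<bar>k\<bar>") (auto simp: pos_root_pair pos_root_pair')
    have "?C = {- (k - 1)..-1}" using k True by (auto simp: pos front_indices_def)
    then show ?thesis using True by simp
  next
    case False
    then have k0: "k < 0" "- k \<le> int n" using k by (auto simp: front_indices_def)
    have pos: "pos_root {k, c} \<longleftrightarrow> \<bar>c\<bar> < - k \<and> 0 < c" if "\<bar>c\<bar> \<noteq> \<bar>k\<bar>" for c
      using that k0 by (cases "\<bar>c\<bar> < \<bar>k\<bar>") (auto simp: pos_root_pair pos_root_pair')
    \<comment> \<open>There are \<open>n + k\<close> positive and \<open>n - 1\<close> negative elements.\<close>
    have "?C = {- k + 1..int n} \<union> ({- int n..-1} - {k})" using k0 by (auto simp: pos)
    also have "card \<dots> = card {- k + 1..int n} + card ({- int n..-1} - {k})"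
      using k0 by (intro card_Un_disjoint) auto
    also have "card ({- int n..-1} - {k}) = n - 1" using k0 by simp
    finally show ?thesis using k0 by (simp add: nat_diff_distrib)
  qed
  finally show ?thesis .
qed

text \<open>The lengths add up because the two factors invert disjoint sets of roots: the first one roots
  without the entry \<open>1\<close>, the second one roots with this entry.\<close>

lemma inv_num_embed_front:
  assumes s: "s \<in> signed_perms n" and k: "k \<in> front_indices (Suc n)"
  shows "inv_num (Suc n) (embed_perm s \<circ> inv (front (Suc n) k)) = inv_num n s + inv_num (Suc n) (front (Suc n) k)"
proof -
  let ?r = "front (Suc n) k" and ?e = "embed_perm s"
  note r = front_signed_perms[OF k] and e = embed_signed_perms(1)[OF s]
  have "inv (inv ?r) = ?r" "inv (inv ?e) = ?e"
    using signed_permsD(1)[OF r] signed_permsD(1)[OF e] by (simp_all add: inv_inv_eq)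
  then have "inv_num (Suc n) (?e \<circ> inv ?r)
     = card (sym_diff (inversions (Suc n) ?e) (inversions (Suc n) ?r))"
    using inv_num_cocycle[OF inv_signed_perms[OF e] inv_signed_perms[OF r]] by simp
  moreover have "inversions (Suc n) ?e \<inter> inversions (Suc n) ?r = {}"
  proof (rule ccontr)
    assume "\<not> ?thesis"
    then obtain R b where R: "R \<in> inversions (Suc n) ?e" "R = {1, b}" "1 < \<bar>b\<bar>"
      unfolding inversions_front[OF k] by blast
    then obtain R' where R': "R' \<in> D_pos n" "R = shift_up ` R'"
      unfolding inversions_embed[OF s] by (auto simp: inversions_def)
    then obtain c where "c \<in> R'" "shift_up c = 1" using R(2) by (metis imageE insertI1)
    moreover have "c \<noteq> 0" using \<open>c \<in> R'\<close> R'(1) unfolding D_pos_iff by auto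
    ultimately show False using abs_shift_up[of c] by simp
  qed
  ultimately have "inv_num (Suc n) (?e \<circ> inv ?r) = inv_num (Suc n) ?e + inv_num (Suc n) ?r"
    by (simp add: inv_num_def card_Un_disjoint finite_inversions Diff_triv Int_commute)
  then show ?thesis by (simp add: inv_num_embed[OF s])
qed

lemma finite_front_indices: "finite (front_indices n)"
  by (rule finite_subset[of _ "{- int n..int n}"]) (auto simp: front_indices_def)

text \<open>The index \<open>k\<close> of the coset of \<open>t\<close> is the preimage of \<open>1\<close> under \<open>t\<close>.\<close>

lemma D_group_coset_bij:
  "bij_betw (\<lambda>(k, s). embed_perm s \<circ> inv (front (Suc n) k)) (front_indices (Suc n) \<times> D_group n) (D_group (Suc n))"
proof (rule bij_betwI')
  let ?f = "\<lambda>(k, s). embed_perm s \<circ> inv (front (Suc n) k)"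
  have sp: "s \<in> D_group m \<Longrightarrow> s \<in> signed_perms m" for s m using D_group_subset by blast
  {
    fix x y assume x: "x \<in> front_indices (Suc n) \<times> D_group n" and y: "y \<in> front_indices (Suc n) \<times> D_group n"
    obtain k s where x': "x = (k, s)" "k \<in> front_indices (Suc n)" "s \<in> D_group n" using x by auto
    obtain l t where y': "y = (l, t)" "l \<in> front_indices (Suc n)" "t \<in> D_group n" using y by auto
    show "?f x = ?f y \<longleftrightarrow> x = y"
    proof
      assume eq: "?f x = ?f y"
      have e: "embed_perm u \<in> signed_perms (Suc n)" if "u \<in> D_group n" for u
        using embed_signed_perms(1)[OF sp[OF that]] .
      have at: "(embed_perm u \<circ> inv (front (Suc n) i)) i = 1" if "i \<in> front_indices (Suc n)" for u i
      proof -
        have "inv (front (Suc n) i) i = 1"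
          using front_one[OF that] bij_inv_eq_iff[OF signed_permsD(1)[OF front_signed_perms[OF that]]] by metis
        then show ?thesis by (simp add: embed_fix)
      qed
      have inj: "inj (embed_perm u \<circ> inv (front (Suc n) i))" if "i \<in> front_indices (Suc n)" "u \<in> D_group n" for u i
        using signed_permsD(1)[OF signed_perms_comp[OF e[OF that(2)] inv_signed_perms[OF front_signed_perms[OF that(1)]]]]
        by (simp add: bij_def)
      have eq': "embed_perm s \<circ> inv (front (Suc n) k) = embed_perm t \<circ> inv (front (Suc n) l)"
        using eq x'(1) y'(1) by simp
      have "(embed_perm t \<circ> inv (front (Suc n) l)) k = (embed_perm t \<circ> inv (front (Suc n) l)) l"
        unfolding at[OF y'(2)] unfolding eq'[symmetric] by (rule at[OF x'(2)])
      then have "k = l" using inj[OF y'(2,3)] by (meson injD)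
      then have "embed_perm s \<circ> inv (front (Suc n) k) \<circ> front (Suc n) k = embed_perm t \<circ> inv (front (Suc n) k) \<circ> front (Suc n) k"
        using eq x'(1) y'(1) by simp
      then have "embed_perm s = embed_perm t"
        using inv_signed_perm_comp(1)[OF front_signed_perms[OF x'(2)]] by (simp add: comp_assoc)
      then show "x = y" using embed_inject[OF sp sp] x' y' \<open>k = l\<close> by blast
    qed simp
  next
    fix x assume "x \<in> front_indices (Suc n) \<times> D_group n"
    then show "?f x \<in> D_group (Suc n)"
      using D_group_comp[OF embed_D_group D_group_inv[OF front_D_group]] by auto
  next
    fix t assume t: "t \<in> D_group (Suc n)"
    note t' = sp[OF t]
    define k where "k = inv t 1"
    have tk: "t k = 1" using signed_permsD(1)[OF t'] by (simp add: k_def bij_is_surj surj_f_inv_f)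
    have k: "k \<in> front_indices (Suc n)"
    proof -
      have "k \<noteq> 0" using tk signed_permsD(4)[OF t'] by auto
      moreover have "\<bar>k\<bar> \<le> int (Suc n)" using signed_permsD(7)[OF t', of k] tk by simp
      moreover have "0 < k" if "Suc n = 1"
      proof -
        have "sgn (t 1) = 1" using t that by (simp add: D_group_eq D_sign_def)
        moreover have "k = 1 \<or> k = - 1" using \<open>k \<noteq> 0\<close> \<open>\<bar>k\<bar> \<le> int (Suc n)\<close> that by auto
        ultimately show ?thesis using tk signed_permsD(2)[OF t', of 1] by auto
      qed
      ultimately show ?thesis by (simp add: front_indices_def)
    qed
    note r = front_D_group[OF k]
    have "t \<circ> front (Suc n) k \<in> D_group (Suc n)" using D_group_comp[OF t r] .
    moreover have "(t \<circ> front (Suc n) k) 1 = 1" using tk front_one[OF k] by simp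
    ultimately obtain s where s: "s \<in> signed_perms n" "t \<circ> front (Suc n) k = embed_perm s"
      using embed_surj sp by metis
    have "D_sign n s = 1" using \<open>t \<circ> front (Suc n) k \<in> D_group (Suc n)\<close>
      unfolding s(2) by (simp add: D_group_eq D_sign_embed)
    then have "s \<in> D_group n" using s(1) by (simp add: D_group_eq)
    moreover have "t = embed_perm s \<circ> inv (front (Suc n) k)"
      unfolding s(2)[symmetric] comp_assoc inv_signed_perm_comp(2)[OF sp[OF r]] by simp
    ultimately show "\<exists>x\<in>front_indices (Suc n) \<times> D_group n. t = ?f x" using k by auto
  }
qed


section \<open>The adjoint of the creation operator\<close>

definition drop_nth :: "nat \<Rightarrow> 'a list \<Rightarrow> 'a list" where
  "drop_nth i xs = take i xs @ drop (Suc i) xs"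

definition flip_last :: "('a \<Rightarrow> 'a) \<Rightarrow> 'a list \<Rightarrow> 'a list" where
  "flip_last J xs = (if xs = [] then [] else butlast xs @ [J (last xs)])"

lemma length_drop_nth: "i < length xs \<Longrightarrow> length (drop_nth i xs) = length xs - 1"
  by (simp add: drop_nth_def)

lemma length_flip_last [simp]: "length (flip_last J xs) = length xs"
  by (simp add: flip_last_def)

lemma nth_drop_nth: "i < length xs \<Longrightarrow> j < length xs - 1 \<Longrightarrow> drop_nth i xs ! j = xs ! (if j < i then j else Suc j)"
  by (auto simp: drop_nth_def nth_append)

lemma nth_flip_last:
  assumes "j < length xs"
  shows "flip_last J xs ! j = (if Suc j = length xs then J (xs ! j) else xs ! j)"
proof (cases "Suc j = length xs")
  case True
  then have "length xs - 1 = j" by simp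
  then show ?thesis using assms True by (auto simp: flip_last_def nth_append last_conv_nth)
next
  case False
  then have "j < length xs - 1" using assms by simp
  then show ?thesis using False by (auto simp: flip_last_def nth_append nth_butlast)
qed

lemma signed_nth_int:
  "signed_nth J xs (int (Suc i)) = xs ! i" "signed_nth J xs (- int (Suc i)) = J (xs ! i)"
  by (simp_all add: signed_nth_def nat_add_distrib)

lemma signed_act_embed:
  assumes s: "s \<in> signed_perms (length ys)"
  shows "signed_act J (embed_perm s) (y # ys) = y # signed_act J s ys"
proof (rule nth_equalityI)
  fix i assume "i < length (signed_act J (embed_perm s) (y # ys))"
  then have i: "i < length (y # ys)" by simp
  show "signed_act J (embed_perm s) (y # ys) ! i = (y # signed_act J s ys) ! i"
  proof (cases i)
    case 0
    then show ?thesis using i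
      by (simp only: nth_signed_act embed_signed_perms(2)[OF s]) (simp add: embed_fix signed_nth_def)
  next
    case (Suc j)
    then have j: "j < length ys" using i by simp
    let ?m = "inv s (int (Suc j))"
    have nz: "?m \<noteq> 0" using inv_signed_perm(2)[OF s] by simp
    define p where "p = nat \<bar>?m\<bar> - 1"
    have "?m = int (Suc p) \<and> shift_up ?m = int (Suc (Suc p)) \<or> ?m = - int (Suc p) \<and> shift_up ?m = - int (Suc (Suc p))"
      using nz by (auto simp: p_def shift_up_def sgn_if)
    then have *: "signed_nth J (y # ys) (shift_up ?m) = signed_nth J ys ?m"
      by (elim disjE conjE) (simp_all only: signed_nth_int nth_Cons_Suc)
    have "int (Suc i) = shift_up (int (Suc j))" using Suc by (simp add: shift_up_def)
    then have "embed_perm (inv s) (int (Suc i)) = shift_up ?m" by (simp add: embed_shift_up del: of_nat_Suc)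
    then show ?thesis using i Suc j *
      by (simp only: nth_signed_act embed_signed_perms(2)[OF s] nth_Cons_Suc)
  qed
qed simp

text \<open>The tensor factors that remain after the factor with signed index \<open>k\<close> has been moved to the
  front; the sign change at \<open>n\<close> becomes an application of \<open>J\<close> to the last remaining factor.\<close>

definition front_rest :: "('a \<Rightarrow> 'a) \<Rightarrow> int \<Rightarrow> 'a list \<Rightarrow> 'a list" where
  "front_rest J k xs = (if 0 < k then drop_nth (nat k - 1) xs else flip_last J (drop_nth (nat (- k) - 1) xs))"

lemma signed_act_front:
  assumes k: "k \<in> front_indices (length xs)"
  shows "signed_act J (inv (front (length xs) k)) xs = signed_nth J xs k # front_rest J k xs"
proof -
  let ?n = "length xs"
  let ?r = "front ?n k"
  define p where "p = nat \<bar>k\<bar> - 1"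
  have p: "p < ?n" "\<bar>k\<bar> = int (Suc p)" using k by (auto simp: front_indices_def p_def)
  have inv: "inv (inv ?r) = ?r" using signed_permsD(1)[OF front_signed_perms[OF k]] by (simp add: inv_inv_eq)
  have len: "length (front_rest J k xs) = ?n - 1"
    using p(1) k by (auto simp: front_rest_def length_drop_nth p_def front_indices_def)
  show ?thesis
  proof (rule nth_equalityI)
    show "length (signed_act J (inv ?r) xs) = length (signed_nth J xs k # front_rest J k xs)"
      using p(1) by (simp add: len)
    fix i assume "i < length (signed_act J (inv ?r) xs)"
    then have i: "i < ?n" by simp
    have l: "signed_act J (inv ?r) xs ! i = signed_nth J xs (?r (int (Suc i)))"
      using i by (simp only: nth_signed_act inv)
    show "signed_act J (inv ?r) xs ! i = (signed_nth J xs k # front_rest J k xs) ! i"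
    proof (cases i)
      case 0
      then show ?thesis unfolding l using front_one[OF k] by simp
    next
      case (Suc j)
      then have j: "j < ?n - 1" using i by simp
      define b where "b = (if j < p then j else Suc j)"
      have r: "?r (int (Suc i)) = (if k < 0 \<and> Suc i = ?n then - int (Suc b) else int (Suc b))"
        using i p Suc unfolding front_def b_def by auto
      have nz: "drop_nth p xs ! j = xs ! b" using nth_drop_nth[OF p(1) j] by (simp only: b_def)
      show ?thesis
      proof (cases "0 < k")
        case True
        then have "front_rest J k xs = drop_nth p xs" by (simp add: front_rest_def p_def)
        then show ?thesis unfolding l r using True nz by (simp add: Suc signed_nth_int del: of_nat_Suc)
      next
        case False
        then have kn: "k < 0" "front_rest J k xs = flip_last J (drop_nth p xs)"
          using k by (auto simp: front_rest_def p_def front_indices_def)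
        have "flip_last J (drop_nth p xs) ! j = (if Suc i = ?n then J (drop_nth p xs ! j) else drop_nth p xs ! j)"
          using j p(1) Suc by (subst nth_flip_last) (auto simp: length_drop_nth)
        then show ?thesis unfolding l r using kn nz by (simp add: Suc signed_nth_int del: of_nat_Suc)
      qed
    qed
  qed
qed

text \<open>A signed permutation moves each slot to one other slot and applies either the identity or \<open>J\<close>
  there, so composing with it preserves multilinearity.\<close>

lemma multilinear_signed_act_sum:
  fixes \<phi> :: "'h::chilbert_space list \<Rightarrow> 'v::complex_vector"
  assumes J: "selfadjoint_involution J" and \<phi>: "multilinear \<phi>"
    and g: "\<And>n i. i \<in> I n \<Longrightarrow> g n i \<in> signed_perms n"
  shows "multilinear (\<lambda>xs. \<Sum>i\<in>I (length xs). c (length xs) i *\<^sub>C \<phi> (signed_act J (g (length xs) i) xs))"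
proof -
  have Jlin: "J (x + y) = J x + J y" "J (a *\<^sub>C x) = a *\<^sub>C J x" for x y a
    using J by (auto simp: selfadjoint_involution_def linear_add bounded_linear.linear)
  have lin: "\<phi> (signed_act J s (as @ (x + y) # bs)) = \<phi> (signed_act J s (as @ x # bs)) + \<phi> (signed_act J s (as @ y # bs))"
    "\<phi> (signed_act J s (as @ (a *\<^sub>C x) # bs)) = a *\<^sub>C \<phi> (signed_act J s (as @ x # bs))"
    if "s \<in> signed_perms (Suc (length as + length bs))" for s as x y bs a
  proof -
    from that obtain us vs h where h: "h = id \<or> h = J"
      and act: "\<And>x. signed_act J s (as @ x # bs) = us @ h x # vs"
      using signed_act_slot[where J = J] by metis
    have "h (x + y) = h x + h y" "h (a *\<^sub>C x) = a *\<^sub>C h x" using h Jlin by auto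
    then show "\<phi> (signed_act J s (as @ (x + y) # bs)) = \<phi> (signed_act J s (as @ x # bs)) + \<phi> (signed_act J s (as @ y # bs))"
      "\<phi> (signed_act J s (as @ (a *\<^sub>C x) # bs)) = a *\<^sub>C \<phi> (signed_act J s (as @ x # bs))"
      using \<phi> unfolding multilinear_def by (simp_all add: act)
  qed
  show ?thesis
    unfolding multilinear_def
    by (auto simp: lin g scaleC_add_right sum.distrib[symmetric]
        complex_vector.scale_sum_right scaleC_scaleC mult.commute intro!: sum.cong)
qed

definition contract :: "'h::chilbert_space \<Rightarrow> 'h list \<Rightarrow> 'h fock" where
  "contract x ys = (case ys of [] \<Rightarrow> 0 | y # zs \<Rightarrow> cinner x y *\<^sub>C tens zs)"

lemma multilinear_contract: "multilinear (contract x)"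
proof -
  have t: "tens (xs @ (y + z) # ys) = tens (xs @ y # ys) + (tens (xs @ z # ys) :: 'a fock)"
    "tens (xs @ (c *\<^sub>C y) # ys) = c *\<^sub>C (tens (xs @ y # ys) :: 'a fock)" for xs ys :: "'a list" and y z c
    using multilinear_tens[where 'h = 'a] unfolding multilinear_def by blast+
  have "contract x (xs @ (y + z) # ys) = contract x (xs @ y # ys) + contract x (xs @ z # ys)" for xs y z ys
    by (cases xs) (auto simp: contract_def t cinner_add_right scaleC_add_left scaleC_add_right)
  moreover have "contract x (xs @ (c *\<^sub>C y) # ys) = c *\<^sub>C contract x (xs @ y # ys)" for xs c y ys
    by (cases xs) (auto simp: contract_def t cinner_scaleC_right scaleC_scaleC mult.commute)
  ultimately show ?thesis by (simp add: multilinear_def)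
qed

text \<open>The candidate for the adjoint of \<^const>\<open>creation\<close>: move each factor, or its image under \<open>J\<close>, to the
  front with the weight of the coset representative that does it, and pair it with \<open>x\<close>.\<close>

definition contraction :: "real \<Rightarrow> ('h::chilbert_space \<Rightarrow> 'h) \<Rightarrow> 'h \<Rightarrow> 'h fock \<Rightarrow> 'h fock" where
  "contraction q J x = fock_lift (\<lambda>ys. \<Sum>k\<in>front_indices (length ys).
     complex_of_real (q ^ inv_num (length ys) (front (length ys) k))
       *\<^sub>C contract x (signed_act J (inv (front (length ys) k)) ys))"

lemma contraction_multilinear:
  assumes "selfadjoint_involution J"
  shows "multilinear (\<lambda>ys. \<Sum>k\<in>front_indices (length ys).
     complex_of_real (q ^ inv_num (length ys) (front (length ys) k))
       *\<^sub>C contract x (signed_act J (inv (front (length ys) k)) ys))"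
  by (rule multilinear_signed_act_sum[OF assms multilinear_contract, where g = "\<lambda>n k. inv (front n k)"
        and c = "\<lambda>n k. complex_of_real (q ^ inv_num n (front n k))"])
     (rule inv_signed_perms[OF front_signed_perms])

lemmas contraction_add = fock_lift_add[OF contraction_multilinear, folded contraction_def]
  and contraction_scaleC = fock_lift_scaleC[OF contraction_multilinear, folded contraction_def]

lemma contraction_tens_front:
  assumes "selfadjoint_involution J"
  shows "contraction q J x (tens ys) = (\<Sum>k\<in>front_indices (length ys).
     (complex_of_real (q ^ inv_num (length ys) (front (length ys) k)) * cinner x (signed_nth J ys k))
       *\<^sub>C tens (front_rest J k ys))"
  unfolding contraction_def fock_lift_tens[OF contraction_multilinear[OF assms]]
  by (intro sum.cong refl) (simp add: signed_act_front contract_def scaleC_scaleC)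

lemma Pq_multilinear:
  assumes "selfadjoint_involution J"
  shows "multilinear (\<lambda>xs. \<Sum>\<sigma>\<in>D_group (length xs).
     complex_of_real (q ^ D_length (length xs) \<sigma>) *\<^sub>C tens (signed_act J \<sigma> xs))"
  by (rule multilinear_signed_act_sum[OF assms multilinear_tens, where g = "\<lambda>n s. s"
        and c = "\<lambda>n s. complex_of_real (q ^ D_length n s)"])
     (use D_group_subset in blast)

lemma inner0_sum_right: "inner0 F (\<Sum>i\<in>A. G i) = (\<Sum>i\<in>A. inner0 F (G i))"
proof (induction A rule: infinite_finite_induct)
  case (insert x A)
  then show ?case by (simp add: inner0_add_right)
qed (use inner0_scaleC_right[of F 0 0] in simp_all)

lemma creation_add: "creation x (F + G) = creation x F + creation x G"
  by (simp add: creation_def fock_lift_add[OF multilinear_tens_Cons])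

lemma creation_scaleC: "creation x (c *\<^sub>C F) = c *\<^sub>C creation x F"
  by (simp add: creation_def fock_lift_scaleC[OF multilinear_tens_Cons])

context
  fixes J :: "'h::chilbert_space \<Rightarrow> 'h" and q :: real
  assumes J: "selfadjoint_involution J"
begin

lemma inner_q_add_right: "inner_q q J F (G + G') = inner_q q J F G + inner_q q J F G'"
  by (simp add: inner_q_def Pq_def fock_lift_add[OF Pq_multilinear[OF J]] inner0_add_right del: of_real_power)

lemma inner_q_scaleC_right: "inner_q q J F (c *\<^sub>C G) = c * inner_q q J F G"
  by (simp add: inner_q_def Pq_def fock_lift_scaleC[OF Pq_multilinear[OF J]] inner0_scaleC_right del: of_real_power)

lemma inner_q_add_left: "inner_q q J (F + F') G = inner_q q J F G + inner_q q J F' G"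
  by (simp add: inner_q_def inner0_add_left)

lemma inner_q_scaleC_left: "inner_q q J (c *\<^sub>C F) G = cnj c * inner_q q J F G"
  by (simp add: inner_q_def inner0_scaleC_left)

lemma inner_q_tens:
  "inner_q q J (tens zs) (tens xs) = (\<Sum>\<sigma>\<in>D_group (length xs).
     complex_of_real (q ^ D_length (length xs) \<sigma>) * tensor_inner zs (signed_act J \<sigma> xs))"
  by (simp add: inner_q_def Pq_tens[OF J] inner0_sum_right inner0_scaleC_right inner0_tens)

text \<open>The factorization of the group into cosets of the stabilizer of \<open>1\<close>, with additive lengths,
  factors \<open>P\<^sub>q\<close> in rank \<open>n + 1\<close> through \<open>P\<^sub>q\<close> in rank \<open>n\<close>, acting on all factors but the
  first.\<close>

lemma inner_q_tens_Cons:
  "inner_q q J (tens (x # zs)) (tens ys) = inner_q q J (tens zs) (contraction q J x (tens ys))"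
proof (cases ys)
  case Nil
  have "front_indices 0 = {}" by (auto simp: front_indices_def)
  moreover have "inner_q q J (tens zs) 0 = 0" using inner_q_scaleC_right[of "tens zs" 0 0] by simp
  moreover have "signed_act J \<sigma> [] = []" for \<sigma> by (simp add: signed_act_def)
  ultimately show ?thesis using Nil by (simp add: inner_q_tens contraction_tens_front[OF J])
next
  case (Cons y ys')
  define n where "n = length ys'"
  have len: "length ys = Suc n" by (simp add: n_def Cons)
  let ?w = "\<lambda>k. complex_of_real (q ^ inv_num (Suc n) (front (Suc n) k)) * cinner x (signed_nth J ys k)"
  let ?p = "\<lambda>k s. complex_of_real (q ^ D_length n s) * tensor_inner zs (signed_act J s (front_rest J k ys))"
  let ?h = "\<lambda>\<sigma>. complex_of_real (q ^ D_length (Suc n) \<sigma>) * tensor_inner (x # zs) (signed_act J \<sigma> ys)"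
  have "inner_q q J (tens (x # zs)) (tens ys) = (\<Sum>\<sigma>\<in>D_group (Suc n). ?h \<sigma>)"
    by (simp only: inner_q_tens len)
  also have "\<dots> = (\<Sum>(k, s)\<in>front_indices (Suc n) \<times> D_group n. ?h (embed_perm s \<circ> inv (front (Suc n) k)))"
    using sum.reindex_bij_betw[OF D_group_coset_bij, of ?h n] by (simp only: case_prod_unfold)
  also have "\<dots> = (\<Sum>k\<in>front_indices (Suc n). \<Sum>s\<in>D_group n. ?h (embed_perm s \<circ> inv (front (Suc n) k)))"
    by (rule sum.cartesian_product[symmetric])
  also have "\<dots> = (\<Sum>k\<in>front_indices (Suc n). \<Sum>s\<in>D_group n. ?w k * ?p k s)"
  proof (intro sum.cong refl)
    fix k s assume k: "k \<in> front_indices (Suc n)" and s: "s \<in> D_group n"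
    have s': "s \<in> signed_perms n" using s D_group_subset by blast
    let ?r = "front (Suc n) k"
    have g: "embed_perm s \<circ> inv ?r \<in> D_group (Suc n)"
      by (intro D_group_comp embed_D_group s D_group_inv front_D_group k)
    have "D_length (Suc n) (embed_perm s \<circ> inv ?r) = D_length n s + inv_num (Suc n) ?r"
      using D_length_eq_inv_num[OF g] D_length_eq_inv_num[OF s] inv_num_embed_front[OF s' k] by simp
    moreover have "signed_act J (embed_perm s \<circ> inv ?r) ys = signed_nth J ys k # signed_act J s (front_rest J k ys)"
    proof -
      have k': "k \<in> front_indices (length ys)" using k len by simp
      have fr: "length (front_rest J k ys) = n"
        using arg_cong[OF signed_act_front[OF k', of J], of length] len by simp
      have "signed_act J (embed_perm s \<circ> inv ?r) ys = signed_act J (embed_perm s) (signed_act J (inv ?r) ys)"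
        using J embed_signed_perms(1)[OF s'] inv_signed_perms[OF front_signed_perms[OF k]] len
        by (intro signed_act_comp) (auto simp: selfadjoint_involution_def)
      also have "\<dots> = signed_act J (embed_perm s) (signed_nth J ys k # front_rest J k ys)"
        using signed_act_front[OF k', of J] by (simp only: len)
      also have "\<dots> = signed_nth J ys k # signed_act J s (front_rest J k ys)"
        using s' fr by (intro signed_act_embed) simp
      finally show ?thesis .
    qed
    ultimately show "?h (embed_perm s \<circ> inv ?r) = ?w k * ?p k s"
      by (simp add: power_add)
  qed
  also have "\<dots> = (\<Sum>k\<in>front_indices (Suc n).
      ?w k * inner_q q J (tens zs) (tens (front_rest J k ys)))"
  proof (intro sum.cong refl)
    fix k assume "k \<in> front_indices (Suc n)"
    then have k': "k \<in> front_indices (length ys)" using len by simp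
    have "length (front_rest J k ys) = n"
      using arg_cong[OF signed_act_front[OF k', of J], of length] len by simp
    then show "(\<Sum>s\<in>D_group n. ?w k * ?p k s)
      = ?w k * inner_q q J (tens zs) (tens (front_rest J k ys))"
      by (simp only: inner_q_tens sum_distrib_left)
  qed
  also have "\<dots> = inner_q q J (tens zs) (contraction q J x (tens ys))"
  proof -
    have "inner_q q J F (\<Sum>i\<in>A. G i) = (\<Sum>i\<in>A. inner_q q J F (G i))" if "finite A" for F G and A :: "int set"
      using that
    proof induction
      case empty
      show ?case using inner_q_scaleC_right[of F 0 0] by simp
    qed (simp add: inner_q_add_right)
    then show ?thesis
      by (simp only: contraction_tens_front[OF J] len finite_front_indices inner_q_scaleC_right)
  qed
  finally show ?thesis .
qed

lemma contraction_adjoint: "inner_q q J (creation x F) G = inner_q q J F (contraction q J x G)"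
proof (induction F rule: fock_induct)
  case (tens zs)
  show ?case
  proof (induction G rule: fock_induct)
    case (tens ys)
    show ?case by (simp add: creation_tens inner_q_tens_Cons)
  qed (simp_all add: contraction_add[OF J] contraction_scaleC[OF J] inner_q_add_right inner_q_scaleC_right)
qed (simp_all add: creation_add creation_scaleC inner_q_add_left inner_q_scaleC_left)

end


section \<open>Nondegeneracy of the deformed inner product\<close>

lemma cinner_zero_right [simp]: "cinner (x :: 'h::chilbert_space) 0 = 0"
  using cinner_scaleC_right[of x 0 0] by simp

lemma cinner_diff_right: "cinner (x :: 'h::chilbert_space) (y - z) = cinner x y - cinner x z"
  using cinner_add_right[of x "y - z" z] by simp

lemma cinner_sum_right: "cinner (x :: 'h::chilbert_space) (\<Sum>i\<in>A. f i) = (\<Sum>i\<in>A. cinner x (f i))"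
  by (induction A rule: infinite_finite_induct) (simp_all add: cinner_add_right)

definition orthonormal :: "'h::chilbert_space set \<Rightarrow> bool" where
  "orthonormal E \<longleftrightarrow> finite E \<and> (\<forall>e\<in>E. \<forall>f\<in>E. cinner e f = (if e = f then 1 else 0))"

lemma cinner_orthonormal_sum:
  assumes "orthonormal E" "f \<in> E"
  shows "cinner f (\<Sum>e\<in>E. c e *\<^sub>C e) = c f"
proof -
  have "cinner f (\<Sum>e\<in>E. c e *\<^sub>C e) = (\<Sum>e\<in>E. if f = e then c e else 0)"
    unfolding cinner_sum_right
    by (intro sum.cong refl) (use assms in \<open>auto simp: orthonormal_def cinner_scaleC_right\<close>)
  then show ?thesis using assms by (simp add: orthonormal_def)
qed

lemma gram_schmidt:
  fixes S :: "'h::chilbert_space set"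
  assumes "finite S"
  shows "\<exists>E. orthonormal E \<and> S \<subseteq> complex_vector.span E"
  using assms
proof induction
  case empty
  show ?case by (intro exI[of _ "{}"]) (simp add: orthonormal_def)
next
  case (insert x S)
  then obtain E where E: "orthonormal E" "S \<subseteq> complex_vector.span E" by blast
  define p where "p = (\<Sum>e\<in>E. cinner e x *\<^sub>C e)"
  define y where "y = x - p"
  have p: "p \<in> complex_vector.span E"
    unfolding p_def by (intro complex_vector.span_sum complex_vector.span_scale complex_vector.span_base)
  show ?case
  proof (cases "y = 0")
    case True
    then show ?thesis using E p by (intro exI[of _ E]) (simp add: y_def)
  next
    case False
    define r where "r = norm y"
    have r: "r > 0" using False by (simp add: r_def)
    have "Im (cinner y y) = 0" using arg_cong[OF cinner_commute[of y y], of Im] by simp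
    then have yy: "cinner y y = complex_of_real (r * r)"
      using cinner_ge_zero[of y] by (simp add: r_def norm_eq_sqrt_cinner complex_eq_iff)
    define f where "f = complex_of_real (1 / r) *\<^sub>C y"
    have ff: "cinner f f = 1"
      using r by (simp add: f_def cinner_scaleC_left cinner_scaleC_right yy)
    have ef: "cinner e f = 0" if "e \<in> E" for e
      using cinner_orthonormal_sum[OF E(1) that, of "\<lambda>e. cinner e x"]
      by (simp add: f_def cinner_scaleC_right y_def cinner_diff_right p_def)
    then have fe: "cinner f e = 0" if "e \<in> E" for e
      using that cinner_commute[of f e] by simp
    have "f \<notin> E" using ef ff by auto
    then have "orthonormal (insert f E)"
      using E(1) ff ef fe unfolding orthonormal_def by auto
    moreover have "complex_vector.span E \<subseteq> complex_vector.span (insert f E)"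
      by (rule complex_vector.span_mono) blast
    moreover have "y = complex_of_real r *\<^sub>C f" using r by (simp add: f_def scaleC_scaleC scaleC_one)
    then have "y \<in> complex_vector.span (insert f E)"
      by (simp add: complex_vector.span_scale complex_vector.span_base)
    then have "y + p \<in> complex_vector.span (insert f E)"
      using p calculation(2) by (intro complex_vector.span_add) blast+
    then have "x \<in> complex_vector.span (insert f E)" by (simp add: y_def)
    ultimately show ?thesis using E(2) by blast
  qed
qed

lemma orthonormal_expansion:
  assumes E: "orthonormal E" and x: "x \<in> complex_vector.span E"
  shows "x = (\<Sum>e\<in>E. cinner e x *\<^sub>C e)"
proof -
  obtain c where "x = (\<Sum>e\<in>E. c e *\<^sub>C e)"
    using x E by (auto simp: complex_vector.span_finite orthonormal_def)
  then show ?thesis using cinner_orthonormal_sum[OF E] by simp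
qed

lemma tens_sum_slot:
  "tens (ps @ (\<Sum>i\<in>A. c i *\<^sub>C v i) # ys) = (\<Sum>i\<in>A. c i *\<^sub>C tens (ps @ v i # ys))"
proof -
  have add: "tens (ps @ (y + z) # ys) = tens (ps @ y # ys) + tens (ps @ z # ys)"
    and scl: "tens (ps @ (a *\<^sub>C y) # ys) = a *\<^sub>C tens (ps @ y # ys)" for y z a
    using multilinear_tens unfolding multilinear_def by blast+
  have z: "tens (ps @ 0 # ys) = 0" using scl[of 0 0] by simp
  show ?thesis by (induction A rule: infinite_finite_induct) (simp_all add: z add scl)
qed

lemma tens_expansion:
  fixes ps xs :: "'h::chilbert_space list"
  assumes E: "orthonormal E" and "set xs \<subseteq> complex_vector.span E"
  shows "tens (ps @ xs) = (\<Sum>es | set es \<subseteq> E \<and> length es = length xs. tensor_inner es xs *\<^sub>C tens (ps @ es))"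
  using assms(2)
proof (induction xs arbitrary: ps)
  case Nil
  have "{es. set es \<subseteq> E \<and> length es = length []} = {[]}" by auto
  then show ?case by (simp add: scaleC_one)
next
  case (Cons x xs)
  let ?L = "{es. set es \<subseteq> E \<and> length es = length xs}"
  have "tens (ps @ x # xs) = (\<Sum>e\<in>E. cinner e x *\<^sub>C tens (ps @ e # xs))"
    using orthonormal_expansion[OF E, of x] Cons.prems tens_sum_slot[of ps "\<lambda>e. cinner e x" "\<lambda>e. e" E xs] by simp
  also have "\<dots> = (\<Sum>e\<in>E. \<Sum>es\<in>?L. (cinner e x * tensor_inner es xs) *\<^sub>C tens (ps @ e # es))"
  proof (rule sum.cong[OF refl])
    fix e
    have "tens (ps @ e # xs) = (\<Sum>es\<in>?L. tensor_inner es xs *\<^sub>C tens (ps @ e # es))"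
      using Cons.IH[of "ps @ [e]"] Cons.prems by simp
    then show "cinner e x *\<^sub>C tens (ps @ e # xs) = (\<Sum>es\<in>?L. (cinner e x * tensor_inner es xs) *\<^sub>C tens (ps @ e # es))"
      by (simp add: complex_vector.scale_sum_right scaleC_scaleC)
  qed
  also have "\<dots> = (\<Sum>es\<in>?L. \<Sum>e\<in>E. (cinner e x * tensor_inner es xs) *\<^sub>C tens (ps @ e # es))"
    by (rule sum.swap)
  also have "\<dots> = (\<Sum>(es, e)\<in>?L \<times> E. tensor_inner (e # es) (x # xs) *\<^sub>C tens (ps @ e # es))"
    by (simp add: sum.cartesian_product)
  also have "\<dots> = (\<Sum>es\<in>(\<lambda>(es, e). e # es) ` (?L \<times> E). tensor_inner es (x # xs) *\<^sub>C tens (ps @ es))"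
    by (subst sum.reindex) (auto simp: inj_on_def case_prod_unfold)
  also have "(\<lambda>(es, e). e # es) ` (?L \<times> E) = {es. set es \<subseteq> E \<and> length es = length (x # xs)}"
    by (simp add: lists_length_Suc_eq)
  finally show ?case .
qed

lemma tensor_inner_length: "length xs \<noteq> length ys \<Longrightarrow> tensor_inner xs ys = 0"
  by (induction xs ys rule: tensor_inner.induct) auto

definition tensor_expansion :: "'h::chilbert_space set \<Rightarrow> nat \<Rightarrow> 'h fock \<Rightarrow> 'h fock" where
  "tensor_expansion E N F = (\<Sum>es | set es \<subseteq> E \<and> length es \<le> N. inner0 (tens es) F *\<^sub>C tens es)"

text \<open>Each vector of the algebraic Fock space involves finitely many elements of \<open>H\<close> and finitely many
  degrees, so it expands along the tensors over a finite orthonormal set.  The statement holds for all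
  sufficiently large \<open>E\<close> and \<open>M\<close>, so that it is stable under sums.\<close>

lemma fock_expansion:
  fixes F :: "'h::chilbert_space fock"
  shows "\<exists>S N. finite S \<and> (\<forall>E M. orthonormal E \<longrightarrow> S \<subseteq> complex_vector.span E \<longrightarrow> N \<le> M \<longrightarrow>
     tensor_expansion E M F = F)"
proof (induction F rule: fock_induct)
  case (tens xs)
  have "tensor_expansion E M (tens xs) = tens xs"
    if E: "orthonormal E" "set xs \<subseteq> complex_vector.span E" "length xs \<le> M" for E M
  proof -
    have "tens xs = (\<Sum>es | set es \<subseteq> E \<and> length es = length xs. tensor_inner es xs *\<^sub>C tens es)"
      using tens_expansion[OF E(1,2), of "[]"] by simp
    also have "\<dots> = (\<Sum>es | set es \<subseteq> E \<and> length es \<le> M. tensor_inner es xs *\<^sub>C tens es)"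
      using E by (intro sum.mono_neutral_left) (auto simp: orthonormal_def tensor_inner_length finite_lists_length_le)
    finally show ?thesis unfolding tensor_expansion_def inner0_tens by (rule sym)
  qed
  then show ?case by (intro exI[of _ "set xs"] exI[of _ "length xs"]) blast
next
  case (add F G)
  obtain S N where F: "finite S" "\<And>E M. orthonormal E \<Longrightarrow> S \<subseteq> complex_vector.span E \<Longrightarrow> N \<le> M \<Longrightarrow>
     tensor_expansion E M F = F" using add(1) by blast
  obtain S' N' where G: "finite S'" "\<And>E M. orthonormal E \<Longrightarrow> S' \<subseteq> complex_vector.span E \<Longrightarrow> N' \<le> M \<Longrightarrow>
     tensor_expansion E M G = G" using add(2) by blast
  have sum: "tensor_expansion E M (F + G) = tensor_expansion E M F + tensor_expansion E M G" for E M
    by (simp add: tensor_expansion_def inner0_add_right scaleC_add_left sum.distrib)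
  have "tensor_expansion E M (F + G) = F + G"
    if "orthonormal E" "S \<union> S' \<subseteq> complex_vector.span E" "max N N' \<le> M" for E M
    using F(2)[of E M] G(2)[of E M] that unfolding sum by simp
  then show ?case using F(1) G(1) by (intro exI[of _ "S \<union> S'"] exI[of _ "max N N'"]) blast
next
  case (scaleC c F)
  have "tensor_expansion E M (c *\<^sub>C F) = c *\<^sub>C tensor_expansion E M F" for E M
    by (simp add: tensor_expansion_def inner0_scaleC_right complex_vector.scale_sum_right scaleC_scaleC)
  then show ?case using scaleC by metis
qed

lemma inner0_nondegenerate:
  fixes F :: "'h::chilbert_space fock"
  assumes "\<And>ys. inner0 (tens ys) F = 0" shows "F = 0"
proof -
  obtain S N where S: "finite S" "\<And>E M. orthonormal E \<Longrightarrow> S \<subseteq> complex_vector.span E \<Longrightarrow> N \<le> M \<Longrightarrow>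
     tensor_expansion E M F = F"
    using fock_expansion[of F] by blast
  obtain E where "orthonormal E" "S \<subseteq> complex_vector.span E" using gram_schmidt[OF S(1)] by blast
  then have "tensor_expansion E N F = F" using S(2) by blast
  then show ?thesis by (simp add: assms tensor_expansion_def)
qed

lemma tensor_inner_prod:
  "length xs = length ys \<Longrightarrow> tensor_inner xs ys = (\<Prod>i<length xs. cinner (xs ! i) (ys ! i))"
  by (induction xs ys rule: list_induct2) (simp_all add: prod.lessThan_Suc_shift del: prod.lessThan_Suc)

text \<open>The action is unitary: a signed permutation only rearranges the factors of the product, and \<open>J\<close>
  passes from one side to the other because it is selfadjoint.\<close>

lemma tensor_inner_signed_act:
  fixes J :: "'h::chilbert_space \<Rightarrow> 'h"
  assumes J: "selfadjoint_involution J" and len: "length zs = n" "length xs = n" and s: "s \<in> signed_perms n"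
  shows "tensor_inner zs (signed_act J s xs) = tensor_inner (signed_act J (inv s) zs) xs"
proof -
  let ?h = "\<lambda>j. nat \<bar>s (int (Suc j))\<bar> - 1"
  have inv: "inv (inv s) = s" using signed_permsD(1)[OF s] by (simp add: inv_inv_eq)
  have h: "\<bar>s (int (Suc j))\<bar> = int (Suc (?h j))" "?h j < n" if "j < n" for j
    using signed_permsD(6,7)[OF s, of "int (Suc j)"] that by auto
  have "inj_on ?h {..<n}"
  proof (rule inj_onI)
    fix i j assume "i \<in> {..<n}" "j \<in> {..<n}" "?h i = ?h j"
    then have "\<bar>s (int (Suc i))\<bar> = \<bar>s (int (Suc j))\<bar>" using h[of i] h[of j] by simp
    then show "i = j" using signed_permsD(5)[OF s] by simp
  qed
  moreover have "?h ` {..<n} \<subseteq> {..<n}" using h(2) by auto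
  ultimately have bij: "bij_betw ?h {..<n} {..<n}" by (simp add: bij_betw_def endo_inj_surj)
  have "tensor_inner zs (signed_act J s xs) = (\<Prod>i<n. cinner (zs ! i) (signed_act J s xs ! i))"
    by (simp add: tensor_inner_prod len)
  also have "\<dots> = (\<Prod>j<n. cinner (zs ! ?h j) (signed_act J s xs ! ?h j))"
    by (rule prod.reindex_bij_betw[OF bij, symmetric])
  also have "\<dots> = (\<Prod>j<n. cinner (signed_act J (inv s) zs ! j) (xs ! j))"
  proof (rule prod.cong[OF refl])
    fix j assume "j \<in> {..<n}"
    then have j: "j < n" by simp
    obtain p where p: "p = ?h j" by blast
    have sp: "\<bar>s (int (Suc j))\<bar> = int (Suc p)" "p < n" unfolding p using h[OF j] by blast+
    have l: "signed_act J s xs ! p = signed_nth J xs (inv s (int (Suc p)))"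
      using sp(2) len by (intro nth_signed_act) simp
    have r: "signed_act J (inv s) zs ! j = signed_nth J zs (s (int (Suc j)))"
      using j len by (simp only: nth_signed_act inv)
    have invs: "inv s (s k) = k" for k using signed_permsD(1)[OF s] by (simp add: bij_is_inj)
    have "cinner (zs ! p) (signed_act J s xs ! p) = cinner (signed_act J (inv s) zs ! j) (xs ! j)"
    proof (cases "0 < s (int (Suc j))")
      case True
      then have e: "s (int (Suc j)) = int (Suc p)" using sp(1) by simp
      then have "inv s (int (Suc p)) = int (Suc j)" using invs[of "int (Suc j)"] by simp
      then show ?thesis unfolding l r e by (simp only: signed_nth_int)
    next
      case False
      then have e: "s (int (Suc j)) = - int (Suc p)" using sp(1) by simp
      then have "inv s (int (Suc p)) = - int (Suc j)"
        using invs[of "int (Suc j)"] inv_signed_perm(1)[OF s, of "int (Suc p)"] by simp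
      then show ?thesis unfolding l r e using J by (simp only: signed_nth_int selfadjoint_involution_def)
    qed
    then show "cinner (zs ! ?h j) (signed_act J s xs ! ?h j) = cinner (signed_act J (inv s) zs ! j) (xs ! j)"
      by (simp only: p)
  qed
  also have "\<dots> = tensor_inner (signed_act J (inv s) zs) xs"
    by (simp add: tensor_inner_prod len)
  finally show ?thesis .
qed

lemma signed_act_id: "signed_act J id xs = xs"
proof (rule nth_equalityI)
  fix i assume "i < length (signed_act J id xs)"
  then show "signed_act J id xs ! i = xs ! i"
    by (simp only: length_signed_act nth_signed_act inv_id id_apply signed_nth_int)
qed simp

context
  fixes J :: "'h::chilbert_space \<Rightarrow> 'h" and q :: real
  assumes J: "selfadjoint_involution J"
begin

lemma inner_q_tens_left:
  "inner_q q J (tens zs) G = (\<Sum>\<sigma>\<in>D_group (length zs).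
     complex_of_real (q ^ D_length (length zs) \<sigma>) * inner0 (tens (signed_act J (inv \<sigma>) zs)) G)"
proof (induction G rule: fock_induct)
  case (tens xs)
  show ?case
  proof (cases "length xs = length zs")
    case True
    have "tensor_inner zs (signed_act J s xs) = tensor_inner (signed_act J (inv s) zs) xs"
      if "s \<in> D_group (length zs)" for s
      using that D_group_subset True by (intro tensor_inner_signed_act[OF J]) auto
    then show ?thesis unfolding inner_q_tens[OF J] inner0_tens True by simp
  next
    case False
    then show ?thesis by (simp add: inner_q_tens[OF J] inner0_tens tensor_inner_length)
  qed
qed (simp_all add: inner_q_add_right[OF J] inner_q_scaleC_right[OF J] inner0_add_right inner0_scaleC_right
    sum.distrib sum_distrib_left algebra_simps)

text \<open>Suppose that \<open>G\<close> is orthogonal to everything.  For a fixed tensor \<open>y\<close> the numbers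
  \<open>c s = \<langle>s\<^sup>-\<^sup>1 y, G\<rangle>\<^sub>0\<close> solve the homogeneous linear system with the matrix
  \<open>q ^ \<ell>(s\<^sup>-\<^sup>1 t)\<close>, because the left argument may be replaced by its translates.  By the cocycle
  identity for the length this is a submatrix of the Hamming kernel on sets of positive roots, so
  \<open>c\<close> vanishes; in particular \<open>\<langle>y, G\<rangle>\<^sub>0 = 0\<close>.\<close>

lemma inner_q_nondegenerate:
  assumes q: "\<bar>q\<bar> < 1" and zero: "\<And>F. inner_q q J F G = 0"
  shows "G = 0"
proof (rule inner0_nondegenerate)
  fix ys :: "'h list"
  define n where "n = length ys"
  let ?W = "D_group n"
  define c where "c s = inner0 (tens (signed_act J (inv s) ys)) G" for s
  let ?A = "\<lambda>s. inversions n (inv s)"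
  have sp: "s \<in> signed_perms n" if "s \<in> ?W" for s using that D_group_subset by blast
  \<comment> \<open>Equal inversion sets mean length \<open>0\<close> of the quotient, which is then the empty word.\<close>
  have inj: "inj_on ?A ?W"
  proof (rule inj_onI)
    fix s t assume st: "s \<in> ?W" "t \<in> ?W" "?A s = ?A t"
    then have "inv_num n (inv s \<circ> t) = 0" using inv_num_cocycle[OF sp sp] by simp
    moreover have "inv s \<circ> t \<in> ?W" using st D_group_comp D_group_inv by blast
    ultimately have "inv s \<circ> t = id"
      using reduced_word_exists[of "inv s \<circ> t" n] by (auto simp: D_group_eq word_prod_def)
    then have "s \<circ> (inv s \<circ> t) = s" by simp
    then show "s = t" using inv_signed_perm_comp(2)[OF sp[OF st(1)]] by (simp add: comp_assoc[symmetric])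
  qed
  \<comment> \<open>The substitution \<open>t = s \<circ> u\<close> turns orthogonality to \<open>s\<^sup>-\<^sup>1 y\<close> into the row \<open>s\<close> of the system.\<close>
  have eqs: "(\<Sum>t\<in>?W. complex_of_real (q ^ card (sym_diff (?A s) (?A t))) * c t) = 0" if s: "s \<in> ?W" for s
  proof -
    have bij: "bij_betw (\<lambda>t. inv s \<circ> t) ?W ?W"
      by (rule bij_betw_byWitness[where f' = "\<lambda>t. s \<circ> t"])
         (use s D_group_comp D_group_inv inv_signed_perm_comp[OF sp[OF s]] in \<open>auto simp: comp_assoc[symmetric]\<close>)
    have "0 = inner_q q J (tens (signed_act J (inv s) ys)) G" by (simp add: zero)
    also have "\<dots> = (\<Sum>u\<in>?W. complex_of_real (q ^ D_length n u) * inner0 (tens (signed_act J (inv u) (signed_act J (inv s) ys))) G)"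
      by (simp add: inner_q_tens_left n_def)
    also have "\<dots> = (\<Sum>u\<in>?W. complex_of_real (q ^ D_length n u) * c (s \<circ> u))"
    proof (rule sum.cong[OF refl])
      fix u assume u: "u \<in> ?W"
      have "inv (s \<circ> u) = inv u \<circ> inv s"
        using signed_permsD(1)[OF sp[OF s]] signed_permsD(1)[OF sp[OF u]] by (rule o_inv_distrib)
      moreover have "signed_act J (inv u \<circ> inv s) ys = signed_act J (inv u) (signed_act J (inv s) ys)"
        using J inv_signed_perms[OF sp[OF u]] inv_signed_perms[OF sp[OF s]]
        by (intro signed_act_comp) (auto simp: selfadjoint_involution_def n_def)
      ultimately show "complex_of_real (q ^ D_length n u) * inner0 (tens (signed_act J (inv u) (signed_act J (inv s) ys))) G
          = complex_of_real (q ^ D_length n u) * c (s \<circ> u)" by (simp add: c_def)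
    qed
    also have "\<dots> = (\<Sum>t\<in>?W. complex_of_real (q ^ D_length n (inv s \<circ> t)) * c (s \<circ> (inv s \<circ> t)))"
      by (rule sum.reindex_bij_betw[OF bij, symmetric])
    also have "\<dots> = (\<Sum>t\<in>?W. complex_of_real (q ^ card (sym_diff (?A s) (?A t))) * c t)"
    proof (rule sum.cong[OF refl])
      fix t assume t: "t \<in> ?W"
      have "s \<circ> (inv s \<circ> t) = t" using inv_signed_perm_comp(2)[OF sp[OF s]] by (simp add: comp_assoc[symmetric])
      moreover have "inv s \<circ> t \<in> ?W" using s t D_group_comp D_group_inv by blast
      ultimately show "complex_of_real (q ^ D_length n (inv s \<circ> t)) * c (s \<circ> (inv s \<circ> t))
         = complex_of_real (q ^ card (sym_diff (?A s) (?A t))) * c t"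
        using inv_num_cocycle[OF sp[OF s] sp[OF t]] by (simp add: D_length_eq_inv_num)
    qed
    finally show ?thesis by simp
  qed
  have "c id = 0"
    by (rule hamming_kernel_regular[OF finite_D_pos[of n] q finite_D_group inj _ eqs D_group_id])
       (auto simp: inversions_def)
  then show "inner0 (tens ys) G = 0" by (simp add: c_def signed_act_id inv_id[unfolded id_def] id_def[symmetric])
qed

lemma annihilation_eq_contraction:
  assumes q: "\<bar>q\<bar> < 1"
  shows "annihilation q J x = contraction q J x"
  unfolding annihilation_def
proof (rule the_equality)
  show "\<forall>f g. inner_q q J (creation x f) g = inner_q q J f (contraction q J x g)"
    using contraction_adjoint[OF J] by blast
  fix T assume T: "\<forall>f g. inner_q q J (creation x f) g = inner_q q J f (T g)"
  show "T = contraction q J x"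
  proof
    fix g
    have "inner_q q J f (T g + - 1 *\<^sub>C contraction q J x g) = 0" for f
    proof -
      have "inner_q q J f (T g) = inner_q q J f (contraction q J x g)"
        using T contraction_adjoint[OF J, of q x f g] by simp
      then show ?thesis by (simp only: inner_q_add_right[OF J] inner_q_scaleC_right[OF J]) simp
    qed
    then have "T g + - 1 *\<^sub>C contraction q J x g = 0" by (rule inner_q_nondegenerate[OF q])
    then show "T g = contraction q J x g"
      by (simp add: scaleC_one)
  qed
qed

end


section \<open>The contraction on elementary tensors\<close>

lemma front_indices_split:
  "front_indices m = (\<lambda>i. int (Suc i)) ` {..<m} \<union> (if 2 \<le> m then (\<lambda>i. - int (Suc i)) ` {..<m} else {})"
proof (intro set_eqI iffI)
  fix k assume k: "k \<in> front_indices m"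
  define i where "i = nat \<bar>k\<bar> - 1"
  have i: "i < m" "k = int (Suc i) \<or> k = - int (Suc i)" using k by (auto simp: front_indices_def i_def)
  show "k \<in> (\<lambda>i. int (Suc i)) ` {..<m} \<union> (if 2 \<le> m then (\<lambda>i. - int (Suc i)) ` {..<m} else {})"
  proof (cases "k = int (Suc i)")
    case False
    then have "k = - int (Suc i)" "2 \<le> m" using i k by (auto simp: front_indices_def)
    then show ?thesis using i(1) by auto
  qed (use i in auto)
qed (auto simp: front_indices_def split: if_splits)

text \<open>The index \<open>k = i + 1\<close> has length \<open>i\<close>, and \<open>k = - (i + 1)\<close> has length
  \<open>2 m - 2 - i = i + 2 (m - 1 - i)\<close>, the latter only if there are at least two factors.\<close>

lemma contraction_tens:
  fixes J :: "'h::chilbert_space \<Rightarrow> 'h" and ys :: "'h list"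
  assumes J: "selfadjoint_involution J"
  defines "m \<equiv> length ys"
  shows "contraction q J x (tens ys) =
    (\<Sum>i<m. (complex_of_real (q ^ i) * cinner x (ys ! i)) *\<^sub>C tens (drop_nth i ys)) +
    (if 2 \<le> m then \<Sum>i<m. (complex_of_real (q ^ (i + 2 * (m - 1 - i))) * cinner x (J (ys ! i)))
        *\<^sub>C tens (flip_last J (drop_nth i ys)) else 0)"
proof -
  let ?h = "\<lambda>k. (complex_of_real (q ^ inv_num m (front m k)) * cinner x (signed_nth J ys k))
       *\<^sub>C tens (front_rest J k ys)"
  have "contraction q J x (tens ys) = (\<Sum>k\<in>front_indices m. ?h k)"
    by (simp only: contraction_tens_front[OF J] m_def)
  also have "\<dots> = (\<Sum>k\<in>(\<lambda>i. int (Suc i)) ` {..<m}. ?h k) + (\<Sum>k\<in>(if 2 \<le> m then (\<lambda>i. - int (Suc i)) ` {..<m} else {}). ?h k)"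
    unfolding front_indices_split by (rule sum.union_disjoint) auto
  also have "(\<Sum>k\<in>(\<lambda>i. int (Suc i)) ` {..<m}. ?h k) = (\<Sum>i<m. ?h (int (Suc i)))"
    by (subst sum.reindex) (auto simp: inj_on_def)
  also have "\<dots> = (\<Sum>i<m. (complex_of_real (q ^ i) * cinner x (ys ! i)) *\<^sub>C tens (drop_nth i ys))"
  proof (rule sum.cong[OF refl])
    fix i assume "i \<in> {..<m}"
    then have "int (Suc i) \<in> front_indices m" by (auto simp: front_indices_def)
    then have "inv_num m (front m (int (Suc i))) = i" by (subst inv_num_front) simp_all
    moreover have "front_rest J (int (Suc i)) ys = drop_nth i ys" by (simp add: front_rest_def nat_add_distrib)
    ultimately show "?h (int (Suc i)) = (complex_of_real (q ^ i) * cinner x (ys ! i)) *\<^sub>C tens (drop_nth i ys)"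
      by (simp only: signed_nth_int)
  qed
  also have "(\<Sum>k\<in>(if 2 \<le> m then (\<lambda>i. - int (Suc i)) ` {..<m} else {}). ?h k)
     = (if 2 \<le> m then \<Sum>i<m. ?h (- int (Suc i)) else 0)"
    by (auto simp: sum.reindex inj_on_def)
  also have "\<dots> = (if 2 \<le> m then \<Sum>i<m. (complex_of_real (q ^ (i + 2 * (m - 1 - i))) * cinner x (J (ys ! i)))
        *\<^sub>C tens (flip_last J (drop_nth i ys)) else 0)"
  proof (intro if_cong refl sum.cong)
    fix i assume "2 \<le> m" and i: "i \<in> {..<m}"
    then have "- int (Suc i) \<in> front_indices m" by (auto simp: front_indices_def)
    then have "inv_num m (front m (- int (Suc i))) = i + 2 * (m - 1 - i)"
      using i by (subst inv_num_front) (auto simp: nat_add_distrib)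
    moreover have "front_rest J (- int (Suc i)) ys = flip_last J (drop_nth i ys)"
      by (simp add: front_rest_def nat_add_distrib)
    ultimately show "?h (- int (Suc i)) = (complex_of_real (q ^ (i + 2 * (m - 1 - i))) * cinner x (J (ys ! i)))
        *\<^sub>C tens (flip_last J (drop_nth i ys))"
      by (simp only: signed_nth_int)
  qed
  finally show ?thesis .
qed

definition flip_if :: "bool \<Rightarrow> ('a \<Rightarrow> 'a) \<Rightarrow> 'a list \<Rightarrow> 'a list" where
  "flip_if b J ys = (if b then flip_last J ys else ys)"

definition apply_if :: "bool \<Rightarrow> ('a \<Rightarrow> 'a) \<Rightarrow> 'a \<Rightarrow> 'a" where
  "apply_if b J y = (if b then J y else y)"

lemma length_flip_if [simp]: "length (flip_if b J ys) = length ys"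
  by (simp add: flip_if_def)

lemma flip_if_Nil [simp]: "flip_if b J [] = []"
  by (simp add: flip_if_def flip_last_def)

lemma drop_nth_flip_if:
  assumes "Suc i < length ys" shows "drop_nth i (flip_if b J ys) = flip_if b J (drop_nth i ys)"
proof (cases b)
  case True
  have "drop_nth i (flip_last J ys) = flip_last J (drop_nth i ys)"
  proof (rule nth_equalityI)
    fix j assume "j < length (drop_nth i (flip_last J ys))"
    then have "j < length ys - 1" using assms by (simp add: length_drop_nth)
    then show "drop_nth i (flip_last J ys) ! j = flip_last J (drop_nth i ys) ! j"
      using assms by (auto simp: nth_drop_nth nth_flip_last length_drop_nth)
  qed (use assms in \<open>simp add: length_drop_nth\<close>)
  then show ?thesis using True by (simp add: flip_if_def)
qed (simp add: flip_if_def)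

lemma drop_nth_flip_if_last:
  assumes "Suc i = length ys" shows "drop_nth i (flip_if b J ys) = drop_nth i ys"
proof (cases b)
  case True
  have "length ys - 1 = i" using assms by simp
  then have "take i (butlast ys) = take i ys" by (metis butlast_conv_take take_butlast order_refl take_take min.idem)
  then show ?thesis using True assms
    by (auto simp: flip_if_def flip_last_def drop_nth_def)
qed (simp add: flip_if_def)

lemma flip_if_flip_if:
  assumes "\<And>y. J (J y) = y" shows "flip_last J (flip_if b J ys) = flip_if (\<not> b) J ys"
  by (cases "ys = []") (auto simp: flip_if_def flip_last_def assms)

lemma nth_flip_if: "i < length ys \<Longrightarrow> flip_if b J ys ! i = (if Suc i = length ys then apply_if b J (ys ! i) else ys ! i)"
  by (simp add: flip_if_def apply_if_def nth_flip_last)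

text \<open>This form of the contraction matches the partitions: \<open>c\<close> is the color (negative or not) of the
  pair that closes with the \<open>i\<close>-th factor.  For the last factor, which may carry a \<open>J\<close>, the terms
  with and without \<open>J\<close> change roles if \<open>b\<close> holds; their weights agree since then \<open>m - 1 - i = 0\<close>.
  If the last factor is the only one, its color is forced to be \<open>b\<close>.\<close>

lemma contraction_flip_if:
  fixes J :: "'h::chilbert_space \<Rightarrow> 'h" and ys :: "'h list"
  assumes J: "selfadjoint_involution J"
  defines "m \<equiv> length ys"
  shows "contraction q J x (tens (flip_if b J ys)) =
    (\<Sum>i<m. \<Sum>c\<in>{c. m = 1 \<longrightarrow> c = b}.
       (complex_of_real (q ^ (i + (if c then 2 * (m - 1 - i) else 0))) * cinner x (apply_if c J (ys ! i)))
          *\<^sub>C tens (flip_if (b \<noteq> c) J (drop_nth i ys)))"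
proof -
  have JJ: "J (J y) = y" for y using J by (simp add: selfadjoint_involution_def)
  let ?t = "\<lambda>i c. (complex_of_real (q ^ (i + (if c then 2 * (m - 1 - i) else 0))) * cinner x (apply_if c J (ys ! i)))
          *\<^sub>C tens (flip_if (b \<noteq> c) J (drop_nth i ys))"
  let ?ys = "flip_if b J ys"
  let ?p = "\<lambda>i. (complex_of_real (q ^ i) * cinner x (?ys ! i)) *\<^sub>C tens (drop_nth i ?ys)"
  let ?q = "\<lambda>i. (complex_of_real (q ^ (i + 2 * (m - 1 - i))) * cinner x (J (?ys ! i)))
        *\<^sub>C tens (flip_last J (drop_nth i ?ys))"
  have con: "contraction q J x (tens ?ys) = (\<Sum>i<m. ?p i) + (if 2 \<le> m then \<Sum>i<m. ?q i else 0)"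
    using contraction_tens[OF J, of q x ?ys] by (simp only: length_flip_if m_def)
  consider "m = 0" | "m = 1" | "2 \<le> m" by linarith
  then show ?thesis
  proof cases
    case 1
    then show ?thesis unfolding con by simp
  next
    case 2
    then have "?p 0 = ?t 0 b"
      unfolding m_def by (simp add: drop_nth_flip_if_last nth_flip_if) (simp add: flip_if_def)
    moreover have "{c. m = 1 \<longrightarrow> c = b} = {b}" "{..<m} = {0}" "\<not> 2 \<le> m" using 2 by auto
    ultimately show ?thesis unfolding con
      by (simp only: sum.insert finite.emptyI empty_iff not_False_eq_True sum.empty add_0_right if_False)
  next
    case 3
    have "?p i + ?q i = ?t i False + ?t i True" if "i < m" for i
    proof (cases "Suc i = m")
      case True
      then have e: "m - 1 - i = 0" by simp
      have "?p i = ?t i b" using True that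
        unfolding e m_def by (simp add: drop_nth_flip_if_last nth_flip_if) (simp add: flip_if_def)
      moreover have "?q i = ?t i (\<not> b)" using True that
        unfolding e m_def by (simp add: drop_nth_flip_if_last nth_flip_if) (simp add: flip_if_def apply_if_def JJ)
      ultimately show ?thesis by (cases b) (simp_all only: add.commute not_True_eq_False not_False_eq_True)
    next
      case False
      then have i: "Suc i < length ys" using that by (simp add: m_def)
      have "?p i = ?t i False"
        using i by (simp add: drop_nth_flip_if nth_flip_if apply_if_def)
      moreover have "?q i = ?t i True"
        using i by (simp add: drop_nth_flip_if nth_flip_if apply_if_def flip_if_flip_if JJ)
      ultimately show ?thesis by simp
    qed
    moreover have "{c. m = 1 \<longrightarrow> c = b} = {False, True}" using 3 by auto
    ultimately have "(\<Sum>i<m. \<Sum>c\<in>{c. m = 1 \<longrightarrow> c = b}. ?t i c) = (\<Sum>i<m. ?p i + ?q i)"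
      by (intro sum.cong refl) simp
    then show ?thesis unfolding con using 3 by (simp add: sum.distrib)
  qed
qed


section \<open>Partition statistics under insertion of a leftmost point\<close>

definition crosses :: "nat set \<Rightarrow> nat set \<Rightarrow> bool" where
  "crosses W V \<longleftrightarrow> (\<exists>i\<in>V. \<exists>j\<in>V. \<exists>k\<in>W. \<exists>l\<in>W. k < i \<and> i < l \<and> l < j)"

text \<open>All four statistics are numbers of pairs of blocks in some relation; the two rules for
  inserting one block reduce each comparison below to the new block.\<close>

definition rel_count :: "'a set \<Rightarrow> 'b set \<Rightarrow> ('a \<Rightarrow> 'b \<Rightarrow> bool) \<Rightarrow> nat" where
  "rel_count A B R = card {(V, W). V \<in> A \<and> W \<in> B \<and> R V W}"

lemma rel_count_insert_left:
  assumes "finite A" "finite B" "a \<notin> A"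
  shows "rel_count (insert a A) B R = rel_count A B R + card {W \<in> B. R a W}"
proof -
  let ?X = "{(V, W). V \<in> A \<and> W \<in> B \<and> R V W}" and ?Y = "Pair a ` {W \<in> B. R a W}"
  have "{(V, W). V \<in> insert a A \<and> W \<in> B \<and> R V W} = ?X \<union> ?Y" by auto
  moreover have "finite ?X" by (rule finite_subset[of _ "A \<times> B"]) (use assms in auto)
  then have "card (?X \<union> ?Y) = card ?X + card ?Y"
    by (rule card_Un_disjoint) (use assms in auto)
  moreover have "card ?Y = card {W \<in> B. R a W}" by (rule card_image) (simp add: inj_on_def)
  ultimately show ?thesis by (simp only: rel_count_def)
qed

lemma rel_count_insert_right:
  assumes "finite A" "finite B" "b \<notin> B"
  shows "rel_count A (insert b B) R = rel_count A B R + card {V \<in> A. R V b}"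
proof -
  let ?X = "{(V, W). V \<in> A \<and> W \<in> B \<and> R V W}" and ?Y = "(\<lambda>V. (V, b)) ` {V \<in> A. R V b}"
  have "{(V, W). V \<in> A \<and> W \<in> insert b B \<and> R V W} = ?X \<union> ?Y" by auto
  moreover have "finite ?X" by (rule finite_subset[of _ "A \<times> B"]) (use assms in auto)
  then have "card (?X \<union> ?Y) = card ?X + card ?Y"
    by (rule card_Un_disjoint) (use assms in auto)
  moreover have "card ?Y = card {V \<in> A. R V b}" by (rule card_image) (simp add: inj_on_def)
  ultimately show ?thesis by (simp only: rel_count_def)
qed

lemma cr_eq_rel_count:
  assumes "finite \<pi>" shows "cr \<pi> = rel_count \<pi> \<pi> (\<lambda>V W. crosses W V)"
proof -
  have "{(V, W). V \<in> \<pi> \<and> W \<in> \<pi> \<and> crosses W V} = (SIGMA V:\<pi>. {W \<in> \<pi>. crosses W V})" by auto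
  then show ?thesis using assms by (simp add: cr_def rel_count_def lcr_def crosses_def)
qed

lemma cs_eq_rel_count: "cs \<pi> = rel_count (Sing_blocks \<pi>) \<pi> (\<lambda>S W. covers W S)"
  by (simp add: cs_def rel_count_def)

text \<open>The exponent of \<open>q\<close> in terms of the partition \<open>\<pi>\<close> and the set \<open>N\<close> of its negative pairs, which
  determine the coloring.\<close>

definition weight_exponent :: "nat set set \<Rightarrow> nat set set \<Rightarrow> nat" where
  "weight_exponent \<pi> N = rel_count \<pi> \<pi> (\<lambda>V W. crosses W V) + rel_count (Sing_blocks \<pi>) \<pi> (\<lambda>S W. covers W S)
     + 2 * rel_count N (Pair_blocks \<pi>) (\<lambda>V W. covers W V)
     + 2 * rel_count N (Sing_blocks \<pi>) (\<lambda>V S. strict_right_of S V)"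

text \<open>The pairs whose color is prescribed by condition (A).\<close>

definition extremal :: "nat set set \<Rightarrow> nat set \<Rightarrow> bool" where
  "extremal \<pi> V \<longleftrightarrow> (\<forall>S\<in>Sing_blocks \<pi>. \<not> right_of S V) \<and> (\<forall>W\<in>\<pi>. \<not> crosses W V \<and> \<not> covers W V)"

lemma extremal_iff:
  assumes "finite \<pi>"
  shows "extremal \<pi> V \<longleftrightarrow> sr \<pi> V = 0 \<and> lcr \<pi> V = 0 \<and> cover_num \<pi> V = 0"
proof -
  have "finite (Sing_blocks \<pi>)" using assms by (simp add: Sing_blocks_def)
  then show ?thesis using assms
    unfolding extremal_def sr_def lcr_def cover_num_def crosses_def[symmetric] by auto
qed

text \<open>Condition (A) on the set \<open>N\<close> of negative pairs.\<close>

definition admissible :: "nat set set \<Rightarrow> nat set set \<Rightarrow> bool" where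
  "admissible \<pi> N \<longleftrightarrow> N \<subseteq> Pair_blocks \<pi> \<and>
     (\<forall>V\<in>Pair_blocks \<pi>. extremal \<pi> V \<longrightarrow> (V \<in> N \<longleftrightarrow> odd (card {W \<in> N. right_of W V})))"

lemma blocks_insert_sing:
  "Sing_blocks (insert {a} \<rho>) = insert {a} (Sing_blocks \<rho>)" "Pair_blocks (insert {a} \<rho>) = Pair_blocks \<rho>"
  by (auto simp: Sing_blocks_def Pair_blocks_def)

lemma blocks_insert_doubleton:
  assumes "a \<noteq> b"
  shows "Sing_blocks (insert {a, b} \<rho>) = Sing_blocks \<rho>"
    "Pair_blocks (insert {a, b} \<rho>) = insert {a, b} (Pair_blocks \<rho>)"
proof -
  have "card {a, b} = 2" using assms by simp
  then show "Sing_blocks (insert {a, b} \<rho>) = Sing_blocks \<rho>"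
    "Pair_blocks (insert {a, b} \<rho>) = insert {a, b} (Pair_blocks \<rho>)"
    by (auto simp: Sing_blocks_def Pair_blocks_def)
qed

lemma sing_rels: "\<not> crosses {a} V" "\<not> crosses V {a}"
  by (auto simp: crosses_def)

lemma sing_not_covers: "V \<noteq> {} \<Longrightarrow> \<not> covers {a} V"
  by (auto simp: covers_def)

lemma finite_blocks: "finite \<rho> \<Longrightarrow> finite (Sing_blocks \<rho>)" "finite \<rho> \<Longrightarrow> finite (Pair_blocks \<rho>)"
  by (simp_all add: Sing_blocks_def Pair_blocks_def)

text \<open>A new smallest point \<open>k\<close> that becomes a singleton interacts with no other block.\<close>

context
  fixes \<rho> :: "nat set set" and k :: nat
  assumes fin: "finite \<rho>"
    and blk: "\<And>V. V \<in> \<rho> \<Longrightarrow> finite V \<and> V \<noteq> {}"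
    and gt: "\<And>V x. V \<in> \<rho> \<Longrightarrow> x \<in> V \<Longrightarrow> k < x"
begin

lemma first_rels:
  assumes "V \<in> \<rho>"
  shows "\<not> covers V {k}" "\<not> strict_right_of {k} V" "\<not> right_of {k} V"
proof -
  show "\<not> covers V {k}" using gt[OF assms] by (fastforce simp: covers_def)
  have "k < Min V" "k < Max V" using gt[OF assms] blk[OF assms] by auto
  then show "\<not> strict_right_of {k} V" "\<not> right_of {k} V" by (auto simp: strict_right_of_def right_of_def)
qed

lemma weight_exponent_insert_first:
  assumes N: "N \<subseteq> Pair_blocks \<rho>"
  shows "weight_exponent (insert {k} \<rho>) N = weight_exponent \<rho> N"
proof -
  note f = fin finite_blocks[OF fin] finite_subset[OF N finite_blocks(2)[OF fin]]
  have new: "{k} \<notin> \<rho>" using gt by blast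
  then have nS: "{k} \<notin> Sing_blocks \<rho>" by (auto simp: Sing_blocks_def)
  have N': "V \<in> N \<Longrightarrow> V \<in> \<rho>" for V using N by (auto simp: Pair_blocks_def)
  have S': "V \<in> Sing_blocks \<rho> \<Longrightarrow> V \<in> \<rho>" for V by (auto simp: Sing_blocks_def)
  have e: "{V \<in> insert {k} \<rho>. crosses {k} V} = {}" "{V \<in> \<rho>. crosses V {k}} = {}"
    "{V \<in> insert {k} (Sing_blocks \<rho>). covers {k} V} = {}" "{V \<in> \<rho>. covers V {k}} = {}"
    "{V \<in> N. strict_right_of {k} V} = {}"
    using sing_rels sing_not_covers blk first_rels S' N' by auto
  show ?thesis
    unfolding weight_exponent_def blocks_insert_sing
    by (simp only: rel_count_insert_left rel_count_insert_right f new nS e card.empty finite_insert not_False_eq_True add_0_right)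
qed

lemma admissible_insert_first:
  assumes N: "N \<subseteq> Pair_blocks \<rho>"
  shows "admissible (insert {k} \<rho>) N \<longleftrightarrow> admissible \<rho> N"
proof -
  have "extremal (insert {k} \<rho>) V \<longleftrightarrow> extremal \<rho> V" if "V \<in> Pair_blocks \<rho>" for V
    using that sing_rels sing_not_covers blk first_rels unfolding extremal_def blocks_insert_sing
    by (auto simp: Pair_blocks_def)
  then show ?thesis by (auto simp: admissible_def blocks_insert_sing)
qed

end

text \<open>In this context \<open>\<rho>\<close> are the old blocks without the point \<open>v\<close>, and \<open>k\<close> is a new smallest point.  The
  partition before the step is \<open>\<rho>\<close> with the block \<open>{v}\<close>, the one after it is \<open>\<rho>\<close> with the block
  \<open>{k, v}\<close>.\<close>

context
  fixes \<rho> :: "nat set set" and k v :: nat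
  assumes fin: "finite \<rho>"
    and blk: "\<And>V. V \<in> \<rho> \<Longrightarrow> finite V \<and> V \<noteq> {}"
    and gt: "\<And>V x. V \<in> \<rho> \<Longrightarrow> x \<in> V \<Longrightarrow> k < x \<and> x \<noteq> v"
    and kv: "k < v"
begin

lemma new_notin: "{v} \<notin> \<rho>" "{k, v} \<notin> \<rho>"
  using gt kv by blast+

lemma blocks_insert_pair:
  "Sing_blocks (insert {k, v} \<rho>) = Sing_blocks \<rho>" "Pair_blocks (insert {k, v} \<rho>) = insert {k, v} (Pair_blocks \<rho>)"
  using kv by (simp_all add: blocks_insert_doubleton)

text \<open>The new pair \<open>{k, v}\<close> starts to the left of everything else.  It crosses exactly the blocks that
  covered the singleton \<open>{v}\<close>, and it covers exactly the blocks that had \<open>{v}\<close> on their strict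
  right.  These two equivalences are responsible for the exchange of statistics below.\<close>

lemma pair_rels:
  assumes V: "V \<in> \<rho>"
  shows "\<not> crosses V {k, v}" "\<not> covers V {k, v}" "\<not> right_of {k, v} V"
    "crosses {k, v} V \<longleftrightarrow> covers V {v}" "covers {k, v} V \<longleftrightarrow> strict_right_of {v} V"
proof -
  have b: "finite V" "V \<noteq> {}" "\<And>x. x \<in> V \<Longrightarrow> k < x" "\<And>x. x \<in> V \<Longrightarrow> x \<noteq> v" using blk[OF V] gt[OF V] by auto
  show "\<not> crosses V {k, v}"
  proof
    assume "crosses V {k, v}"
    then obtain i j x l where "i \<in> {k, v}" "j \<in> {k, v}" "x \<in> V" "x < i" "i < l" "l < j" unfolding crosses_def by blast
    then show False using b(3)[of x] kv by auto
  qed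
  show "\<not> covers V {k, v}" using b kv by (fastforce simp: covers_def)
  have "k < Min V" using b by auto
  then show "\<not> right_of {k, v} V" using kv by (auto simp: right_of_def)
  show "crosses {k, v} V \<longleftrightarrow> covers V {v}"
  proof
    assume "crosses {k, v} V"
    then obtain i j l where "i \<in> V" "j \<in> V" "l \<in> {k, v}" "i < l" "l < j" unfolding crosses_def by blast
    moreover from this have "l = v" using b(3)[of i] by auto
    ultimately show "covers V {v}" unfolding covers_def by blast
  next
    assume "covers V {v}"
    then obtain i j where "i \<in> V" "j \<in> V" "i < v" "v < j" unfolding covers_def by blast
    then show "crosses {k, v} V" using b(3)[of i] unfolding crosses_def by blast
  qed
  show "covers {k, v} V \<longleftrightarrow> strict_right_of {v} V"
    using b kv unfolding covers_def strict_right_of_def by auto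
qed

lemma pair_self_rels: "\<not> crosses {k, v} {k, v}" "\<not> covers {k, v} {k, v}" "\<not> right_of {k, v} {k, v}"
  by (auto simp: crosses_def covers_def right_of_def)

text \<open>Let the singleton \<open>{v}\<close> be replaced by the pair \<open>{k, v}\<close>.  A cover of the singleton becomes a
  crossing of the pair, and a negative pair with the singleton on its strict right becomes a negative
  pair covered by the new pair; both changes leave the exponent fixed.  What remains are the
  singletons covered by the new pair and, if this pair is negative, the singletons on its strict right
  with weight 2.  This is the exponent in \<open>contraction_flip_if\<close>.\<close>

lemma weight_exponent_pairing:
  assumes N: "N \<subseteq> Pair_blocks \<rho>"
  shows "weight_exponent (insert {k, v} \<rho>) (if c then insert {k, v} N else N) =
    weight_exponent (insert {v} \<rho>) N + card {S \<in> Sing_blocks \<rho>. strict_right_of {v} S}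
      + (if c then 2 * card {S \<in> Sing_blocks \<rho>. strict_right_of S {k, v}} else 0)"
proof -
  let ?P = "{k, v}"
  note f = fin finite_blocks[OF fin] finite_subset[OF N finite_blocks(2)[OF fin]]
  have nS: "{v} \<notin> Sing_blocks \<rho>" "?P \<notin> Pair_blocks \<rho>" "?P \<notin> N" using new_notin N by (auto simp: Sing_blocks_def Pair_blocks_def)
  have N': "V \<in> N \<Longrightarrow> V \<in> \<rho>" for V using N by (auto simp: Pair_blocks_def)
  have S': "V \<in> Sing_blocks \<rho> \<Longrightarrow> V \<in> \<rho>" "V \<in> Pair_blocks \<rho> \<Longrightarrow> V \<in> \<rho>" for V
    by (auto simp: Sing_blocks_def Pair_blocks_def)
  have e: "{V \<in> insert {v} \<rho>. crosses {v} V} = {}" "{V \<in> \<rho>. crosses V {v}} = {}"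
    "{V \<in> insert {v} (Sing_blocks \<rho>). covers {v} V} = {}"
    using sing_rels sing_not_covers blk S' by auto
  have p: "{V \<in> \<rho>. crosses V ?P} = {}" "{V \<in> insert ?P \<rho>. crosses ?P V} = {V \<in> \<rho>. covers V {v}}"
    "{V \<in> Sing_blocks \<rho>. covers ?P V} = {S \<in> Sing_blocks \<rho>. strict_right_of {v} S}"
    "{V \<in> N. covers ?P V} = {V \<in> N. strict_right_of {v} V}"
    "{V \<in> insert ?P N. covers ?P V} = {V \<in> N. strict_right_of {v} V}"
    "{W \<in> Pair_blocks \<rho>. covers W ?P} = {}"
    using pair_rels pair_self_rels S' N' by auto
  show ?thesis
    unfolding weight_exponent_def blocks_insert_sing blocks_insert_pair
    by (cases c) (simp_all only: if_True if_False rel_count_insert_left rel_count_insert_right f new_notin nS e p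
        card.empty finite_insert not_False_eq_True add_0_right, simp_all)
qed

text \<open>If \<open>v\<close> lies to the right of \<open>V\<close>, then \<open>V\<close> is extremal neither before the step, because of the
  singleton \<open>{v}\<close>, nor after it, because \<open>{k, v}\<close> crosses or covers \<open>V\<close>.  Otherwise nothing changes
  for \<open>V\<close>.\<close>

lemma extremal_pairing:
  assumes V: "V \<in> \<rho>"
  shows "extremal (insert {k, v} \<rho>) V \<longleftrightarrow> extremal (insert {v} \<rho>) V"
proof -
  have b: "finite V" "V \<noteq> {}" "\<And>x. x \<in> V \<Longrightarrow> x \<noteq> v" using blk[OF V] gt[OF V] by auto
  have "right_of {v} V \<longleftrightarrow> covers V {v} \<or> strict_right_of {v} V"
  proof -
    have "covers V {v} \<longleftrightarrow> Min V < v \<and> v < Max V"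
      unfolding covers_def using b(1,2) by (auto simp: Min_less_iff Max_gr_iff)
    moreover have "Max V \<noteq> v" "Min V \<le> Max V" using b Max_in[of V] by auto
    ultimately show ?thesis by (auto simp: right_of_def strict_right_of_def)
  qed
  then show ?thesis
    using pair_rels[OF V] sing_rels sing_not_covers[OF b(2)]
    unfolding extremal_def blocks_insert_pair blocks_insert_sing by blast
qed

lemma extremal_new_pair: "extremal (insert {k, v} \<rho>) {k, v} \<longleftrightarrow> Sing_blocks \<rho> = {}"
proof -
  have "right_of S {k, v}" if "S \<in> Sing_blocks \<rho>" for S
  proof -
    have "S \<in> \<rho>" using that by (simp add: Sing_blocks_def)
    then have "k < Min S" using gt blk by auto
    then show ?thesis using kv by (simp add: right_of_def)
  qed
  then show ?thesis using pair_rels pair_self_rels unfolding extremal_def blocks_insert_pair by blast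
qed

text \<open>Negative pairs to the right of an old pair are the same before and after, because \<open>{k, v}\<close> is
  to the right of nothing.  The new pair itself is extremal only if no singleton is left, and then all
  pairs in \<open>N\<close> are on its right.\<close>

lemma admissible_pairing:
  assumes N: "N \<subseteq> Pair_blocks \<rho>"
  shows "admissible (insert {k, v} \<rho>) (if c then insert {k, v} N else N) \<longleftrightarrow>
    admissible (insert {v} \<rho>) N \<and> (Sing_blocks \<rho> = {} \<longrightarrow> (c \<longleftrightarrow> odd (card N)))"
proof -
  let ?P = "{k, v}" and ?M = "if c then insert {k, v} N else N"
  have nP: "?P \<notin> N" "?P \<notin> Pair_blocks \<rho>" using new_notin N by (auto simp: Pair_blocks_def)
  have "right_of W ?P" if "W \<in> N" for W
  proof -
    have "W \<in> \<rho>" using that N by (auto simp: Pair_blocks_def)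
    then have "k < Min W" using gt blk by auto
    then show ?thesis using kv by (simp add: right_of_def)
  qed
  then have 1: "{W \<in> ?M. right_of W ?P} = N" using pair_self_rels by auto
  have 2: "{W \<in> ?M. right_of W V} = {W \<in> N. right_of W V}" "V \<in> ?M \<longleftrightarrow> V \<in> N"
      "extremal (insert ?P \<rho>) V \<longleftrightarrow> extremal (insert {v} \<rho>) V" if "V \<in> Pair_blocks \<rho>" for V
    using that pair_rels(3)[of V] extremal_pairing[of V] nP by (auto simp: Pair_blocks_def)
  have 3: "?P \<in> ?M \<longleftrightarrow> c" "?M \<subseteq> insert ?P (Pair_blocks \<rho>)" using nP N by auto
  show ?thesis
    unfolding admissible_def blocks_insert_pair blocks_insert_sing ball_simps 1 3 extremal_new_pair
    using 2 3 N by auto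
qed

end


section \<open>Summation over partitions by the block of the leftmost point\<close>

definition singles :: "nat set set \<Rightarrow> nat set" where
  "singles \<pi> = \<Union>(Sing_blocks \<pi>)"

lemma Sing_blocks_eq: "Sing_blocks \<pi> = (\<lambda>s. {s}) ` singles \<pi>"
  by (auto simp: Sing_blocks_def singles_def card_1_singleton_iff)

lemma mem_singles: "s \<in> singles \<pi> \<longleftrightarrow> {s} \<in> \<pi>"
  by (auto simp: Sing_blocks_def singles_def card_1_singleton_iff)

text \<open>Partitions of type D, with the coloring replaced by the set of negative pairs and \<open>{1, \<dots>, n}\<close>
  replaced by any set, so that the recursion on the leftmost point can be formulated.\<close>

definition negative_partitions :: "(nat \<Rightarrow> exponent) \<Rightarrow> nat set \<Rightarrow> (nat set set \<times> nat set set) set" where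
  "negative_partitions \<epsilon> X = {(\<pi>, N). partition_on X \<pi> \<and> (\<forall>V\<in>\<pi>. card V \<in> {1, 2}) \<and>
     admissible \<pi> N \<and> compatible \<epsilon> \<pi>}"

definition partition_term :: "real \<Rightarrow> ('h::chilbert_space \<Rightarrow> 'h) \<Rightarrow> (nat \<Rightarrow> 'h) \<Rightarrow> nat set set \<Rightarrow> nat set set \<Rightarrow> 'h fock" where
  "partition_term q J x \<pi> N =
    (complex_of_real (q ^ weight_exponent \<pi> N)
      * (\<Prod>V\<in>Pair_blocks \<pi> - N. cinner (x (Min V)) (x (Max V)))
      * (\<Prod>V\<in>N. cinner (x (Min V)) (J (x (Max V)))))
    *\<^sub>C tens (flip_if (odd (card N)) J (map x (sorted_list_of_set (singles \<pi>))))"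

text \<open>If there are only pairs, then the pair \<open>P\<close> of the smallest point is extremal, and all other
  pairs are on its right.  By condition (A), \<open>P\<close> is negative iff the number of the other negative
  pairs is odd.\<close>

lemma admissible_no_singles_even:
  assumes p: "partition_on X \<pi>" "\<forall>V\<in>\<pi>. card V \<in> {1, 2}" and fX: "finite X"
    and adm: "admissible \<pi> N" and no: "singles \<pi> = {}"
  shows "even (card N)"
proof (cases "\<pi> = {}")
  case True
  then show ?thesis using adm by (simp add: admissible_def Pair_blocks_def)
next
  case False
  have fin: "finite \<pi>" using p(1) fX finite_elements by blast
  have blk: "finite V \<and> V \<noteq> {} \<and> V \<subseteq> X" if "V \<in> \<pi>" for V
    using that p(1) fX unfolding partition_on_def by (metis Sup_upper finite_subset)
  have "X \<noteq> {}" using False blk by blast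
  define k where "k = Min X"
  have k: "k \<in> X" "\<And>x. x \<in> X \<Longrightarrow> k \<le> x" using \<open>X \<noteq> {}\<close> fX by (simp_all add: k_def)
  obtain P where P: "P \<in> \<pi>" "k \<in> P" using k(1) p(1) unfolding partition_on_def by blast
  have "card P \<noteq> 1" using no P(1) by (auto simp: mem_singles[symmetric] card_1_singleton_iff)
  then have "card P = 2" using p(2) P(1) by auto
  then obtain a b where "P = {a, b}" "a \<noteq> b" by (auto simp: card_2_iff)
  then obtain v where Pv: "P = {k, v}" "k \<noteq> v" using P(2) by auto
  have "v \<in> X" using blk[OF P(1)] Pv by blast
  then have kv: "k < v" using k(2) Pv(2) by fastforce
  have pair: "P \<in> Pair_blocks \<pi>" using P(1) \<open>card P = 2\<close> by (simp add: Pair_blocks_def)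
  have "extremal \<pi> P"
    unfolding extremal_def
  proof (intro conjI ballI)
    fix S assume "S \<in> Sing_blocks \<pi>" then show "\<not> right_of S P" using no by (simp add: Sing_blocks_eq)
  next
    fix W assume W: "W \<in> \<pi>"
    have w: "k \<le> y" if "y \<in> W" for y using that blk[OF W] k(2) by blast
    show "\<not> crosses W P"
    proof
      assume "crosses W P"
      then obtain i j y l where "i \<in> {k, v}" "j \<in> {k, v}" "y \<in> W" "y < i" "i < l" "l < j"
        unfolding crosses_def Pv(1) by blast
      then show False using w[of y] kv by auto
    qed
    show "\<not> covers W P"
      unfolding covers_def Pv(1) using w by fastforce
  qed
  then have "P \<in> N \<longleftrightarrow> odd (card {W \<in> N. right_of W P})" using adm pair unfolding admissible_def by blast
  moreover have "{W \<in> N. right_of W P} = N - {P}"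
  proof -
    have "right_of W P" if "W \<in> N" "W \<noteq> P" for W
    proof -
      have W: "W \<in> \<pi>" using that(1) adm by (auto simp: admissible_def Pair_blocks_def)
      have "Min W \<in> W" "Min W \<in> X" using blk[OF W] Min_in by auto
      moreover have "k \<notin> W" using p(1) W P that(2) unfolding partition_on_def by (meson disjointD disjoint_iff)
      ultimately have "k < Min W" using k(2) by (metis le_neq_implies_less)
      then show ?thesis using kv by (simp add: right_of_def Pv(1))
    qed
    moreover have "\<not> right_of P P" by (simp add: right_of_def)
    ultimately show ?thesis by blast
  qed
  moreover have "finite N" using adm fin by (auto simp: admissible_def Pair_blocks_def intro: finite_subset)
  ultimately show ?thesis by (cases "P \<in> N") (auto simp: card_Diff_singleton card_gt_0_iff)
qed

lemma partition_on_insert_block: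
  assumes \<pi>: "partition_on X \<pi>" and B: "B \<noteq> {}" "B \<inter> X = {}"
  shows "partition_on (B \<union> X) (insert B \<pi>)"
proof -
  have "\<Union>{B} \<inter> \<Union>\<pi> = {}" using B partition_onD1[OF \<pi>] by simp
  then have "disjoint ({B} \<union> \<pi>)" using partition_onD2[OF \<pi>] by (intro disjoint_union) simp_all
  then show ?thesis using partition_onD1[OF \<pi>] partition_onD3[OF \<pi>] B by (simp add: partition_on_def)
qed

lemma partition_on_remove_block:
  assumes \<pi>: "partition_on X \<pi>" and B: "B \<in> \<pi>"
  shows "partition_on (X - B) (\<pi> - {B})"
proof (rule partition_onI)
  show "\<Union>(\<pi> - {B}) = X - B"
  proof (intro set_eqI iffI)
    fix a assume "a \<in> \<Union>(\<pi> - {B})"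
    then obtain V where V: "V \<in> \<pi>" "V \<noteq> B" "a \<in> V" by blast
    then have "V \<inter> B = {}" using disjointD[OF partition_onD2[OF \<pi>] V(1) B] by blast
    then show "a \<in> X - B" using V partition_onD1[OF \<pi>] by blast
  qed (use partition_onD1[OF \<pi>] in blast)
  show "disjnt V W" if "V \<in> \<pi> - {B}" "W \<in> \<pi> - {B}" "V \<noteq> W" for V W
    using that disjointD[OF partition_onD2[OF \<pi>]] by (simp add: disjnt_def)
qed (use partition_onD3[OF \<pi>] in blast)

lemma finite_negative_partitions:
  assumes "finite X" shows "finite (negative_partitions \<epsilon> X)"
proof (rule finite_subset)
  have "\<pi> \<in> Pow (Pow X) \<and> N \<in> Pow (Pow X)" if "(\<pi>, N) \<in> negative_partitions \<epsilon> X" for \<pi> N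
  proof -
    have p: "partition_on X \<pi>" "N \<subseteq> Pair_blocks \<pi>"
      using that by (simp_all add: negative_partitions_def admissible_def)
    have "\<pi> \<subseteq> Pow X" unfolding partition_onD1[OF p(1)] by blast
    then show ?thesis using p(2) by (auto simp: Pair_blocks_def)
  qed
  then show "negative_partitions \<epsilon> X \<subseteq> Pow (Pow X) \<times> Pow (Pow X)"
    by (intro subrelI SigmaI) blast+
qed (use assms in simp)

context
  fixes X :: "nat set" and k :: nat and \<epsilon> :: "nat \<Rightarrow> exponent"
  assumes fX: "finite X" and kX: "\<And>a. a \<in> X \<Longrightarrow> k < a"
begin

lemma block_facts:
  assumes "partition_on (X - A) \<rho>"
  shows "finite \<rho>" "V \<in> \<rho> \<Longrightarrow> finite V \<and> V \<noteq> {}" "V \<in> \<rho> \<Longrightarrow> a \<in> V \<Longrightarrow> k < a \<and> a \<notin> A"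
proof -
  show "finite \<rho>" using finite_elements[OF _ assms] fX by simp
  have *: "V \<subseteq> X - A" "V \<noteq> {}" if "V \<in> \<rho>" for V
    using that assms unfolding partition_on_def by auto
  show "V \<in> \<rho> \<Longrightarrow> finite V \<and> V \<noteq> {}" using *[of V] fX finite_subset[of V X] by blast
  show "V \<in> \<rho> \<Longrightarrow> a \<in> V \<Longrightarrow> k < a \<and> a \<notin> A" using * kX by blast
qed

lemma compatible_insert_sing:
  "compatible \<epsilon> (insert {a} \<rho>) \<longleftrightarrow> \<epsilon> a = Star \<and> compatible \<epsilon> \<rho>"
  by (auto simp: compatible_def blocks_insert_sing)

lemma compatible_insert_pair:
  assumes "k < v" shows "compatible \<epsilon> (insert {k, v} \<rho>) \<longleftrightarrow> \<epsilon> k = One \<and> \<epsilon> v = Star \<and> compatible \<epsilon> \<rho>"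
  using assms by (auto simp: compatible_def blocks_insert_doubleton)

lemma negative_partitions_pairing:
  assumes v: "v \<in> X" and \<rho>: "partition_on (X - {v}) \<rho>" and N: "N \<subseteq> Pair_blocks \<rho>" and k: "\<epsilon> k = One"
  shows "(insert {k, v} \<rho>, if c then insert {k, v} N else N) \<in> negative_partitions \<epsilon> (insert k X) \<longleftrightarrow>
    (insert {v} \<rho>, N) \<in> negative_partitions \<epsilon> X \<and> (Sing_blocks \<rho> = {} \<longrightarrow> c = odd (card N))"
proof -
  have kv: "k < v" using kX v by blast
  note f = block_facts[OF \<rho>]
  have 1: "partition_on (insert k X) (insert {k, v} \<rho>)"
  proof -
    have "{k, v} \<union> (X - {v}) = insert k X" using v by blast
    then show ?thesis using partition_on_insert_block[OF \<rho>, of "{k, v}"] kX by (metis Diff_iff Int_insert_left_if0 Int_empty_left insertI1 insert_not_empty less_irrefl)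
  qed
  have 2: "partition_on X (insert {v} \<rho>)"
  proof -
    have "{v} \<union> (X - {v}) = X" using v by blast
    then show ?thesis using partition_on_insert_block[OF \<rho>, of "{v}"] by auto
  qed
  have "admissible (insert {k, v} \<rho>) (if c then insert {k, v} N else N) \<longleftrightarrow>
    admissible (insert {v} \<rho>) N \<and> (Sing_blocks \<rho> = {} \<longrightarrow> (c \<longleftrightarrow> odd (card N)))"
    by (rule admissible_pairing) (use f kv N in auto)
  then show ?thesis
    using 1 2 kv k unfolding negative_partitions_def
    by (auto simp: compatible_insert_sing compatible_insert_pair)
qed

lemma negative_partitions_remove_single:
  assumes mem: "(\<pi>, N) \<in> negative_partitions \<epsilon> X" and v: "v \<in> singles \<pi>"
  defines "\<rho> \<equiv> \<pi> - {{v}}"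
  shows "v \<in> X" "partition_on (X - {v}) \<rho>" "insert {v} \<rho> = \<pi>" "N \<subseteq> Pair_blocks \<rho>"
    "Sing_blocks \<rho> = {} \<longleftrightarrow> card (singles \<pi>) = 1"
proof -
  have p: "partition_on X \<pi>" and N: "N \<subseteq> Pair_blocks \<pi>"
    using mem by (simp_all add: negative_partitions_def admissible_def)
  have v': "{v} \<in> \<pi>" using v by (simp add: mem_singles)
  then show "v \<in> X" using partition_onD1[OF p] by blast
  show "partition_on (X - {v}) \<rho>" unfolding \<rho>_def by (rule partition_on_remove_block[OF p v'])
  show "insert {v} \<rho> = \<pi>" using v' by (auto simp: \<rho>_def)
  show "N \<subseteq> Pair_blocks \<rho>" using N by (auto simp: \<rho>_def Pair_blocks_def)
  have "singles \<rho> = singles \<pi> - {v}" by (auto simp: mem_singles \<rho>_def)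
  then have "Sing_blocks \<rho> = {} \<longleftrightarrow> singles \<pi> = {v}" using v by (auto simp: Sing_blocks_eq)
  also have "\<dots> \<longleftrightarrow> card (singles \<pi>) = 1" using v by (auto simp: card_1_singleton_iff)
  finally show "Sing_blocks \<rho> = {} \<longleftrightarrow> card (singles \<pi>) = 1" .
qed

text \<open>By compatibility, the symbol of the smallest point decides whether this point is a singleton or
  the left end of a pair.\<close>

lemma negative_partitions_first_block:
  assumes mem: "(\<pi>, N) \<in> negative_partitions \<epsilon> (insert k X)"
  obtains "\<epsilon> k = Star" "{k} \<in> \<pi>" | v where "\<epsilon> k = One" "v \<in> X" "{k, v} \<in> \<pi>"
proof -
  have p: "partition_on (insert k X) \<pi>" and c: "\<And>V. V \<in> \<pi> \<Longrightarrow> card V \<in> {1, 2}" and e: "compatible \<epsilon> \<pi>"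
    using mem by (simp_all add: negative_partitions_def)
  obtain P where P: "P \<in> \<pi>" "k \<in> P" using partition_onD1[OF p] by blast
  have PX: "P \<subseteq> insert k X" using partition_onD1[OF p] P(1) by blast
  consider "card P = 1" | "card P = 2" using c[OF P(1)] by blast
  then show thesis
  proof cases
    case 1
    then have "P = {k}" using P(2) by (auto simp: card_1_singleton_iff)
    moreover have "P \<in> Sing_blocks \<pi>" using 1 P(1) by (simp add: Sing_blocks_def)
    ultimately show thesis using e P(1) that(1) by (auto simp: compatible_def)
  next
    case 2
    then obtain a b where "P = {a, b}" "a \<noteq> b" by (auto simp: card_2_iff)
    then obtain v where v: "P = {k, v}" "k \<noteq> v" using P(2) by auto
    then have "v \<in> X" using PX by blast
    then have "Min P = k" using kX[of v] v(1) by simp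
    moreover have "P \<in> Pair_blocks \<pi>" using 2 P(1) by (simp add: Pair_blocks_def)
    ultimately show thesis using e P(1) v \<open>v \<in> X\<close> that(2) by (auto simp: compatible_def)
  qed
qed

lemma sum_negative_partitions_Star:
  assumes k: "\<epsilon> k = Star"
  shows "(\<Sum>(\<pi>, N)\<in>negative_partitions \<epsilon> (insert k X). G \<pi> N)
    = (\<Sum>(\<pi>, N)\<in>negative_partitions \<epsilon> X. G (insert {k} \<pi>) N)"
proof -
  let ?Q = "negative_partitions \<epsilon> X" and ?R = "negative_partitions \<epsilon> (insert k X)"
  let ?h = "\<lambda>(\<pi>, N). (insert {k} \<pi>, N :: nat set set)"
  have mem: "(insert {k} \<pi>, N) \<in> ?R \<longleftrightarrow> (\<pi>, N) \<in> ?Q"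
    if p: "partition_on X \<pi>" and N: "N \<subseteq> Pair_blocks \<pi>" for \<pi> N
  proof -
    have p': "partition_on (X - {}) \<pi>" using p by simp
    have "k \<notin> X" using kX by blast
    then have "partition_on (insert k X) (insert {k} \<pi>)" using partition_on_insert_block[OF p, of "{k}"] by simp
    moreover have "admissible (insert {k} \<pi>) N \<longleftrightarrow> admissible \<pi> N"
      by (rule admissible_insert_first) (use block_facts[OF p'] N in auto)
    ultimately show ?thesis using p k by (auto simp: negative_partitions_def compatible_insert_sing)
  qed
  have D: "partition_on X \<pi> \<and> N \<subseteq> Pair_blocks \<pi> \<and> {k} \<notin> \<pi>" if "(\<pi>, N) \<in> ?Q" for \<pi> N
  proof -
    have p: "partition_on X \<pi>" using that by (simp add: negative_partitions_def)
    have "{k} \<notin> \<pi>" using partition_onD1[OF p] kX by blast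
    then show ?thesis using that by (simp add: negative_partitions_def admissible_def)
  qed
  have "bij_betw ?h (?Q) (?R)"
  proof (rule bij_betw_imageI)
    show "inj_on ?h (?Q)"
    proof (rule inj_onI)
      fix y z assume y: "y \<in> ?Q" and z: "z \<in> ?Q"
        and eq: "?h y = ?h z"
      obtain \<pi> N \<pi>' N' where yz: "y = (\<pi>, N)" "z = (\<pi>', N')" by (metis prod.exhaust)
      have "insert {k} \<pi> = insert {k} \<pi>'" "N = N'" using eq by (simp_all add: yz)
      moreover have "{k} \<notin> \<pi>" "{k} \<notin> \<pi>'" using D y z unfolding yz by blast+
      ultimately show "y = z" unfolding yz by (simp add: insert_ident)
    qed
    show "?h ` ?Q = ?R"
    proof (intro equalityI subsetI)
      fix z assume "z \<in> ?h ` ?Q"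
      then obtain \<pi> N where z: "z = (insert {k} \<pi>, N)" "(\<pi>, N) \<in> ?Q" by auto
      then show "z \<in> ?R" using D[OF z(2)] mem by simp
    next
      fix z assume z: "z \<in> ?R"
      obtain \<pi>' N where z': "z = (\<pi>', N)" by (cases z)
      have kk: "{k} \<in> \<pi>'" using z k unfolding z' by (auto elim: negative_partitions_first_block)
      define \<pi> where "\<pi> = \<pi>' - {{k}}"
      have p: "partition_on (insert k X) \<pi>'" and N: "N \<subseteq> Pair_blocks \<pi>'"
        using z by (simp_all add: z' negative_partitions_def admissible_def)
      have "k \<notin> X" using kX by blast
      then have 1: "partition_on X \<pi>" using partition_on_remove_block[OF p kk] by (simp add: \<pi>_def)
      have 2: "N \<subseteq> Pair_blocks \<pi>" using N by (auto simp: \<pi>_def Pair_blocks_def)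
      have 3: "insert {k} \<pi> = \<pi>'" using kk by (auto simp: \<pi>_def)
      then have "(\<pi>, N) \<in> ?Q" using mem[OF 1 2] z z' by simp
      then show "z \<in> ?h ` ?Q"
        using 3 z' by (intro image_eqI[of _ _ "(\<pi>, N)"]) simp_all
    qed
  qed
  from sum.reindex_bij_betw[OF this, of "\<lambda>(\<pi>, N). G \<pi> N"] show ?thesis
    by (simp add: case_prod_unfold)
qed

text \<open>A partition in which \<open>k\<close> is the left end of a pair \<open>{k, v}\<close> of color \<open>c\<close> arises from exactly one
  partition without \<open>k\<close>, by pairing its singleton \<open>v\<close> with \<open>k\<close>.\<close>

lemma sum_negative_partitions_One:
  assumes k: "\<epsilon> k = One"
  shows "(\<Sum>(\<pi>, N)\<in>negative_partitions \<epsilon> (insert k X). G \<pi> N)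
    = (\<Sum>(\<pi>, N)\<in>negative_partitions \<epsilon> X. \<Sum>v\<in>singles \<pi>. \<Sum>c\<in>{c. card (singles \<pi>) = 1 \<longrightarrow> c = odd (card N)}.
         G (insert {k, v} (\<pi> - {{v}})) (if c then insert {k, v} N else N))"
proof -
  let ?Q = "negative_partitions \<epsilon> X" and ?R = "negative_partitions \<epsilon> (insert k X)"
  define A where "A = (\<lambda>(\<pi> :: nat set set, N :: nat set set). SIGMA v:singles \<pi>. {c. card (singles \<pi>) = 1 \<longrightarrow> c = odd (card N)})"
  define h where "h = (\<lambda>((\<pi>, N), v, c). (insert {k, v} (\<pi> - {{v}}), if c then insert {k, v} N else N :: nat set set))"
  have fS: "finite (singles \<pi>)" if "(\<pi>, N) \<in> ?Q" for \<pi> N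
  proof -
    have "partition_on X \<pi>" using that by (simp add: negative_partitions_def)
    then have "singles \<pi> \<subseteq> X" using partition_onD1[of X \<pi>] by (auto simp: mem_singles)
    then show ?thesis using fX finite_subset by blast
  qed
  have fC: "finite C" for C :: "bool set" by (rule finite_subset[of _ UNIV]) simp_all
  have D: "\<rho> = \<pi> - {{v}} \<Longrightarrow> v \<in> X \<and> partition_on (X - {v}) \<rho> \<and> insert {v} \<rho> = \<pi> \<and> N \<subseteq> Pair_blocks \<rho> \<and>
      {k, v} \<notin> \<rho> \<and> {k, v} \<notin> N \<and> {v} \<notin> \<rho> \<and> (Sing_blocks \<rho> = {} \<longleftrightarrow> card (singles \<pi>) = 1) \<and> (\<forall>V\<in>\<rho>. k \<notin> V)"
    if "(\<pi>, N) \<in> ?Q" "v \<in> singles \<pi>" for \<pi> N v \<rho>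
  proof -
    assume r: "\<rho> = \<pi> - {{v}}"
    note d = negative_partitions_remove_single[OF that, folded r]
    have "\<forall>V\<in>\<rho>. k \<notin> V" using block_facts(3)[OF d(2)] by blast
    moreover from this have "{k, v} \<notin> \<rho>" by blast
    moreover from this have "{k, v} \<notin> N" using d(4) by (auto simp: Pair_blocks_def)
    ultimately show ?thesis using d r by blast
  qed
  have "bij_betw h (SIGMA z:?Q. A z) ?R"
  proof (rule bij_betw_imageI)
    show "inj_on h (SIGMA z:?Q. A z)"
    proof (rule inj_onI)
      fix y z assume y: "y \<in> (SIGMA z:?Q. A z)" and z: "z \<in> (SIGMA z:?Q. A z)" and eq: "h y = h z"
      obtain \<pi> N v c where y': "y = ((\<pi>, N), v, c)" by (metis prod.exhaust)
      obtain \<pi>' N' v' c' where z': "z = ((\<pi>', N'), v', c')" by (metis prod.exhaust)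
      define \<rho> \<rho>' where r: "\<rho> = \<pi> - {{v}}" "\<rho>' = \<pi>' - {{v'}}"
      have "(\<pi>, N) \<in> ?Q" "v \<in> singles \<pi>" using y by (auto simp: y' A_def)
      note d = D[OF this r(1)]
      have "(\<pi>', N') \<in> ?Q" "v' \<in> singles \<pi>'" using z by (auto simp: z' A_def)
      note d' = D[OF this r(2)]
      have e1: "insert {k, v} \<rho> = insert {k, v'} \<rho>'"
        and e2: "(if c then insert {k, v} N else N) = (if c' then insert {k, v'} N' else N')"
        using eq by (simp_all add: y' z' h_def r)
      have "{k, v} \<in> insert {k, v'} \<rho>'" using e1 by blast
      then have "{k, v} = {k, v'}" using d' by blast
      then have vv: "v = v'" by (auto simp: doubleton_eq_iff)
      have n: "{k, v} \<notin> \<rho>" "{k, v} \<notin> N" "insert {v} \<rho> = \<pi>" using d by blast+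
      have n': "{k, v} \<notin> \<rho>'" "{k, v} \<notin> N'" "insert {v} \<rho>' = \<pi>'" unfolding vv using d' by blast+
      have "\<rho> = \<rho>'" using e1 insert_ident[OF n(1) n'(1)] unfolding vv[symmetric] by simp
      then have "\<pi> = \<pi>'" using n(3) n'(3) by simp
      moreover have "c = c'" using e2 n(2) n'(2) unfolding vv[symmetric] by (metis insertI1)
      moreover from this have "N = N'"
        using e2 insert_ident[OF n(2) n'(2)] unfolding vv[symmetric] by (cases c') simp_all
      ultimately show "y = z" using vv by (simp add: y' z')
    qed
    show "h ` (SIGMA z:?Q. A z) = ?R"
    proof (intro equalityI subsetI)
      fix w assume "w \<in> h ` (SIGMA z:?Q. A z)"
      then obtain \<pi> N v c where w: "w = h ((\<pi>, N), v, c)" and z: "(\<pi>, N) \<in> ?Q" "v \<in> singles \<pi>"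
        "card (singles \<pi>) = 1 \<longrightarrow> c = odd (card N)" by (auto simp: A_def)
      note d = D[OF z(1,2) refl]
      have "w = (insert {k, v} (\<pi> - {{v}}), if c then insert {k, v} N else N)" by (simp add: w h_def)
      then show "w \<in> ?R" using negative_partitions_pairing[of v "\<pi> - {{v}}" N c, OF _ _ _ k] d z by metis
    next
      fix w assume "w \<in> ?R"
      then obtain \<pi>' N' where w: "w = (\<pi>', N')" "(\<pi>', N') \<in> ?R" by (metis prod.exhaust)
      obtain v where v: "v \<in> X" "{k, v} \<in> \<pi>'"
        using w(2) k by (auto elim: negative_partitions_first_block)
      define \<rho> N c where defs: "\<rho> = \<pi>' - {{k, v}}" "N = N' - {{k, v}}" "c = ({k, v} \<in> N')"
      have p: "partition_on (insert k X) \<pi>'" and N: "N' \<subseteq> Pair_blocks \<pi>'"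
        using w(2) by (simp_all add: negative_partitions_def admissible_def)
      have "k \<notin> X" using kX by blast
      then have "insert k X - {k, v} = X - {v}" using v(1) by auto
      then have \<rho>: "partition_on (X - {v}) \<rho>" using partition_on_remove_block[OF p v(2)] by (simp add: defs)
      have N\<rho>: "N \<subseteq> Pair_blocks \<rho>" using N by (auto simp: defs Pair_blocks_def)
      have "(insert {k, v} \<rho>, if c then insert {k, v} N else N) = w"
        unfolding w(1) defs using v(2) by auto
      then have z: "(insert {v} \<rho>, N) \<in> ?Q" "Sing_blocks \<rho> = {} \<longrightarrow> c = odd (card N)"
        using negative_partitions_pairing[OF v(1) \<rho> N\<rho> k] w by metis+
      have vs: "v \<in> singles (insert {v} \<rho>)" by (simp add: mem_singles)
      have "{v} \<notin> \<rho>" using partition_onD1[OF \<rho>] by blast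
      then have rr: "\<rho> = insert {v} \<rho> - {{v}}" by blast
      note d = D[OF z(1) vs rr]
      have "h ((insert {v} \<rho>, N), v, c) = w"
        unfolding h_def using \<open>_ = w\<close> rr by simp
      moreover have "((insert {v} \<rho>, N), v, c) \<in> (SIGMA z:?Q. A z)" using z vs d by (simp add: A_def)
      ultimately show "w \<in> h ` (SIGMA z:?Q. A z)" by blast
    qed
  qed
  from sum.reindex_bij_betw[OF this, of "\<lambda>(\<pi>, N). G \<pi> N"]
  have "(\<Sum>(\<pi>, N)\<in>?R. G \<pi> N) = (\<Sum>y\<in>(SIGMA z:?Q. A z). case h y of (\<pi>, N) \<Rightarrow> G \<pi> N)" by simp
  also have "\<dots> = (\<Sum>z\<in>?Q. \<Sum>y\<in>A z. case h (z, y) of (\<pi>, N) \<Rightarrow> G \<pi> N)"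
    using finite_negative_partitions[OF fX] fS fC
    by (subst sum.Sigma) (auto simp: A_def case_prod_unfold)
  also have "\<dots> = (\<Sum>(\<pi>, N)\<in>?Q. \<Sum>v\<in>singles \<pi>. \<Sum>c\<in>{c. card (singles \<pi>) = 1 \<longrightarrow> c = odd (card N)}.
         G (insert {k, v} (\<pi> - {{v}})) (if c then insert {k, v} N else N))"
  proof (rule sum.cong[OF refl])
    fix z assume z: "z \<in> ?Q"
    obtain \<pi> N where z': "z = (\<pi>, N)" by (cases z)
    show "(\<Sum>y\<in>A z. case h (z, y) of (\<pi>, N) \<Rightarrow> G \<pi> N) = (case z of (\<pi>, N) \<Rightarrow>
       \<Sum>v\<in>singles \<pi>. \<Sum>c\<in>{c. card (singles \<pi>) = 1 \<longrightarrow> c = odd (card N)}.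
         G (insert {k, v} (\<pi> - {{v}})) (if c then insert {k, v} N else N))"
      unfolding z' A_def prod.case h_def
      by (subst sum.Sigma) (use fS z z' fC in \<open>auto simp: case_prod_unfold\<close>)
  qed
  finally show ?thesis .
qed

end


section \<open>The moment formula\<close>

lemma sorted_list_nth_facts:
  fixes T :: "nat set"
  assumes T: "finite T"
  defines "vs \<equiv> sorted_list_of_set T"
  assumes i: "i < card T"
  shows "vs ! i \<in> T" "card {s \<in> T. s < vs ! i} = i" "card {s \<in> T. vs ! i < s} = card T - 1 - i"
    "drop_nth i vs = sorted_list_of_set (T - {vs ! i})"
proof -
  have len: "length vs = card T" and set: "set vs = T" and dist: "distinct vs"
    using T by (simp_all add: vs_def)
  have less: "vs ! a < vs ! b \<longleftrightarrow> a < b" if "a < card T" "b < card T" for a b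
  proof -
    have "vs ! a < vs ! b" if "a < b" "b < card T" for a b
      using that sorted_wrt_nth_less[of "(<)" vs a b] T by (simp add: vs_def)
    then show ?thesis using that by (metis less_asym less_irrefl linorder_neqE_nat)
  qed
  have inj: "inj_on ((!) vs) {..<card T}" using dist len by (auto simp: inj_on_nth)
  have Tn: "T = (!) vs ` {..<card T}" using set len by (auto simp: set_conv_nth)
  show "vs ! i \<in> T" using i set len by (metis nth_mem)
  have "{s \<in> T. s < vs ! i} = (!) vs ` {..<i}"
    using less i by (subst Tn) (auto intro: less_trans)
  moreover have "inj_on ((!) vs) {..<i}" using inj by (rule inj_on_subset) (use i in auto)
  ultimately show "card {s \<in> T. s < vs ! i} = i" by (simp add: card_image)
  have "{s \<in> T. vs ! i < s} = (!) vs ` {Suc i..<card T}"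
    using less i by (subst Tn) (auto simp: Suc_le_eq)
  moreover have "inj_on ((!) vs) {Suc i..<card T}" using inj by (rule inj_on_subset) auto
  ultimately show "card {s \<in> T. vs ! i < s} = card T - 1 - i" by (simp add: card_image)
  have split: "vs = take i vs @ vs ! i # drop (Suc i) vs" using i len by (simp add: id_take_nth_drop)
  then have "vs ! i \<notin> set (take i vs)" using dist by (metis distinct_append disjoint_insert(1) list.simps(15))
  then have "remove1 (vs ! i) vs = take i vs @ drop (Suc i) vs"
    by (subst (2) split) (simp add: remove1_append)
  then show "drop_nth i vs = sorted_list_of_set (T - {vs ! i})"
    using T by (simp add: drop_nth_def vs_def sorted_list_of_set_remove)
qed

lemma singles_insert:
  "singles (insert {v} \<rho>) = insert v (singles \<rho>)" "k \<noteq> v \<Longrightarrow> singles (insert {k, v} \<rho>) = singles \<rho>"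
  by (auto simp: mem_singles)

lemma drop_nth_map: "drop_nth i (map f xs) = map f (drop_nth i xs)"
  by (simp add: drop_nth_def take_map drop_map)

lemma flip_if_Cons: "ys \<noteq> [] \<or> \<not> b \<Longrightarrow> flip_if b J (y # ys) = y # flip_if b J ys"
  by (auto simp: flip_if_def flip_last_def)

lemma card_singles_filter: "card {S \<in> Sing_blocks \<rho>. P S} = card {s \<in> singles \<rho>. P {s}}"
proof -
  have "{S \<in> Sing_blocks \<rho>. P S} = (\<lambda>s. {s}) ` {s \<in> singles \<rho>. P {s}}" unfolding Sing_blocks_eq by auto
  then show ?thesis by (simp add: card_image)
qed

context
  fixes X :: "nat set" and k :: nat and \<epsilon> :: "nat \<Rightarrow> exponent"
  assumes fX: "finite X" and kX: "\<And>a. a \<in> X \<Longrightarrow> k < a"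
begin

text \<open>A new leftmost singleton changes no statistic.  If it is the only singleton, then it is the
  rightmost one as well; it carries no \<open>J\<close>, since the number of negative pairs is even by
  \<open>admissible_no_singles_even\<close>.\<close>

lemma creation_partition_term:
  assumes mem: "(\<pi>, N) \<in> negative_partitions \<epsilon> X"
  shows "creation (x k) (partition_term q J x \<pi> N) = partition_term q J x (insert {k} \<pi>) N"
proof -
  have p: "partition_on X \<pi>" "\<forall>V\<in>\<pi>. card V \<in> {1, 2}" and adm: "admissible \<pi> N"
    using mem by (simp_all add: negative_partitions_def)
  have p': "partition_on (X - {}) \<pi>" using p by simp
  have sX: "singles \<pi> \<subseteq> X" using partition_onD1[OF p(1)] by (auto simp: mem_singles)
  then have fs: "finite (singles \<pi>)" using fX finite_subset by blast
  have gt: "k < a" if "a \<in> singles \<pi>" for a using that sX kX by blast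
  have "Min (insert k (singles \<pi>)) = k"
    using fs gt by (intro Min_eqI) (auto intro: less_imp_le)
  moreover have "insert k (singles \<pi>) - {k} = singles \<pi>" using gt by blast
  ultimately have vs: "sorted_list_of_set (singles (insert {k} \<pi>)) = k # sorted_list_of_set (singles \<pi>)"
    using sorted_list_of_set_nonempty[of "insert k (singles \<pi>)"] fs by (simp add: singles_insert)
  have w: "weight_exponent (insert {k} \<pi>) N = weight_exponent \<pi> N"
    by (rule weight_exponent_insert_first)
       (use block_facts[OF fX kX p'] adm in \<open>auto simp: admissible_def\<close>)
  have "flip_if (odd (card N)) J (x k # map x (sorted_list_of_set (singles \<pi>)))
    = x k # flip_if (odd (card N)) J (map x (sorted_list_of_set (singles \<pi>)))"
    using admissible_no_singles_even[OF p fX adm] fs by (intro flip_if_Cons) auto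
  then show ?thesis
    by (simp add: partition_term_def creation_scaleC creation_tens vs w blocks_insert_sing)
qed

text \<open>Each term of the contraction belongs to one way of pairing \<open>k\<close> with a singleton: the position of
  \<open>v\<close> among the singletons gives the exponent, the scalar product becomes the factor of the new
  pair, and the parity of the number of negative pairs decides where the last \<open>J\<close> stands.\<close>

lemma contraction_partition_term:
  assumes J: "selfadjoint_involution J" and mem: "(\<pi>, N) \<in> negative_partitions \<epsilon> X"
  shows "contraction q J (x k) (partition_term q J x \<pi> N) =
    (\<Sum>v\<in>singles \<pi>. \<Sum>c\<in>{c. card (singles \<pi>) = 1 \<longrightarrow> c = odd (card N)}.
       partition_term q J x (insert {k, v} (\<pi> - {{v}})) (if c then insert {k, v} N else N))"
proof -
  define T vs where "T = singles \<pi>" and "vs = sorted_list_of_set T"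
  have p: "partition_on X \<pi>" using mem by (simp add: negative_partitions_def)
  have "T \<subseteq> X" using partition_onD1[OF p] by (auto simp: mem_singles T_def)
  then have fT: "finite T" using fX finite_subset by blast
  let ?b = "odd (card N)"
  let ?C = "{c. card T = 1 \<longrightarrow> c = ?b}"
  define a where "a = complex_of_real (q ^ weight_exponent \<pi> N)
      * (\<Prod>V\<in>Pair_blocks \<pi> - N. cinner (x (Min V)) (x (Max V)))
      * (\<Prod>V\<in>N. cinner (x (Min V)) (J (x (Max V))))"
  have len: "length (map x vs) = card T" by (simp add: vs_def)
  have "contraction q J (x k) (partition_term q J x \<pi> N)
    = a *\<^sub>C contraction q J (x k) (tens (flip_if ?b J (map x vs)))"
    by (simp add: partition_term_def contraction_scaleC[OF J] a_def vs_def T_def)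
  also have "\<dots> = (\<Sum>i<card T. \<Sum>c\<in>?C.
       (a * (complex_of_real (q ^ (i + (if c then 2 * (card T - 1 - i) else 0))) * cinner (x k) (apply_if c J (map x vs ! i))))
          *\<^sub>C tens (flip_if (?b \<noteq> c) J (drop_nth i (map x vs))))"
    unfolding contraction_flip_if[OF J] len complex_vector.scale_sum_right scaleC_scaleC ..
  also have "\<dots> = (\<Sum>i<card T. \<Sum>c\<in>?C.
     partition_term q J x (insert {k, vs ! i} (\<pi> - {{vs ! i}})) (if c then insert {k, vs ! i} N else N))"
  proof (intro sum.cong refl)
    fix i c assume i: "i \<in> {..<card T}"
    define v \<rho> where "v = vs ! i" and "\<rho> = \<pi> - {{v}}"
    note s = sorted_list_nth_facts[OF fT, of i, folded vs_def, folded v_def]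
    have i': "i < card T" using i by simp
    have vT: "v \<in> singles \<pi>" using s(1) i' by (simp add: T_def)
    note d = negative_partitions_remove_single[OF fX kX mem vT, folded \<rho>_def]
    have ins: "insert {v} \<rho> = \<pi>" using vT by (auto simp: \<rho>_def mem_singles)
    have kv: "k < v" using d(1) kX by blast
    note f = block_facts[OF fX kX d(2)]
    let ?P = "{k, v}"
    let ?M = "if c then insert ?P N else N"
    have Pn: "?P \<notin> \<rho>" using f(3)[of ?P k] by blast
    then have PN: "?P \<notin> N" "?P \<notin> Pair_blocks \<rho>" using d(4) by (auto simp: Pair_blocks_def)
    have fN: "finite N" "finite (Pair_blocks \<rho>)" using f(1) d(4) by (auto simp: Pair_blocks_def intro: finite_subset)
    have Ts: "singles \<rho> = T - {v}" by (auto simp: mem_singles \<rho>_def T_def)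
    have "{s \<in> T - {v}. s < v} = {s \<in> T. s < v}" "{s \<in> T - {v}. v < s} = {s \<in> T. v < s}" by auto
    then have c1: "card {S \<in> Sing_blocks \<rho>. strict_right_of {v} S} = i"
      and c2: "card {S \<in> Sing_blocks \<rho>. strict_right_of S ?P} = card T - 1 - i"
      using s(2,3) i' kv by (simp_all add: card_singles_filter Ts strict_right_of_def)
    have "weight_exponent (insert ?P \<rho>) ?M = weight_exponent (insert {v} \<rho>) N
        + card {S \<in> Sing_blocks \<rho>. strict_right_of {v} S}
        + (if c then 2 * card {S \<in> Sing_blocks \<rho>. strict_right_of S ?P} else 0)"
      by (rule weight_exponent_pairing) (use f kv d(4) in auto)
    then have w: "weight_exponent (insert ?P \<rho>) ?M = weight_exponent \<pi> N + (i + (if c then 2 * (card T - 1 - i) else 0))"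
      unfolding c1 c2 ins by simp
    have pr: "Pair_blocks \<pi> = Pair_blocks \<rho>" unfolding ins[symmetric] blocks_insert_sing ..
    have Pb: "Pair_blocks (insert ?P \<rho>) = insert ?P (Pair_blocks \<rho>)"
      using kv by (simp add: blocks_insert_doubleton)
    have mm: "Min ?P = k" "Max ?P = v" using kv by simp_all
    have prod: "(\<Prod>V\<in>Pair_blocks (insert ?P \<rho>) - ?M. cinner (x (Min V)) (x (Max V))) * (\<Prod>V\<in>?M. cinner (x (Min V)) (J (x (Max V))))
      = (\<Prod>V\<in>Pair_blocks \<pi> - N. cinner (x (Min V)) (x (Max V))) * (\<Prod>V\<in>N. cinner (x (Min V)) (J (x (Max V))))
         * cinner (x k) (apply_if c J (x v))"
    proof (cases c)
      case True
      have "insert ?P (Pair_blocks \<rho>) - insert ?P N = Pair_blocks \<rho> - N" using PN by blast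
      then show ?thesis using True PN fN by (simp add: pr Pb mm apply_if_def)
    next
      case False
      have "insert ?P (Pair_blocks \<rho>) - N = insert ?P (Pair_blocks \<rho> - N)" using PN by blast
      then show ?thesis using False PN fN by (simp add: pr Pb mm apply_if_def)
    qed
    have par: "odd (card ?M) = (?b \<noteq> c)" using PN fN by (cases c) simp_all
    have vs: "drop_nth i vs = sorted_list_of_set (singles (insert ?P \<rho>))"
      using s(4) i' kv Ts by (simp add: singles_insert)
    have nth: "map x vs ! i = x v" using i' by (simp add: v_def vs_def)
    have "(a * (complex_of_real (q ^ (i + (if c then 2 * (card T - 1 - i) else 0))) * cinner (x k) (apply_if c J (x v))))
          *\<^sub>C tens (flip_if (?b \<noteq> c) J (map x (drop_nth i vs)))
      = partition_term q J x (insert ?P \<rho>) ?M"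
      unfolding partition_term_def par vs w mult.assoc prod unfolding a_def power_add of_real_mult
      by (simp only: mult_ac)
    then show "(a * (complex_of_real (q ^ (i + (if c then 2 * (card T - 1 - i) else 0))) * cinner (x k) (apply_if c J (map x vs ! i))))
          *\<^sub>C tens (flip_if (?b \<noteq> c) J (drop_nth i (map x vs)))
      = partition_term q J x (insert {k, vs ! i} (\<pi> - {{vs ! i}})) (if c then insert {k, vs ! i} N else N)"
      unfolding nth drop_nth_map \<rho>_def unfolding v_def .
  qed
  also have "\<dots> = (\<Sum>v\<in>T. \<Sum>c\<in>?C. partition_term q J x (insert {k, v} (\<pi> - {{v}})) (if c then insert {k, v} N else N))"
  proof (rule sum.reindex_bij_betw)
    show "bij_betw ((!) vs) {..<card T} T"
      using fT by (intro bij_betw_nth) (simp_all add: vs_def)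
  qed
  finally show ?thesis by (simp only: T_def)
qed

end

lemma creation_zero: "creation x 0 = 0"
  using creation_scaleC[of x 0 0] by simp

lemma creation_sum: "creation x (\<Sum>i\<in>A. F i) = (\<Sum>i\<in>A. creation x (F i))"
  by (induction A rule: infinite_finite_induct) (simp_all add: creation_zero creation_add)

lemma contraction_sum:
  assumes J: "selfadjoint_involution J"
  shows "contraction q J x (\<Sum>i\<in>A. F i) = (\<Sum>i\<in>A. contraction q J x (F i))"
  using contraction_scaleC[OF J, of q x 0 0]
  by (induction A rule: infinite_finite_induct) (simp_all add: contraction_add[OF J])

text \<open>The operators act from right to left, so the induction adds the points in decreasing order.\<close>

lemma d_op_moment_sum:
  assumes J: "selfadjoint_involution J" and q: "\<bar>q\<bar> < 1" and k: "1 \<le> k" "k \<le> Suc n"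
  shows "foldr (\<lambda>i. d_op q J (\<epsilon> i) (x i)) [k..<Suc n] \<Omega> =
    (\<Sum>(\<pi>, N)\<in>negative_partitions \<epsilon> {k..n}. partition_term q J x \<pi> N)"
  using k(2)
proof (induction k rule: inc_induct)
  case base
  have "negative_partitions \<epsilon> {Suc n..n} = {({}, {})}"
    by (auto simp: negative_partitions_def partition_on_empty admissible_def Pair_blocks_def compatible_def Sing_blocks_def)
  moreover have "partition_term q J x {} {} = \<Omega>"
    by (simp add: partition_term_def weight_exponent_def rel_count_def Pair_blocks_def singles_def Sing_blocks_def
        vacuum_def scaleC_one)
  ultimately show ?case by simp
next
  case (step k)
  let ?X = "{Suc k..n}"
  let ?Q = "negative_partitions \<epsilon> ?X" and ?R = "negative_partitions \<epsilon> (insert k ?X)"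
  let ?t = "partition_term q J x"
  have X: "finite ?X" "\<And>a. a \<in> ?X \<Longrightarrow> k < a" "insert k ?X = {k..n}" using step.hyps by auto
  have "[k..<Suc n] = k # [Suc k..<Suc n]" using step.hyps by (simp add: upt_conv_Cons)
  then have "foldr (\<lambda>i. d_op q J (\<epsilon> i) (x i)) [k..<Suc n] \<Omega> =
    d_op q J (\<epsilon> k) (x k) (\<Sum>(\<pi>, N)\<in>?Q. ?t \<pi> N)"
    using step.IH by simp
  also have "\<dots> = (\<Sum>(\<pi>, N)\<in>?R. ?t \<pi> N)"
  proof (cases "\<epsilon> k")
    case One
    have "d_op q J (\<epsilon> k) (x k) (\<Sum>(\<pi>, N)\<in>?Q. ?t \<pi> N) =
       (\<Sum>(\<pi>, N)\<in>?Q. contraction q J (x k) (?t \<pi> N))"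
      by (simp add: One annihilation_eq_contraction[OF J q] contraction_sum[OF J] case_prod_unfold)
    also have "\<dots> = (\<Sum>(\<pi>, N)\<in>?Q. \<Sum>v\<in>singles \<pi>. \<Sum>c\<in>{c. card (singles \<pi>) = 1 \<longrightarrow> c = odd (card N)}.
       ?t (insert {k, v} (\<pi> - {{v}})) (if c then insert {k, v} N else N))"
    proof (rule sum.cong[OF refl])
      fix z assume z: "z \<in> ?Q"
      obtain \<pi> N where "z = (\<pi>, N)" by (cases z)
      then show "(case z of (\<pi>, N) \<Rightarrow> contraction q J (x k) (?t \<pi> N)) =
        (case z of (\<pi>, N) \<Rightarrow> \<Sum>v\<in>singles \<pi>. \<Sum>c\<in>{c. card (singles \<pi>) = 1 \<longrightarrow> c = odd (card N)}.
           ?t (insert {k, v} (\<pi> - {{v}})) (if c then insert {k, v} N else N))"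
        using contraction_partition_term[OF X(1,2) J, of \<pi> N \<epsilon> q x] z by simp
    qed
    also have "\<dots> = (\<Sum>(\<pi>, N)\<in>?R. ?t \<pi> N)"
      by (rule sum_negative_partitions_One[where k = k and X = ?X and \<epsilon> = \<epsilon>, OF X(1,2) One, symmetric])
    finally show ?thesis .
  next
    case Star
    have "d_op q J (\<epsilon> k) (x k) (\<Sum>(\<pi>, N)\<in>?Q. ?t \<pi> N) =
       (\<Sum>(\<pi>, N)\<in>?Q. creation (x k) (?t \<pi> N))"
      by (simp add: Star creation_sum case_prod_unfold)
    also have "\<dots> = (\<Sum>(\<pi>, N)\<in>?Q. ?t (insert {k} \<pi>) N)"
    proof (rule sum.cong[OF refl])
      fix z assume z: "z \<in> ?Q"
      obtain \<pi> N where "z = (\<pi>, N)" by (cases z)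
      then show "(case z of (\<pi>, N) \<Rightarrow> creation (x k) (?t \<pi> N)) =
        (case z of (\<pi>, N) \<Rightarrow> ?t (insert {k} \<pi>) N)"
        using creation_partition_term[OF X(1,2), of \<pi> N \<epsilon> x q J] z by simp
    qed
    also have "\<dots> = (\<Sum>(\<pi>, N)\<in>?R. ?t \<pi> N)"
      by (rule sum_negative_partitions_Star[where k = k and X = ?X and \<epsilon> = \<epsilon>, OF X(1,2) Star, symmetric])
    finally show ?thesis .
  qed
  finally show ?case unfolding X(3) .
qed

text \<open>The coloring with negative pairs \<open>N\<close> that satisfies condition (B).\<close>

definition coloring :: "nat set set \<Rightarrow> nat set set \<Rightarrow> nat set \<Rightarrow> int" where
  "coloring \<pi> N = (\<lambda>V\<in>\<pi>. if V \<in> N then - 1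
     else if V \<in> Sing_blocks \<pi> \<and> \<not> (\<exists>T\<in>Sing_blocks \<pi>. right_of T V) then (- 1) ^ card N else 1)"

lemma minus_one_power_int: "(- 1 :: int) ^ m = (if odd m then - 1 else 1)"
  by simp

lemma admissible_iff_color_condition:
  assumes fin: "finite \<pi>" and f: "f \<in> \<pi> \<rightarrow>\<^sub>E {1, - 1}"
  shows "admissible \<pi> (neg_pairs \<pi> f) \<longleftrightarrow>
    (\<forall>V\<in>Pair_blocks \<pi>. sr \<pi> V = 0 \<and> lcr \<pi> V = 0 \<and> cover_num \<pi> V = 0 \<longrightarrow> f V = (- 1) ^ npr \<pi> f V)"
proof -
  have "f V = (- 1) ^ npr \<pi> f V \<longleftrightarrow> (V \<in> neg_pairs \<pi> f \<longleftrightarrow> odd (card {W \<in> neg_pairs \<pi> f. right_of W V}))"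
    if "V \<in> Pair_blocks \<pi>" for V
  proof -
    have "f V \<in> {1, - 1}" using that f by (auto simp: Pair_blocks_def)
    then show ?thesis using that by (auto simp: npr_def neg_pairs_def minus_one_power_int)
  qed
  then show ?thesis unfolding admissible_def extremal_iff[OF fin] by (auto simp: neg_pairs_def)
qed

lemma neg_pairs_coloring:
  assumes "N \<subseteq> Pair_blocks \<pi>" shows "neg_pairs \<pi> (coloring \<pi> N) = N"
proof -
  have "V \<notin> Sing_blocks \<pi>" if "V \<in> Pair_blocks \<pi>" for V using that by (simp add: Pair_blocks_def Sing_blocks_def)
  then show ?thesis using assms by (auto simp: neg_pairs_def coloring_def Pair_blocks_def)
qed

lemma coloring_range: "coloring \<pi> N \<in> \<pi> \<rightarrow>\<^sub>E {1, - 1}"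
  by (auto simp: coloring_def minus_one_power_int)

lemma coloring_neg_pairs:
  assumes b: "\<forall>V\<in>\<pi>. card V \<in> {1, 2}" and f: "f \<in> \<pi> \<rightarrow>\<^sub>E {1, - 1}"
    and s: "\<forall>S\<in>Sing_blocks \<pi>. f S = (if \<exists>T\<in>Sing_blocks \<pi>. right_of T S then 1 else (- 1) ^ np \<pi> f)"
  shows "coloring \<pi> (neg_pairs \<pi> f) = f"
proof
  fix V
  show "coloring \<pi> (neg_pairs \<pi> f) V = f V"
  proof (cases "V \<in> \<pi>")
    case False
    then have "f V = undefined" using PiE_arb[OF f] by blast
    then show ?thesis using False by (simp add: coloring_def)
  next
    case True
    then have fV: "f V = 1 \<or> f V = - 1" using f by auto
    consider "card V = 1" | "card V = 2" using b True by auto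
    then show ?thesis
    proof cases
      case 1
      then have "V \<in> Sing_blocks \<pi>" "V \<notin> neg_pairs \<pi> f"
        using True by (simp_all add: Sing_blocks_def neg_pairs_def Pair_blocks_def)
      then show ?thesis using s True by (simp add: coloring_def np_def)
    next
      case 2
      then have "V \<notin> Sing_blocks \<pi>" "V \<in> neg_pairs \<pi> f \<longleftrightarrow> f V = - 1"
        using True by (simp_all add: Sing_blocks_def neg_pairs_def Pair_blocks_def)
      then show ?thesis using True fV by (auto simp: coloring_def)
    qed
  qed
qed

lemma sing_tensor_eq:
  assumes fin: "finite (singles \<pi>)"
    and s: "\<forall>S\<in>Sing_blocks \<pi>. f S = (if \<exists>T\<in>Sing_blocks \<pi>. right_of T S then 1 else (- 1) ^ np \<pi> f)"
  shows "sing_tensor J x \<pi> f = tens (flip_if (odd (np \<pi> f)) J (map x (sorted_list_of_set (singles \<pi>))))"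
proof (cases "singles \<pi> = {}")
  case True
  then show ?thesis by (simp add: sing_tensor_def singles_def[symmetric] Sing_blocks_eq)
next
  case False
  define m where "m = Max (singles \<pi>)"
  have m: "m \<in> singles \<pi>" "\<And>s. s \<in> singles \<pi> \<Longrightarrow> s \<le> m" using False fin by (simp_all add: m_def)
  have "\<not> (\<exists>T\<in>Sing_blocks \<pi>. right_of T {m})" using m(2) by (fastforce simp: Sing_blocks_eq right_of_def)
  then have "f {m} = (- 1) ^ np \<pi> f" using s m(1) by (simp add: Sing_blocks_eq)
  then have ex: "(\<exists>S\<in>Sing_blocks \<pi>. f S = - 1) \<longleftrightarrow> odd (np \<pi> f)"
    using s m(1) by (auto simp: Sing_blocks_eq minus_one_power_int split: if_splits)
  have "sorted_list_of_set (singles \<pi>) \<noteq> []" using False fin by simp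
  then show ?thesis unfolding sing_tensor_def Let_def ex singles_def[symmetric]
    by (simp add: flip_if_def flip_last_def map_butlast last_map)
qed

theorem theorem4p11:
  fixes J :: "'h::chilbert_space \<Rightarrow> 'h"
    and q :: real and n :: nat and x :: "nat \<Rightarrow> 'h" and \<epsilon> :: "nat \<Rightarrow> exponent"
  assumes "selfadjoint_involution J"
    and "- 1 < q" and "q < 1" and "n \<ge> 1"
  shows "foldr (\<lambda>i. d_op q J (\<epsilon> i) (x i)) [1..<Suc n] \<Omega> =
    (\<Sum>(\<pi>, f)\<in>PD12_eps n \<epsilon>.
       (complex_of_real (q ^ (cr \<pi> + cs \<pi> + 2 * cnp \<pi> f + 2 * npssr \<pi> f))
        * (\<Prod>V\<in>{V \<in> Pair_blocks \<pi>. f V = 1}. cinner (x (Min V)) (x (Max V)))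
        * (\<Prod>V\<in>{V \<in> Pair_blocks \<pi>. f V = - 1}. cinner (x (Min V)) (J (x (Max V)))))
       *\<^sub>C sing_tensor J x \<pi> f)"
proof -
  have eq: "foldr (\<lambda>i. d_op q J (\<epsilon> i) (x i)) [1..<Suc n] \<Omega> =
    (\<Sum>(\<pi>, N)\<in>negative_partitions \<epsilon> {1..n}. partition_term q J x \<pi> N)"
    using assms by (intro d_op_moment_sum) auto
  show ?thesis unfolding eq
  proof (rule sum.reindex_bij_witness[where j = "\<lambda>(\<pi>, N). (\<pi>, coloring \<pi> N)"
        and i = "\<lambda>(\<pi>, f). (\<pi>, neg_pairs \<pi> f)"])
    have fin: "finite \<pi>" if "partition_on {1..n} \<pi>" for \<pi> using finite_elements[OF _ that] by simp
    {
      fix z assume "z \<in> negative_partitions \<epsilon> {1..n}"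
      then obtain \<pi> N where z: "z = (\<pi>, N)" "(\<pi>, N) \<in> negative_partitions \<epsilon> {1..n}" by (metis prod.exhaust)
      then have p: "partition_on {1..n} \<pi>" "\<forall>V\<in>\<pi>. card V \<in> {1, 2}" "admissible \<pi> N" "compatible \<epsilon> \<pi>"
        by (simp_all add: negative_partitions_def)
      have N: "N \<subseteq> Pair_blocks \<pi>" using p(3) by (simp add: admissible_def)
      note np = neg_pairs_coloring[OF N]
      show "(case case z of (\<pi>, N) \<Rightarrow> (\<pi>, coloring \<pi> N) of (\<pi>, f) \<Rightarrow> (\<pi>, neg_pairs \<pi> f)) = z"
        using np z(1) by simp
      have s: "\<forall>S\<in>Sing_blocks \<pi>. coloring \<pi> N S = (if \<exists>T\<in>Sing_blocks \<pi>. right_of T S then 1 else (- 1) ^ np \<pi> (coloring \<pi> N))"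
      proof
        fix S assume S: "S \<in> Sing_blocks \<pi>"
        then have "S \<in> \<pi>" "S \<notin> N" using N by (auto simp: Sing_blocks_def Pair_blocks_def)
        then show "coloring \<pi> N S = (if \<exists>T\<in>Sing_blocks \<pi>. right_of T S then 1 else (- 1) ^ np \<pi> (coloring \<pi> N))"
          using S by (simp add: coloring_def np_def np[unfolded coloring_def])
      qed
      have "\<forall>V\<in>Pair_blocks \<pi>. sr \<pi> V = 0 \<and> lcr \<pi> V = 0 \<and> cover_num \<pi> V = 0 \<longrightarrow>
          coloring \<pi> N V = (- 1) ^ npr \<pi> (coloring \<pi> N) V"
        using admissible_iff_color_condition[OF fin[OF p(1)] coloring_range, of N] p(3) np by simp
      then show "(case z of (\<pi>, N) \<Rightarrow> (\<pi>, coloring \<pi> N)) \<in> PD12_eps n \<epsilon>"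
        using p s coloring_range[of \<pi> N] unfolding z(1) by (simp add: PD12_eps_def PD12_def P12_def)
      have cpos: "{V \<in> Pair_blocks \<pi>. coloring \<pi> N V = 1} = Pair_blocks \<pi> - N"
        and cneg: "{V \<in> Pair_blocks \<pi>. coloring \<pi> N V = - 1} = N"
      proof -
        show "{V \<in> Pair_blocks \<pi>. coloring \<pi> N V = - 1} = N" using np by (simp add: neg_pairs_def)
        moreover have "coloring \<pi> N V = 1 \<or> coloring \<pi> N V = - 1" if "V \<in> Pair_blocks \<pi>" for V
          using that coloring_range[of \<pi> N] by (auto simp: Pair_blocks_def)
        ultimately show "{V \<in> Pair_blocks \<pi>. coloring \<pi> N V = 1} = Pair_blocks \<pi> - N" by force
      qed
      have "singles \<pi> \<subseteq> {1..n}" using partition_onD1[OF p(1)] by (auto simp: mem_singles)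
      then have "finite (singles \<pi>)" using finite_subset by blast
      then have "sing_tensor J x \<pi> (coloring \<pi> N) = tens (flip_if (odd (card N)) J (map x (sorted_list_of_set (singles \<pi>))))"
        using sing_tensor_eq[OF _ s] by (simp add: np_def np)
      moreover have "cr \<pi> + cs \<pi> + 2 * cnp \<pi> (coloring \<pi> N) + 2 * npssr \<pi> (coloring \<pi> N) = weight_exponent \<pi> N"
        by (simp add: weight_exponent_def cr_eq_rel_count[OF fin[OF p(1)]] cs_eq_rel_count cnp_def npssr_def np rel_count_def)
      ultimately show "(case case z of (\<pi>, N) \<Rightarrow> (\<pi>, coloring \<pi> N) of (\<pi>, f) \<Rightarrow>
          (complex_of_real (q ^ (cr \<pi> + cs \<pi> + 2 * cnp \<pi> f + 2 * npssr \<pi> f))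
          * (\<Prod>V\<in>{V \<in> Pair_blocks \<pi>. f V = 1}. cinner (x (Min V)) (x (Max V)))
          * (\<Prod>V\<in>{V \<in> Pair_blocks \<pi>. f V = - 1}. cinner (x (Min V)) (J (x (Max V)))))
         *\<^sub>C sing_tensor J x \<pi> f) = (case z of (\<pi>, N) \<Rightarrow> partition_term q J x \<pi> N)"
        unfolding z(1) prod.case by (simp only: partition_term_def cpos cneg)
    next
      fix z assume "z \<in> PD12_eps n \<epsilon>"
      then obtain \<pi> f where z: "z = (\<pi>, f)" "(\<pi>, f) \<in> PD12_eps n \<epsilon>" by (metis prod.exhaust)
      then have p: "partition_on {1..n} \<pi>" "\<forall>V\<in>\<pi>. card V \<in> {1, 2}" "compatible \<epsilon> \<pi>" "f \<in> \<pi> \<rightarrow>\<^sub>E {1, - 1}"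
        and a: "\<forall>V\<in>Pair_blocks \<pi>. sr \<pi> V = 0 \<and> lcr \<pi> V = 0 \<and> cover_num \<pi> V = 0 \<longrightarrow> f V = (- 1) ^ npr \<pi> f V"
        and s: "\<forall>S\<in>Sing_blocks \<pi>. f S = (if \<exists>T\<in>Sing_blocks \<pi>. right_of T S then 1 else (- 1) ^ np \<pi> f)"
        unfolding PD12_eps_def PD12_def P12_def by auto
      show "(case case z of (\<pi>, f) \<Rightarrow> (\<pi>, neg_pairs \<pi> f) of (\<pi>, N) \<Rightarrow> (\<pi>, coloring \<pi> N)) = z"
        using coloring_neg_pairs[OF p(2,4) s] z(1) by simp
      have "admissible \<pi> (neg_pairs \<pi> f)"
        using admissible_iff_color_condition[OF fin[OF p(1)] p(4)] a by blast
      then show "(case z of (\<pi>, f) \<Rightarrow> (\<pi>, neg_pairs \<pi> f)) \<in> negative_partitions \<epsilon> {1..n}"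
        using p z(1) by (simp add: negative_partitions_def)
    }
  qed
qed

end
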